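(* (Working in von Neumann–Bernays–Gödel class theory without the Axiom of Choice.) If $j\colon V\to V$ is a non-trivial elementary embedding with critical sequence $\langle\lambda_m:m<\omega\rangle$, then $\lambda_0$ is parametrically $n$-ultraexact for $\langle\lambda_{m+1}:m<\omega\rangle$, for every natural number $n>0$.
   Context: The critical sequence of $j$ is given by $\lambda_0=\mathrm{crit}(j)$, $\lambda_{m+1}=j(\lambda_m)$. $C^{(n)}$ denotes the class of cardinals $\nu$ with $V_\nu\prec_{\Sigma_n}V$. For $n>0$ and a limit cardinal $\lambda$: given a cardinal $\eta\in C^{(n)}$ with $\eta>\lambda$, an elementary submodel $X\prec V_\eta$ with $V_\lambda\cup\{\lambda\}\subseteq X$, and a cardinal $\zeta\in C^{(n+1)}$ with $\zeta>\lambda$, an elementary embedding $k\colon X\to V_\zeta$ is an $n$-ultraexact embedding at $\lambda$ if $k(\lambda)=\lambda$, $k\restriction\lambda\neq\mathrm{id}_\lambda$ and $k\restriction V_\lambda\in X$. Given a strictly increasing sequence $\vec\mu=\langle\mu_m:m<\omega\rangle$ of cardinals with supremum $\lambda$, a cardinal $\kappa<\mu_0$ is parametrically $n$-ultraexact for $\vec\mu$ if for every $A\in V_{\lambda+1}$ there is an $n$-ultraexact embedding $k\colon X\to V_\zeta$ at $\lambda$ with $A\in\mathrm{ran}(k)$, $k(\kappa)=\mu_0$, $k(\mu_m)=\mu_{m+1}$ for all $m<\omega$, and $k(\mathrm{crit}(k))=\kappa$. *)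

theory Defs
  imports Main
begin

text \<open>
  Working in NBG is rendered by an arbitrary model of NBG: the elements of a type \<open>'c\<close> are the
  classes, \<open>mem\<close> is membership, and sets are the classes that belong to some class. The model may be
  ill-founded from outside (its \<open>\<omega>\<close> may be nonstandard), so two kinds of formulas have to be kept
  apart. The datatype \<open>fm\<close> is the metalanguage of the schemas (class comprehension, elementarity of
  \<open>j : V \<rightarrow> V\<close>); elementarity between set-sized structures, and \<open>\<Sigma>\<^sub>n\<close>-elementarity of
  \<open>V\<^sub>\<nu>\<close> in \<open>V\<close>, refer to formulas coded as sets inside the model.
\<close>

datatype fm =
    FMem nat nat
  | FEq nat nat
  | FNeg fm
  | FConj fm fm
  | FEx nat fm

locale class_structure =
  fixes mem :: "'c \<Rightarrow> 'c \<Rightarrow> bool"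
begin

definition elts :: "'c \<Rightarrow> 'c set" where
  "elts A = {x. mem x A}"

definition sets :: "'c set" where
  "sets = {x. \<exists>A. x \<in> elts A}"

text \<open>Quantifiers range over sets only, so class comprehension below is predicative.\<close>

primrec tru :: "fm \<Rightarrow> (nat \<Rightarrow> 'c) \<Rightarrow> bool" where
  "tru (FMem a b) e \<longleftrightarrow> e a \<in> elts (e b)"
| "tru (FEq a b) e \<longleftrightarrow> e a = e b"
| "tru (FNeg p) e \<longleftrightarrow> \<not> tru p e"
| "tru (FConj p q) e \<longleftrightarrow> tru p e \<and> tru q e"
| "tru (FEx a p) e \<longleftrightarrow> (\<exists>x\<in>sets. tru p (e(a := x)))"

text \<open>The class \<open>{x | P x}\<close>; meaningful because every \<open>P\<close> used below is first order over sets.\<close>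

definition Coll :: "('c \<Rightarrow> bool) \<Rightarrow> 'c" where
  "Coll P = (THE A. elts A = {x \<in> sets. P x})"

definition Univ :: 'c where
  "Univ = Coll (\<lambda>x. True)"

definition empty :: 'c where
  "empty = Coll (\<lambda>x. False)"

definition succ :: "'c \<Rightarrow> 'c" where
  "succ x = Coll (\<lambda>w. w \<in> elts x \<or> w = x)"

definition upair :: "'c \<Rightarrow> 'c \<Rightarrow> 'c" where
  "upair x y = Coll (\<lambda>w. w = x \<or> w = y)"

definition opair :: "'c \<Rightarrow> 'c \<Rightarrow> 'c" where
  "opair x y = upair (upair x x) (upair x y)"

definition is_fun :: "'c \<Rightarrow> 'c \<Rightarrow> 'c \<Rightarrow> bool" where
  "is_fun f A B \<longleftrightarrow>
     (\<forall>p\<in>elts f. \<exists>x\<in>elts A. \<exists>y\<in>elts B. p = opair x y) \<and>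
     (\<forall>x\<in>elts A. \<exists>!y. y \<in> elts B \<and> opair x y \<in> elts f)"

definition app :: "'c \<Rightarrow> 'c \<Rightarrow> 'c" where
  "app f x = (THE y. y \<in> sets \<and> opair x y \<in> elts f)"

definition restrict :: "'c \<Rightarrow> 'c \<Rightarrow> 'c" where
  "restrict f A = Coll (\<lambda>p. p \<in> elts f \<and> (\<exists>x\<in>elts A. \<exists>y\<in>sets. p = opair x y))"

definition ident :: "'c \<Rightarrow> 'c" where
  "ident A = Coll (\<lambda>p. \<exists>x\<in>elts A. p = opair x x)"

definition transitive :: "'c \<Rightarrow> bool" where
  "transitive x \<longleftrightarrow> (\<forall>y\<in>elts x. elts y \<subseteq> elts x)"

definition Ord :: "'c \<Rightarrow> bool" where
  "Ord x \<longleftrightarrow> x \<in> sets \<and> transitive x \<and> (\<forall>y\<in>elts x. transitive y)"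

definition omega :: 'c where
  "omega = Coll (\<lambda>x. \<forall>I\<in>sets. empty \<in> elts I \<and> (\<forall>y\<in>elts I. succ y \<in> elts I) \<longrightarrow> x \<in> elts I)"

definition is_bij :: "'c \<Rightarrow> 'c \<Rightarrow> 'c \<Rightarrow> bool" where
  "is_bij f A B \<longleftrightarrow> is_fun f A B \<and> (\<forall>y\<in>elts B. \<exists>!x. x \<in> elts A \<and> app f x = y)"

text \<open>In the absence of choice, cardinals are initial ordinals.\<close>

definition Card :: "'c \<Rightarrow> bool" where
  "Card \<kappa> \<longleftrightarrow> Ord \<kappa> \<and> \<not> (\<exists>\<alpha>\<in>elts \<kappa>. \<exists>f\<in>sets. is_bij f \<alpha> \<kappa>)"

definition limit_Card :: "'c \<Rightarrow> bool" where
  "limit_Card l \<longleftrightarrow> Card l \<and> l \<noteq> empty \<and> (\<forall>\<alpha>\<in>elts l. \<exists>\<mu>\<in>elts l. Card \<mu> \<and> \<alpha> \<in> elts \<mu>)"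

text \<open>\<open>V\<^sub>\<alpha>\<close>, by the recursion \<open>V\<^sub>\<beta> = (\<Union>\<gamma><\<beta>. P(V\<^sub>\<gamma>))\<close>.\<close>

definition Vlev :: "'c \<Rightarrow> 'c" where
  "Vlev \<alpha> = (THE v. \<exists>f\<in>sets. is_fun f (succ \<alpha>) Univ \<and>
     (\<forall>\<beta>\<in>elts (succ \<alpha>). app f \<beta> = Coll (\<lambda>x. \<exists>\<gamma>\<in>elts \<beta>. elts x \<subseteq> elts (app f \<gamma>))) \<and>
     v = app f \<alpha>)"

text \<open>
  Formulas coded inside the model; variables are indexed by elements of the model's \<open>\<omega>\<close>.
\<close>

definition cMem :: "'c \<Rightarrow> 'c \<Rightarrow> 'c" where
  "cMem a b = opair empty (opair a b)"

definition cEq :: "'c \<Rightarrow> 'c \<Rightarrow> 'c" where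
  "cEq a b = opair (succ empty) (opair a b)"

definition cNeg :: "'c \<Rightarrow> 'c" where
  "cNeg p = opair (succ (succ empty)) p"

definition cConj :: "'c \<Rightarrow> 'c \<Rightarrow> 'c" where
  "cConj p q = opair (succ (succ (succ empty))) (opair p q)"

definition cEx :: "'c \<Rightarrow> 'c \<Rightarrow> 'c" where
  "cEx a p = opair (succ (succ (succ (succ empty)))) (opair a p)"

definition form_closed :: "'c \<Rightarrow> bool" where
  "form_closed F \<longleftrightarrow>
     (\<forall>a\<in>elts omega. \<forall>b\<in>elts omega. cMem a b \<in> elts F \<and> cEq a b \<in> elts F) \<and>
     (\<forall>p\<in>elts F. cNeg p \<in> elts F) \<and>
     (\<forall>p\<in>elts F. \<forall>q\<in>elts F. cConj p q \<in> elts F) \<and>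
     (\<forall>a\<in>elts omega. \<forall>p\<in>elts F. cEx a p \<in> elts F)"

definition Form :: 'c where
  "Form = Coll (\<lambda>p. \<forall>F\<in>sets. form_closed F \<longrightarrow> p \<in> elts F)"

definition delta0_closed :: "'c \<Rightarrow> bool" where
  "delta0_closed F \<longleftrightarrow>
     (\<forall>a\<in>elts omega. \<forall>b\<in>elts omega. cMem a b \<in> elts F \<and> cEq a b \<in> elts F) \<and>
     (\<forall>p\<in>elts F. cNeg p \<in> elts F) \<and>
     (\<forall>p\<in>elts F. \<forall>q\<in>elts F. cConj p q \<in> elts F) \<and>
     (\<forall>a\<in>elts omega. \<forall>b\<in>elts omega. \<forall>p\<in>elts F.
        a \<noteq> b \<longrightarrow> cEx a (cConj (cMem a b) p) \<in> elts F)"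

definition Delta0 :: 'c where
  "Delta0 = Coll (\<lambda>p. \<forall>F\<in>sets. delta0_closed F \<longrightarrow> p \<in> elts F)"

text \<open>
  Assignments are total functions from \<open>\<omega>\<close>, so the empty structure has none; the structures
  compared in the definition of ultraexact embeddings all contain \<open>\<lambda>\<close>.
\<close>

definition assignment :: "'c \<Rightarrow> 'c \<Rightarrow> bool" where
  "assignment M s \<longleftrightarrow> s \<in> sets \<and> is_fun s omega M"

definition upd :: "'c \<Rightarrow> 'c \<Rightarrow> 'c \<Rightarrow> 'c" where
  "upd s a x = Coll (\<lambda>p. (p \<in> elts s \<and> \<not> (\<exists>y\<in>sets. p = opair a y)) \<or> p = opair a x)"

definition comp :: "'c \<Rightarrow> 'c \<Rightarrow> 'c" where
  "comp k s = Coll (\<lambda>p. \<exists>a\<in>elts omega. p = opair a (app k (app s a)))"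

definition sat_relation :: "'c \<Rightarrow> 'c \<Rightarrow> bool" where
  "sat_relation M S \<longleftrightarrow> (\<forall>s. assignment M s \<longrightarrow>
     (\<forall>a\<in>elts omega. \<forall>b\<in>elts omega.
        (opair (cMem a b) s \<in> elts S \<longleftrightarrow> app s a \<in> elts (app s b)) \<and>
        (opair (cEq a b) s \<in> elts S \<longleftrightarrow> app s a = app s b)) \<and>
     (\<forall>p\<in>elts Form. opair (cNeg p) s \<in> elts S \<longleftrightarrow> opair p s \<notin> elts S) \<and>
     (\<forall>p\<in>elts Form. \<forall>q\<in>elts Form.
        opair (cConj p q) s \<in> elts S \<longleftrightarrow> opair p s \<in> elts S \<and> opair q s \<in> elts S) \<and>
     (\<forall>a\<in>elts omega. \<forall>p\<in>elts Form.
        opair (cEx a p) s \<in> elts S \<longleftrightarrow> (\<exists>x\<in>elts M. opair p (upd s a x) \<in> elts S)))"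

definition Sat :: "'c \<Rightarrow> 'c \<Rightarrow> 'c \<Rightarrow> bool" where
  "Sat M p s \<longleftrightarrow> (\<exists>S\<in>sets. sat_relation M S \<and> opair p s \<in> elts S)"

definition elementary_submodel :: "'c \<Rightarrow> 'c \<Rightarrow> bool" where
  "elementary_submodel X M \<longleftrightarrow> elts X \<subseteq> elts M \<and>
     (\<forall>p\<in>elts Form. \<forall>s. assignment X s \<longrightarrow> (Sat X p s \<longleftrightarrow> Sat M p s))"

definition elementary_embedding :: "'c \<Rightarrow> 'c \<Rightarrow> 'c \<Rightarrow> bool" where
  "elementary_embedding k X M \<longleftrightarrow> is_fun k X M \<and>
     (\<forall>p\<in>elts Form. \<forall>s. assignment X s \<longrightarrow> (Sat X p s \<longleftrightarrow> Sat M p (comp k s)))"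

text \<open>
  Coded \<open>\<Sigma>\<^sub>n\<close> formulas (a \<open>\<Sigma>\<^sub>n\<^sub>+\<^sub>1\<close> formula is an existential quantifier followed by the negation of
  a \<open>\<Sigma>\<^sub>n\<close> formula) and their truth in \<open>V\<close>. The number \<open>n\<close> belongs to the metatheory, since truth in
  \<open>V\<close> is definable only level by level. \<open>\<Delta>\<^sub>0\<close> truth is evaluated in a transitive set containing the
  parameters.
\<close>

primrec sigma_form :: "nat \<Rightarrow> 'c \<Rightarrow> bool" where
  "sigma_form 0 p \<longleftrightarrow> p \<in> elts Delta0"
| "sigma_form (Suc n) p \<longleftrightarrow> (\<exists>a\<in>elts omega. \<exists>q\<in>sets. sigma_form n q \<and> p = cEx a (cNeg q))"

primrec sigma_true :: "nat \<Rightarrow> 'c \<Rightarrow> 'c \<Rightarrow> bool" where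
  "sigma_true 0 p s \<longleftrightarrow> (\<exists>M\<in>sets. transitive M \<and> assignment M s \<and> Sat M p s)"
| "sigma_true (Suc n) p s \<longleftrightarrow>
     (\<exists>a\<in>elts omega. \<exists>q\<in>sets. p = cEx a (cNeg q) \<and> (\<exists>x\<in>sets. \<not> sigma_true n q (upd s a x)))"

definition C_class :: "nat \<Rightarrow> 'c \<Rightarrow> bool" where
  "C_class n \<nu> \<longleftrightarrow> Card \<nu> \<and>
     (\<forall>p s. sigma_form n p \<longrightarrow> assignment (Vlev \<nu>) s \<longrightarrow>
        (Sat (Vlev \<nu>) p s \<longleftrightarrow> sigma_true n p s))"

text \<open>The least ordinal of the domain \<open>D\<close> moved by \<open>f\<close>; \<open>D\<close> need not be transitive.\<close>

definition crit :: "'c \<Rightarrow> 'c \<Rightarrow> 'c" where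
  "crit f D = (THE \<alpha>. \<alpha> \<in> elts D \<and> Ord \<alpha> \<and> app f \<alpha> \<noteq> \<alpha> \<and>
     (\<forall>\<beta>\<in>elts \<alpha>. \<beta> \<in> elts D \<longrightarrow> app f \<beta> = \<beta>))"

definition ultraexact_embedding :: "nat \<Rightarrow> 'c \<Rightarrow> 'c \<Rightarrow> 'c \<Rightarrow> 'c \<Rightarrow> 'c \<Rightarrow> bool" where
  "ultraexact_embedding n l \<eta> X \<zeta> k \<longleftrightarrow>
     n > 0 \<and> limit_Card l \<and>
     C_class n \<eta> \<and> l \<in> elts \<eta> \<and>
     elementary_submodel X (Vlev \<eta>) \<and> elts (Vlev l) \<union> {l} \<subseteq> elts X \<and>
     C_class (n + 1) \<zeta> \<and> l \<in> elts \<zeta> \<and>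
     elementary_embedding k X (Vlev \<zeta>) \<and>
     app k l = l \<and> restrict k l \<noteq> ident l \<and> restrict k (Vlev l) \<in> elts X"

text \<open>The supremum of a sequence of ordinals is its union.\<close>

definition seq_sup :: "'c \<Rightarrow> 'c" where
  "seq_sup \<mu> = Coll (\<lambda>x. \<exists>m\<in>elts omega. x \<in> elts (app \<mu> m))"

definition parametrically_ultraexact :: "nat \<Rightarrow> 'c \<Rightarrow> 'c \<Rightarrow> bool" where
  "parametrically_ultraexact n \<kappa> \<mu> \<longleftrightarrow>
     \<mu> \<in> sets \<and> is_fun \<mu> omega Univ \<and>
     (\<forall>m\<in>elts omega. Card (app \<mu> m)) \<and>
     (\<forall>m\<in>elts omega. \<forall>i\<in>elts m. app \<mu> i \<in> elts (app \<mu> m)) \<and>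
     Card \<kappa> \<and> \<kappa> \<in> elts (app \<mu> empty) \<and>
     (\<forall>A\<in>elts (Vlev (succ (seq_sup \<mu>))).
        \<exists>\<eta>\<in>sets. \<exists>X\<in>sets. \<exists>\<zeta>\<in>sets. \<exists>k\<in>sets.
          ultraexact_embedding n (seq_sup \<mu>) \<eta> X \<zeta> k \<and>
          (\<exists>x\<in>elts X. app k x = A) \<and>
          app k \<kappa> = app \<mu> empty \<and>
          (\<forall>m\<in>elts omega. app k (app \<mu> m) = app \<mu> (succ m)) \<and>
          app k (crit k X) = \<kappa>)"

text \<open>
  Full elementarity of a class function on \<open>V\<close> is a schema over the formulas of the metatheory.
\<close>

definition elementary_V :: "'c \<Rightarrow> bool" where
  "elementary_V j \<longleftrightarrow> is_fun j Univ Univ \<and>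
     (\<forall>p e. range e \<subseteq> sets \<longrightarrow> (tru p e \<longleftrightarrow> tru p (\<lambda>a. app j (e a))))"

definition nontrivial_V :: "'c \<Rightarrow> bool" where
  "nontrivial_V j \<longleftrightarrow> (\<exists>x\<in>sets. app j x \<noteq> x)"

definition critical_sequence :: "'c \<Rightarrow> 'c" where
  "critical_sequence j = (THE l. l \<in> sets \<and> is_fun l omega Univ \<and>
     app l empty = crit j Univ \<and> (\<forall>m\<in>elts omega. app l (succ m) = app j (app l m)))"

definition seq_shift :: "'c \<Rightarrow> 'c" where
  "seq_shift l = Coll (\<lambda>p. \<exists>m\<in>elts omega. p = opair m (app l (succ m)))"

end

text \<open>NBG with neither global choice nor choice for sets.\<close>

locale nbg = class_structure mem for mem :: "'c \<Rightarrow> 'c \<Rightarrow> bool" +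
  assumes extensionality: "elts A = elts B \<Longrightarrow> A = B"
    and comprehension: "\<exists>A. elts A = {x \<in> sets. tru p (e(0 := x))}"
    and pairing: "\<lbrakk>x \<in> sets; y \<in> sets\<rbrakk> \<Longrightarrow> \<exists>z\<in>sets. elts z = {x, y}"
    and union: "x \<in> sets \<Longrightarrow> \<exists>u\<in>sets. elts u = (\<Union>y\<in>elts x. elts y)"
    and power_set: "x \<in> sets \<Longrightarrow> \<exists>w\<in>sets. elts w = {y \<in> sets. elts y \<subseteq> elts x}"
    and infinity: "\<exists>I\<in>sets. empty \<in> elts I \<and> (\<forall>y\<in>elts I. succ y \<in> elts I)"
    and replacement:
      "\<lbrakk>x \<in> sets; \<And>u v w. \<lbrakk>v \<in> sets; w \<in> sets; opair u v \<in> elts F; opair u w \<in> elts F; u \<in> elts x\<rbrakk> \<Longrightarrow> v = w\<rbrakk>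
       \<Longrightarrow> \<exists>y\<in>sets. elts y = {v \<in> sets. \<exists>u\<in>elts x. opair u v \<in> elts F}"
    and foundation: "elts A \<noteq> {} \<Longrightarrow> \<exists>x\<in>elts A. elts x \<inter> elts A = {}"

end

theory Submission
  imports Defs
begin

text \<open>
  Let \<open>\<kappa>\<close> be the critical point, \<open>\<lambda>\<close> the supremum of the critical sequence and \<open>\<eta>\<close> the least limit
  ordinal above \<open>\<lambda>\<close> in \<open>C\<^sup>(\<^sup>n\<^sup>) \<inter> C\<^sup>(\<^sup>n\<^sup>+\<^sup>1\<^sup>)\<close>. Since \<open>j(\<lambda>) = \<lambda>\<close> and \<open>\<eta>\<close> is definable from \<open>\<lambda>\<close>,
  also \<open>j(\<eta>) = \<eta>\<close>. The restriction of \<open>j\<close> to \<open>V\<^sub>\<eta>\<close> is an elementary embedding of \<open>V\<^sub>\<eta>\<close> into itself, it has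
  \<open>j(A)\<close> in its range for every \<open>A \<subseteq> V\<^sub>\<lambda>\<close>, it maps its critical point \<open>\<kappa>\<close> to \<open>j(\<kappa>)\<close>, and it shifts the
  sequence \<open>j(\<mu>)\<close>, where \<open>\<mu>\<close> is the shifted critical sequence. The existence of an embedding of \<open>V\<^sub>\<eta>\<close> with
  these properties is a first-order statement about \<open>j(A), j(\<kappa>), j(\<mu>)\<close> and fixed parameters, so by
  elementarity of \<open>j\<close> it holds for \<open>A, \<kappa>, \<mu>\<close>.
\<close>

text \<open>Elementarity of \<open>j\<close> is a schema over metatheoretic formulas that do not
  mention \<open>j\<close>, whereas ultraexactness quantifies over formulas coded in the model,
  possibly of nonstandard length. The bridge is that \<open>j\<close> fixes every coded formula:
  then the single instance of the schema for \<open>Sat\<close> makes the restriction of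
  \<open>j\<close> elementary in the internal sense. Most operations of the definitions are
  descriptions whose values off the intended domain are described by no formula. This forces a
  calculus of definable conditions with an explicit parameter set, and relational substitutes for
  \<open>app\<close>, \<open>crit\<close> and \<open>comp\<close> wherever elementarity is applied.
  The existence of \<eta> is the other obstacle. Its construction must be choice-free, so witnesses
  are always replaced by least ordinals or whole levels, and it needs an ordinal in which no
  omega-sequence is cofinal. The critical point is one, because \<open>j\<close> does not move the
  values of a sequence from omega into \<kappa>. The embedding obtained in the end is never the
  restriction of \<open>j\<close>: that one sends its critical point to \<open>j\<close>(\<kappa>),
  while pulling \<open>j\<close>(\<kappa>) back to \<kappa> yields one that sends its critical point
  to \<kappa>.\<close>

named_theorems dfn_intros

text \<open>A strict bound on all variable indices of a formula, bound ones included; it serves to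
  find fresh variables.\<close>

primrec fm_bound :: "fm \<Rightarrow> nat" where
  "fm_bound (FMem a b) = Suc (max a b)"
| "fm_bound (FEq a b) = Suc (max a b)"
| "fm_bound (FNeg p) = fm_bound p"
| "fm_bound (FConj p q) = max (fm_bound p) (fm_bound q)"
| "fm_bound (FEx a p) = max (Suc a) (fm_bound p)"

section \<open>Definability\<close>

context class_structure
begin

lemma tru_cong: "(\<And>i. i < fm_bound p \<Longrightarrow> e i = e' i) \<Longrightarrow> tru p e \<longleftrightarrow> tru p e'"
proof (induction p arbitrary: e e')
  case (FEx a p)
  have "tru p (e(a := x)) \<longleftrightarrow> tru p (e'(a := x))" for x
    by (rule FEx.IH) (use FEx.prems in auto)
  then show ?case by simp
next
  case (FConj p q)
  have "tru p e = tru p e'" by (rule FConj.IH(1)) (use FConj.prems in auto)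
  moreover have "tru q e = tru q e'" by (rule FConj.IH(2)) (use FConj.prems in auto)
  ultimately show ?case by simp
next
  case (FNeg p)
  have "tru p e = tru p e'" by (rule FNeg.IH) (use FNeg.prems in auto)
  then show ?case by simp
qed auto

text \<open>Substitution can capture, so at a quantifier the bound variable moves to an index
  \<open>M\<close> beyond the image of \<open>r\<close>. As \<open>r\<close> is an arbitrary map,
  this one lemma supplies all index shifts between metatheoretic formulas and the de Bruijn
  convention.\<close>

lemma tru_rename: "\<exists>p'. \<forall>e. tru p' e \<longleftrightarrow> tru p (\<lambda>i. e (r i))"
proof (induction p arbitrary: r)
  case (FMem a b)
  then show ?case by (intro exI[of _ "FMem (r a) (r b)"]) simp
next
  case (FEq a b)
  then show ?case by (intro exI[of _ "FEq (r a) (r b)"]) simp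
next
  case (FNeg p)
  obtain p' where "\<forall>e. tru p' e \<longleftrightarrow> tru p (\<lambda>i. e (r i))" using FNeg.IH[of r] by (rule exE)
  then show ?case by (intro exI[of _ "FNeg p'"]) simp
next
  case (FConj p q)
  obtain p' where "\<forall>e. tru p' e \<longleftrightarrow> tru p (\<lambda>i. e (r i))" using FConj.IH(1)[of r] by (rule exE)
  moreover obtain q' where "\<forall>e. tru q' e \<longleftrightarrow> tru q (\<lambda>i. e (r i))"
    using FConj.IH(2)[of r] by (rule exE)
  ultimately show ?case by (intro exI[of _ "FConj p' q'"]) simp
next
  case (FEx a p)
  define M where "M = Suc (Max (insert 0 (r ` {..<fm_bound p})))"
  have fresh: "r i \<noteq> M" if "i < fm_bound p" for i
  proof -
    have "r i \<le> Max (insert 0 (r ` {..<fm_bound p}))" using that by (intro Max_ge) auto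
    then show ?thesis by (simp add: M_def)
  qed
  obtain p' where p': "\<forall>e. tru p' e \<longleftrightarrow> tru p (\<lambda>i. e ((r(a := M)) i))"
    using FEx.IH[of "r(a := M)"] by (rule exE)
  have "tru p (\<lambda>i. (e(M := x)) ((r(a := M)) i)) \<longleftrightarrow> tru p ((\<lambda>i. e (r i))(a := x))" for e x
    by (rule tru_cong) (auto simp: fresh)
  then show ?case using p' by (intro exI[of _ "FEx M p'"]) simp
qed

text \<open>
  A condition on environments of sets is \<open>dfn K\<close> if it is first order over the sets, with class
  parameters from \<open>K\<close>. For \<open>K = UNIV\<close> this is what comprehension accepts; for \<open>K\<close> the sets fixed by an
  embedding of \<open>V\<close> it is what the embedding preserves. A function is \<open>tm K\<close> if it maps set environments to
  sets and has a definable graph. Variables are de Bruijn indices: below a quantifier \<open>e 0\<close> is the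
  bound variable and \<open>e\<close> is shifted.
\<close>

definition penv :: "'c list \<Rightarrow> (nat \<Rightarrow> 'c) \<Rightarrow> nat \<Rightarrow> 'c" where
  "penv ps e i = (if i < length ps then ps ! i else e (i - length ps))"

definition dfn :: "'c set \<Rightarrow> ((nat \<Rightarrow> 'c) \<Rightarrow> bool) \<Rightarrow> bool" where
  "dfn K P \<longleftrightarrow> (\<exists>p ps. set ps \<subseteq> K \<and> (\<forall>e. range e \<subseteq> sets \<longrightarrow> (tru p (penv ps e) \<longleftrightarrow> P e)))"

definition tm :: "'c set \<Rightarrow> ((nat \<Rightarrow> 'c) \<Rightarrow> 'c) \<Rightarrow> bool" where
  "tm K F \<longleftrightarrow> (\<forall>e. range e \<subseteq> sets \<longrightarrow> F e \<in> sets) \<and> dfn K (\<lambda>e. e 0 = F (\<lambda>i. e (Suc i)))"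

lemma dfnE:
  assumes "dfn K P"
  obtains p ps where "set ps \<subseteq> K" "\<And>e. range e \<subseteq> sets \<Longrightarrow> tru p (penv ps e) \<longleftrightarrow> P e"
  using assms unfolding dfn_def by auto

lemma dfnI:
  assumes "set ps \<subseteq> K" "\<And>e. range e \<subseteq> sets \<Longrightarrow> tru p (penv ps e) \<longleftrightarrow> P e"
  shows "dfn K P"
  using assms unfolding dfn_def by auto

lemma dfn_cong:
  assumes "dfn K P" "\<And>e. range e \<subseteq> sets \<Longrightarrow> P e \<longleftrightarrow> Q e"
  shows "dfn K Q"
  using assms unfolding dfn_def by meson

lemma dfn_rename:
  assumes "dfn K P"
  shows "dfn K (\<lambda>e. P (\<lambda>i. e (r i)))"
proof -
  obtain p ps where ps: "set ps \<subseteq> K" and p: "\<And>e. range e \<subseteq> sets \<Longrightarrow> tru p (penv ps e) \<longleftrightarrow> P e"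
    using assms by (rule dfnE) (rule that)
  \<comment> \<open>\<open>penv\<close> keeps the parameters at the first \<open>length ps\<close>
    indices; these stay in place and \<open>r\<close> acts on the rest.\<close>
  define s where "s i = (if i < length ps then i else r (i - length ps) + length ps)" for i
  obtain p' where p': "\<forall>e. tru p' e \<longleftrightarrow> tru p (\<lambda>i. e (s i))"
    using tru_rename[of p s] by (rule exE)
  have "(\<lambda>i. penv ps e (s i)) = penv ps (\<lambda>i. e (r i))" for e
    by (auto simp: penv_def s_def)
  then have "tru p' (penv ps e) \<longleftrightarrow> P (\<lambda>i. e (r i))" if "range e \<subseteq> sets" for e
    using that p[of "\<lambda>i. e (r i)"] by (auto simp: p' image_subset_iff)
  then show ?thesis by (rule dfnI[OF ps])
qed

lemma dfn_neg: "dfn K P \<Longrightarrow> dfn K (\<lambda>e. \<not> P e)"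
proof -
  assume "dfn K P"
  then obtain p ps where "set ps \<subseteq> K" "\<And>e. range e \<subseteq> sets \<Longrightarrow> tru p (penv ps e) \<longleftrightarrow> P e"
    by (rule dfnE) (rule that)
  then show ?thesis unfolding dfn_def by (intro exI[of _ "FNeg p"] exI[of _ ps]) simp
qed

lemma dfn_conj:
  assumes "dfn K P" "dfn K Q"
  shows "dfn K (\<lambda>e. P e \<and> Q e)"
proof -
  obtain p ps where ps: "set ps \<subseteq> K" and p: "\<And>e. range e \<subseteq> sets \<Longrightarrow> tru p (penv ps e) \<longleftrightarrow> P e"
    using assms(1) by (rule dfnE) (rule that)
  obtain q qs where qs: "set qs \<subseteq> K" and q: "\<And>e. range e \<subseteq> sets \<Longrightarrow> tru q (penv qs e) \<longleftrightarrow> Q e"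
    using assms(2) by (rule dfnE) (rule that)
  \<comment> \<open>The joint parameter list is \<open>ps @ qs\<close>: the free variables of
    \<open>p\<close> jump over the block \<open>qs\<close>, and all of \<open>q\<close> is shifted
    past \<open>ps\<close>.\<close>
  define r where "r i = (if i < length ps then i else i + length qs)" for i
  obtain p' where p': "\<forall>e. tru p' e \<longleftrightarrow> tru p (\<lambda>i. e (r i))"
    using tru_rename[of p r] by (rule exE)
  obtain q' where q': "\<forall>e. tru q' e \<longleftrightarrow> tru q (\<lambda>i. e (i + length ps))"
    using tru_rename[of q "\<lambda>i. i + length ps"] by (rule exE)
  have "(\<lambda>i. penv (ps @ qs) e (r i)) = penv ps e" for e
    by (auto simp: penv_def r_def nth_append)
  moreover have "(\<lambda>i. penv (ps @ qs) e (i + length ps)) = penv qs e" for e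
    by (auto simp: penv_def nth_append)
  ultimately have "tru (FConj p' q') (penv (ps @ qs) e) \<longleftrightarrow> P e \<and> Q e" if "range e \<subseteq> sets" for e
    using that by (simp add: p' q' p q)
  moreover have "set (ps @ qs) \<subseteq> K" using ps qs by simp
  ultimately show ?thesis by (intro dfnI)
qed

lemma dfn_ex:
  assumes "dfn K (\<lambda>e. P (e 0) (\<lambda>i. e (Suc i)))"
  shows "dfn K (\<lambda>e. \<exists>x\<in>sets. P x e)"
proof -
  obtain p ps where ps: "set ps \<subseteq> K"
    and p: "\<And>e. range e \<subseteq> sets \<Longrightarrow> tru p (penv ps e) \<longleftrightarrow> P (e 0) (\<lambda>i. e (Suc i))"
    using assms by (rule dfnE) (rule that)
  define L where "L = length ps"
  define M where "M = Suc (L + fm_bound p)"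
  \<comment> \<open>Index \<open>L\<close>, the first after the parameters, is the variable to be
    bound and receives the fresh name \<open>M\<close>; later indices drop by one, since the outer
    environment has no slot for it.\<close>
  define r where "r i = (if i < L then i else if i = L then M else i - 1)" for i
  obtain p' where p': "\<forall>e. tru p' e \<longleftrightarrow> tru p (\<lambda>i. e (r i))"
    using tru_rename[of p r] by (rule exE)
  have "tru (FEx M p') (penv ps e) \<longleftrightarrow> (\<exists>x\<in>sets. P x e)" if e: "range e \<subseteq> sets" for e
  proof -
    have "tru p (\<lambda>i. ((penv ps e)(M := x)) (r i)) \<longleftrightarrow> P x e" if x: "x \<in> sets" for x
    proof -
      have "tru p (\<lambda>i. ((penv ps e)(M := x)) (r i)) \<longleftrightarrow> tru p (penv ps (case_nat x e))"
      proof (rule tru_cong)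
        fix i assume "i < fm_bound p"
        then show "((penv ps e)(M := x)) (r i) = penv ps (case_nat x e) i"
          by (cases "i \<le> L") (auto simp: r_def penv_def M_def L_def not_le dest!: less_imp_Suc_add)
      qed
      also have "\<dots> \<longleftrightarrow> P x e"
        using p[of "case_nat x e"] e x by (auto simp: image_subset_iff split: nat.split)
      finally show ?thesis .
    qed
    then show ?thesis by (simp add: p')
  qed
  then show ?thesis by (rule dfnI[OF ps])
qed

lemma dfn_eq_var: "dfn K (\<lambda>e. e i = e k)"
  unfolding dfn_def by (intro exI[of _ "FEq i k"] exI[of _ "[]"]) (simp add: penv_def)

lemma dfn_mem_var: "dfn K (\<lambda>e. e i \<in> elts (e k))"
  unfolding dfn_def by (intro exI[of _ "FMem i k"] exI[of _ "[]"]) (simp add: penv_def)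

text \<open>The entry point of proper classes as parameters: a class may stand to the right of
  membership. With \<open>K = UNIV\<close> this is how \<open>j\<close> itself gets into
  comprehension and induction.\<close>

lemma dfn_mem_class_var: "A \<in> K \<Longrightarrow> dfn K (\<lambda>e. e i \<in> elts A)"
  unfolding dfn_def by (intro exI[of _ "FMem (Suc i) 0"] exI[of _ "[A]"]) (simp add: penv_def)

lemma tm_const: "a \<in> sets \<Longrightarrow> a \<in> K \<Longrightarrow> tm K (\<lambda>e. a)"
  unfolding tm_def dfn_def
  by (intro conjI allI impI exI[of _ "FEq 1 0"] exI[of _ "[a]"]) (auto simp add: penv_def)

lemma tm_var [dfn_intros]: "tm K (\<lambda>e. e i)"
  unfolding tm_def by (auto intro: dfn_eq_var)

lemma tm_rename: "tm K F \<Longrightarrow> tm K (\<lambda>e. F (\<lambda>i. e (r i)))"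
  unfolding tm_def
proof (intro conjI allI impI, goal_cases)
  case (1 e)
  then show ?case by (auto simp: image_subset_iff)
next
  case 2
  then have "dfn K (\<lambda>e. e 0 = F (\<lambda>i. e (Suc i)))" by blast
  from dfn_rename[OF this, of "case_nat 0 (\<lambda>i. Suc (r i))"] show ?case by simp
qed

lemma tm_sets: "tm K F \<Longrightarrow> range e \<subseteq> sets \<Longrightarrow> F e \<in> sets"
  unfolding tm_def by blast

text \<open>\<open>P (F e) e\<close> is expressed as: some set equals \<open>F e\<close> and
  satisfies \<open>P\<close>. This is sound because the value of a \<open>tm\<close> is a set and so
  lies in the range of the quantifiers.\<close>

lemma dfn_subst:
  assumes F: "tm K F" and P: "dfn K (\<lambda>e. P (e 0) (\<lambda>i. e (Suc i)))"
  shows "dfn K (\<lambda>e. P (F e) e)"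
proof -
  have "dfn K (\<lambda>e. \<exists>x\<in>sets. x = F e \<and> P x e)"
    using F P unfolding tm_def by (intro dfn_ex dfn_conj) auto
  then show ?thesis by (rule dfn_cong) (use F in \<open>auto simp: tm_def\<close>)
qed

lemma dfn_subst2:
  assumes F: "tm K F" and G: "tm K G" and P: "dfn K (\<lambda>e. P (e 0) (e (Suc 0)))"
  shows "dfn K (\<lambda>e. P (F e) (G e))"
proof (rule dfn_subst[OF F, where P = "\<lambda>x e. P x (G e)"])
  show "dfn K (\<lambda>e. P (e 0) (G (\<lambda>i. e (Suc i))))"
    by (rule dfn_subst[OF tm_rename[OF G, of Suc], where P = "\<lambda>x e. P (e 0) x"])
       (use dfn_rename[OF P, of "\<lambda>i. if i = 0 then 1 else 0"] in simp)
qed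

lemma dfn_subst3:
  assumes F: "tm K F" and G: "tm K G" and H: "tm K H"
    and P: "dfn K (\<lambda>e. P (e 0) (e (Suc 0)) (e (Suc (Suc 0))))"
  shows "dfn K (\<lambda>e. P (F e) (G e) (H e))"
proof (rule dfn_subst[OF F, where P = "\<lambda>x e. P x (G e) (H e)"])
  show "dfn K (\<lambda>e. P (e 0) (G (\<lambda>i. e (Suc i))) (H (\<lambda>i. e (Suc i))))"
  proof (rule dfn_subst[OF tm_rename[OF G, of Suc], where P = "\<lambda>x e. P (e 0) x (H (\<lambda>i. e (Suc i)))"])
    show "dfn K (\<lambda>e. P (e (Suc 0)) (e 0) (H (\<lambda>i. e (Suc (Suc i)))))"
      by (rule dfn_subst[OF tm_rename[OF H, of "\<lambda>i. Suc (Suc i)"], where P = "\<lambda>x e. P (e (Suc 0)) (e 0) x"])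
         (use dfn_rename[OF P, of "\<lambda>i. if i = 0 then 2 else if i = 1 then 1 else 0"] in \<open>simp add: numeral_2_eq_2\<close>)
  qed
qed

lemma dfn_subst1:
  assumes F: "tm K F" and P: "dfn K (\<lambda>e. P (e 0))"
  shows "dfn K (\<lambda>e. P (F e))"
  using dfn_subst[OF F, where P = "\<lambda>x e. P x"] P by simp

lemma dfn_eq [dfn_intros]: "tm K F \<Longrightarrow> tm K G \<Longrightarrow> dfn K (\<lambda>e. F e = G e)"
  by (rule dfn_subst2[where P = "(=)"]) (auto intro: dfn_eq_var)

lemma dfn_mem [dfn_intros]: "tm K F \<Longrightarrow> tm K G \<Longrightarrow> dfn K (\<lambda>e. F e \<in> elts (G e))"
  by (rule dfn_subst2[where P = "\<lambda>x y. x \<in> elts y"]) (auto intro: dfn_mem_var)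

lemma dfn_mem_class: "tm K F \<Longrightarrow> A \<in> K \<Longrightarrow> dfn K (\<lambda>e. F e \<in> elts A)"
  by (rule dfn_subst1[where P = "\<lambda>x. x \<in> elts A"]) (auto intro: dfn_mem_class_var)

lemma tm_subst1:
  assumes "tm K F" "tm K (\<lambda>e. f (e 0))"
  shows "tm K (\<lambda>e. f (F e))"
proof -
  have f: "f x \<in> sets" if "x \<in> sets" for x
    using tm_sets[OF assms(2), of "\<lambda>_. x"] that by auto
  have "dfn K (\<lambda>e. e 0 = f (F (\<lambda>i. e (Suc i))))"
    by (rule dfn_subst2[where P = "\<lambda>y x. y = f x", OF tm_var tm_rename[OF assms(1)]])
       (use assms(2) in \<open>auto simp: tm_def\<close>)
  then show ?thesis using assms(1) f unfolding tm_def by auto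
qed

lemma tm_subst2:
  assumes "tm K F" "tm K G" "tm K (\<lambda>e. f (e 0) (e (Suc 0)))"
  shows "tm K (\<lambda>e. f (F e) (G e))"
proof -
  have f: "f x y \<in> sets" if "x \<in> sets" "y \<in> sets" for x y
    using tm_sets[OF assms(3), of "\<lambda>i. if i = 0 then x else y"] that by auto
  have "dfn K (\<lambda>e. e 0 = f (F (\<lambda>i. e (Suc i))) (G (\<lambda>i. e (Suc i))))"
    by (rule dfn_subst3[where P = "\<lambda>z x y. z = f x y", OF tm_var tm_rename[OF assms(1)] tm_rename[OF assms(2)]])
       (use assms(3) in \<open>auto simp: tm_def\<close>)
  then show ?thesis using assms(1,2) f unfolding tm_def by auto
qed

section \<open>Derived connectives and bounded quantifiers\<close>

lemma dfn_disj:
  assumes "dfn K P" "dfn K Q"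
  shows "dfn K (\<lambda>e. P e \<or> Q e)"
  by (rule dfn_cong[OF dfn_neg[OF dfn_conj[OF dfn_neg[OF assms(1)] dfn_neg[OF assms(2)]]]]) simp

lemma dfn_imp:
  assumes "dfn K P" "dfn K Q"
  shows "dfn K (\<lambda>e. P e \<longrightarrow> Q e)"
  by (rule dfn_cong[OF dfn_disj[OF dfn_neg[OF assms(1)] assms(2)]]) simp

lemma dfn_iff:
  assumes "dfn K P" "dfn K Q"
  shows "dfn K (\<lambda>e. P e \<longleftrightarrow> Q e)"
  by (rule dfn_cong[OF dfn_conj[OF dfn_imp[OF assms] dfn_imp[OF assms(2,1)]]]) auto

lemma dfn_all:
  assumes "dfn K (\<lambda>e. P (e 0) (\<lambda>i. e (Suc i)))"
  shows "dfn K (\<lambda>e. \<forall>x\<in>sets. P x e)"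
  by (rule dfn_cong[OF dfn_neg[OF dfn_ex[where P = "\<lambda>x e. \<not> P x e", OF dfn_neg[OF assms]]]]) simp

lemma dfn_True: "dfn K (\<lambda>e. True)"
  by (rule dfn_cong[OF dfn_eq_var[of K 0 0]]) simp

lemma dfn_False: "dfn K (\<lambda>e. False)"
  using dfn_neg[OF dfn_True] by simp

lemma elts_sets: "x \<in> elts A \<Longrightarrow> x \<in> sets"
  unfolding sets_def by blast

lemma dfn_bex:
  assumes "tm K A" "dfn K (\<lambda>e. P (e 0) (\<lambda>i. e (Suc i)))"
  shows "dfn K (\<lambda>e. \<exists>x\<in>elts (A e). P x e)"
proof -
  have "dfn K (\<lambda>e. \<exists>x\<in>sets. x \<in> elts (A e) \<and> P x e)"
    by (rule dfn_ex) (intro dfn_conj dfn_mem tm_var tm_rename[OF assms(1)] assms(2))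
  then show ?thesis by (rule dfn_cong) (auto dest: elts_sets)
qed

lemma dfn_ball:
  assumes "tm K A" "dfn K (\<lambda>e. P (e 0) (\<lambda>i. e (Suc i)))"
  shows "dfn K (\<lambda>e. \<forall>x\<in>elts (A e). P x e)"
  by (rule dfn_cong[OF dfn_neg[OF dfn_bex[where P = "\<lambda>x e. \<not> P x e", OF assms(1) dfn_neg[OF assms(2)]]]]) simp

lemma dfn_bex1:
  assumes "dfn K (\<lambda>e. P (e 0) (\<lambda>i. e (Suc i)))"
  shows "dfn K (\<lambda>e. \<exists>!x. x \<in> sets \<and> P x e)"
proof -
  have "dfn K (\<lambda>e. P (e 0) (\<lambda>i. e (Suc (Suc i))))"
    using dfn_rename[OF assms, of "\<lambda>i. if i = 0 then 0 else Suc i"] by simp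
  then have "dfn K (\<lambda>e. \<exists>x\<in>sets. P x e \<and> (\<forall>y\<in>sets. P y e \<longrightarrow> y = x))"
    by (intro dfn_ex dfn_conj[OF assms] dfn_all dfn_imp dfn_eq tm_var)
  then show ?thesis by (rule dfn_cong) blast
qed

lemma dfn_bex1':
  assumes "tm K A" "dfn K (\<lambda>e. P (e 0) (\<lambda>i. e (Suc i)))"
  shows "dfn K (\<lambda>e. \<exists>!x. x \<in> elts (A e) \<and> P x e)"
proof -
  have "dfn K (\<lambda>e. \<exists>!x. x \<in> sets \<and> (x \<in> elts (A e) \<and> P x e))"
    by (rule dfn_bex1) (intro dfn_conj dfn_mem tm_var tm_rename[OF assms(1)] assms(2))
  then show ?thesis by (rule dfn_cong) (metis elts_sets)
qed

lemma dfn_subset [dfn_intros]: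
  assumes "tm K A" "tm K B"
  shows "dfn K (\<lambda>e. elts (A e) \<subseteq> elts (B e))"
  unfolding subset_eq by (intro dfn_ball assms(1) dfn_mem tm_var tm_rename[OF assms(2)])

text \<open>Here \<open>m\<close> is a number of the metatheory, so the right-hand side is a finite
  conjunction of formulas and not a quantifier over the model's \<open>omega\<close>.\<close>

lemma dfn_all_less: "(\<And>i. i < m \<Longrightarrow> dfn K (P i)) \<Longrightarrow> dfn K (\<lambda>e. \<forall>i<m. P i e)" for m :: nat
proof (induction m)
  case 0
  then show ?case by (simp add: dfn_True)
next
  case (Suc m)
  then have "dfn K (\<lambda>e. P m e \<and> (\<forall>i<m. P i e))" by (intro dfn_conj) auto
  then show ?case by (rule dfn_cong) (auto simp: less_Suc_eq)
qed

lemmas dfn_logic [dfn_intros] = dfn_bex1' dfn_bex1 dfn_ball dfn_bex dfn_all dfn_ex dfn_neg dfn_conj dfn_disj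
  dfn_imp dfn_iff dfn_True dfn_False

lemma tm_UNIV_const: "a \<in> sets \<Longrightarrow> tm UNIV (\<lambda>e. a)"
  by (simp add: tm_const)

lemma tm_if:
  assumes "dfn K P" "tm K F" "tm K G"
  shows "tm K (\<lambda>e. if P e then F e else G e)"
proof -
  have "dfn K (\<lambda>e. (P (\<lambda>i. e (Suc i)) \<and> e 0 = F (\<lambda>i. e (Suc i))) \<or>
    (\<not> P (\<lambda>i. e (Suc i)) \<and> e 0 = G (\<lambda>i. e (Suc i))))"
    using dfn_rename[OF assms(1), of Suc] assms(2,3) unfolding tm_def
    by (intro dfn_disj dfn_conj dfn_neg) blast+
  then have "dfn K (\<lambda>e. e 0 = (if P (\<lambda>i. e (Suc i)) then F (\<lambda>i. e (Suc i)) else G (\<lambda>i. e (Suc i))))"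
    by (rule dfn_cong) auto
  then show ?thesis using assms(2,3) unfolding tm_def by auto
qed

text \<open>Terms enter the calculus through a formula that singles out their value. Only the
  parameters of that formula count, so a function first constructed from classes becomes available
  to elementarity once it has a parameter-free characterisation.\<close>

lemma tm_The:
  assumes Q: "dfn K (\<lambda>e. Q (e 0) (\<lambda>i. e (Suc i)))"
    and ex1: "\<And>e. range e \<subseteq> sets \<Longrightarrow> F e \<in> sets \<and> (\<forall>x\<in>sets. Q x e \<longleftrightarrow> x = F e)"
  shows "tm K F"
  unfolding tm_def
proof
  show "\<forall>e. range e \<subseteq> sets \<longrightarrow> F e \<in> sets" using ex1 by blast
  show "dfn K (\<lambda>e. e 0 = F (\<lambda>i. e (Suc i)))"
  proof (rule dfn_cong[OF Q])
    fix e :: "nat \<Rightarrow> 'c" assume "range e \<subseteq> sets"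
    then have "range (\<lambda>i. e (Suc i)) \<subseteq> sets" "e 0 \<in> sets" by auto
    then show "Q (e 0) (\<lambda>i. e (Suc i)) \<longleftrightarrow> e 0 = F (\<lambda>i. e (Suc i))" using ex1 by blast
  qed
qed

lemma dfn_mono: "dfn K P \<Longrightarrow> K \<subseteq> L \<Longrightarrow> dfn L P"
  unfolding dfn_def by blast

lemma tm_subst3:
  assumes "tm K F" "tm K G" "tm K H" "tm K (\<lambda>e. f (e 0) (e (Suc 0)) (e (Suc (Suc 0))))"
  shows "tm K (\<lambda>e. f (F e) (G e) (H e))"
proof -
  have f: "f x y z \<in> sets" if "x \<in> sets" "y \<in> sets" "z \<in> sets" for x y z
    using tm_sets[OF assms(4), of "\<lambda>i. if i = 0 then x else if i = 1 then y else z"] that by auto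
  have d: "dfn K (\<lambda>e. e 0 = f (e (Suc 0)) (e (Suc (Suc 0))) (e (Suc (Suc (Suc 0)))))"
    using assms(4) unfolding tm_def by simp
  have "dfn K (\<lambda>e. \<exists>u\<in>sets. u = F (\<lambda>i. e (Suc i)) \<and> (\<exists>v\<in>sets. v = G (\<lambda>i. e (Suc i)) \<and>
      (\<exists>w\<in>sets. w = H (\<lambda>i. e (Suc i)) \<and> e 0 = f u v w)))"
  proof -
    have d2: "dfn K (\<lambda>e. e (Suc (Suc (Suc 0))) = f (e (Suc (Suc 0))) (e (Suc 0)) (e 0))"
      using dfn_rename[OF d, of "\<lambda>i. if i = 0 then 3 else 3 - i"] by (simp add: numeral_3_eq_3)
    show ?thesis
      by (intro dfn_ex dfn_conj[OF _ d2] dfn_conj dfn_eq tm_var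
          tm_rename[OF assms(1), of "\<lambda>i. Suc (Suc i)"] tm_rename[OF assms(2), of "\<lambda>i. Suc (Suc (Suc i))"]
          tm_rename[OF assms(3), of "\<lambda>i. Suc (Suc (Suc (Suc i)))"])
  qed
  then have "dfn K (\<lambda>e. e 0 = f (F (\<lambda>i. e (Suc i))) (G (\<lambda>i. e (Suc i))) (H (\<lambda>i. e (Suc i))))"
  proof (rule dfn_cong)
    fix e :: "nat \<Rightarrow> 'c" assume "range e \<subseteq> sets"
    then have "range (\<lambda>i. e (Suc i)) \<subseteq> sets" by auto
    then show "(\<exists>u\<in>sets. u = F (\<lambda>i. e (Suc i)) \<and> (\<exists>v\<in>sets. v = G (\<lambda>i. e (Suc i)) \<and>
      (\<exists>w\<in>sets. w = H (\<lambda>i. e (Suc i)) \<and> e 0 = f u v w))) \<longleftrightarrow>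
      e 0 = f (F (\<lambda>i. e (Suc i))) (G (\<lambda>i. e (Suc i))) (H (\<lambda>i. e (Suc i)))"
      using tm_sets[OF assms(1)] tm_sets[OF assms(2)] tm_sets[OF assms(3)] by auto
  qed
  then show ?thesis using assms(1-3) f unfolding tm_def by auto
qed

lemma dfn_transitive0: "dfn K (\<lambda>e. transitive (e 0))"
  unfolding transitive_def by (intro dfn_intros)

lemmas dfn_transitive [dfn_intros] = dfn_subst1[where P = transitive, OF _ dfn_transitive0]

text \<open>The conjunct \<open>x \<in> sets\<close> of \<open>Ord\<close> refers to classes and is
  no formula over sets, but it holds in every environment of sets.\<close>

lemma dfn_Ord0: "dfn K (\<lambda>e. Ord (e 0))"
proof -
  have "dfn K (\<lambda>e. transitive (e 0) \<and> (\<forall>y\<in>elts (e 0). transitive y))"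
    by (intro dfn_intros)
  then show ?thesis by (rule dfn_cong) (auto simp: Ord_def)
qed

lemmas dfn_Ord [dfn_intros] = dfn_subst1[where P = Ord, OF _ dfn_Ord0]

end

context nbg
begin

section \<open>Elementary set theory\<close>

lemma class_ex:
  assumes "dfn K (\<lambda>e. P (e 0) (\<lambda>i. e (Suc i)))" "range e \<subseteq> sets"
  shows "\<exists>A. elts A = {x \<in> sets. P x e}"
proof -
  obtain p ps where p: "\<And>e. range e \<subseteq> sets \<Longrightarrow> tru p (penv ps e) \<longleftrightarrow> P (e 0) (\<lambda>i. e (Suc i))"
    using assms(1) by (rule dfnE) (rule that)
  define L where "L = length ps"
  \<comment> \<open>The comprehension axiom binds index 0, whereas \<open>penv\<close> starts with
    the parameters: these move up by one and the element variable, at index \<open>L\<close>, goes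
    to 0.\<close>
  define r where "r i = (if i < L then Suc i else if i = L then 0 else i)" for i
  obtain p' where p': "\<forall>e. tru p' e \<longleftrightarrow> tru p (\<lambda>i. e (r i))"
    using tru_rename[of p r] by (rule exE)
  define E where "E = case_nat undefined (penv ps e)"
  have "tru p' (E(0 := x)) \<longleftrightarrow> P x e" if "x \<in> sets" for x
  proof -
    have "(\<lambda>i. (E(0 := x)) (r i)) = penv ps (case_nat x e)"
    proof
      fix i
      show "(E(0 := x)) (r i) = penv ps (case_nat x e) i"
        by (cases "i \<le> L") (auto simp: r_def penv_def E_def L_def not_le dest!: less_imp_Suc_add)
    qed
    then show ?thesis
      using p[of "case_nat x e"] assms(2) that by (auto simp: p' image_subset_iff split: nat.split)
  qed
  then have "{x \<in> sets. tru p' (E(0 := x))} = {x \<in> sets. P x e}" by blast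
  then show ?thesis using comprehension[of p' E] by simp
qed

lemma Coll_eq: "elts A = {x \<in> sets. P x} \<Longrightarrow> Coll P = A"
  unfolding Coll_def by (rule the_equality) (auto intro: extensionality)

lemma elts_Coll':
  assumes "dfn K (\<lambda>e. P (e 0) (\<lambda>i. e (Suc i)))" "range e \<subseteq> sets"
  shows "elts (Coll (\<lambda>x. P x e)) = {x \<in> sets. P x e}"
proof -
  obtain A where A: "elts A = {x \<in> sets. P x e}" using class_ex[OF assms] by (rule exE)
  show ?thesis by (simp add: Coll_eq[OF A] A)
qed

lemma sets_nonempty: "\<exists>I. I \<in> sets" using infinity by blast

lemma elts_Coll:
  assumes "dfn K (\<lambda>e. P (e 0))"
  shows "elts (Coll P) = {x \<in> sets. P x}"
proof -
  obtain I where "I \<in> sets" using sets_nonempty by blast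
  then show ?thesis using elts_Coll'[where P = "\<lambda>x e. P x" and e = "\<lambda>_. I" and K = K] assms by auto
qed

lemma elts_empty [simp]: "elts empty = {}"
  unfolding empty_def using elts_Coll[OF dfn_False] by simp

lemma elts_Univ [simp]: "elts Univ = sets"
  unfolding Univ_def using elts_Coll[OF dfn_True] by simp

lemma empty_sets [simp]: "empty \<in> sets"
  using infinity elts_sets by blast

lemma upair_aux: "x \<in> sets \<Longrightarrow> y \<in> sets \<Longrightarrow> upair x y \<in> sets \<and> elts (upair x y) = {x, y}"
  using pairing[of x y] Coll_eq[of _ "\<lambda>w. w = x \<or> w = y"] unfolding upair_def
  by (smt (verit, best) Collect_cong elts_sets insert_compr singletonD singletonI mem_Collect_eq insert_iff Collect_mem_eq)

lemma upair_sets [simp]: "x \<in> sets \<Longrightarrow> y \<in> sets \<Longrightarrow> upair x y \<in> sets"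
  using upair_aux by blast

lemma elts_upair [simp]: "x \<in> sets \<Longrightarrow> y \<in> sets \<Longrightarrow> elts (upair x y) = {x, y}"
  using upair_aux by blast

lemma opair_sets [simp]: "x \<in> sets \<Longrightarrow> y \<in> sets \<Longrightarrow> opair x y \<in> sets"
  unfolding opair_def by simp

lemma opair_eq_iff:
  assumes "x \<in> sets" "y \<in> sets" "x' \<in> sets" "y' \<in> sets"
  shows "opair x y = opair x' y' \<longleftrightarrow> x = x' \<and> y = y'"
proof
  assume "opair x y = opair x' y'"
  then have "elts ` elts (opair x y) = elts ` elts (opair x' y')" by simp
  then have "{{x}, {x, y}} = {{x'}, {x', y'}}" using assms by (simp add: opair_def)
  then show "x = x' \<and> y = y'" by (metis doubleton_eq_iff insertCI singleton_insert_inj_eq')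
qed auto

lemma tm_Coll:
  assumes P: "dfn K (\<lambda>e. P (e 0) (\<lambda>i. e (Suc i)))"
    and set: "\<And>e. range e \<subseteq> sets \<Longrightarrow> Coll (\<lambda>x. P x e) \<in> sets"
  shows "tm K (\<lambda>e. Coll (\<lambda>x. P x e))"
proof (rule tm_The[where Q = "\<lambda>y e. \<forall>x\<in>sets. x \<in> elts y \<longleftrightarrow> P x e"])
  have "dfn K (\<lambda>e. P (e 0) (\<lambda>i. e (Suc (Suc i))))"
    using dfn_rename[OF P, of "\<lambda>i. if i = 0 then 0 else Suc i"] by simp
  then show "dfn K (\<lambda>e. \<forall>x\<in>sets. x \<in> elts (e 0) \<longleftrightarrow> P x (\<lambda>i. e (Suc i)))"
    by (intro dfn_all dfn_iff dfn_mem tm_var)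
next
  fix e :: "nat \<Rightarrow> 'c" assume e: "range e \<subseteq> sets"
  have "(\<forall>x\<in>sets. x \<in> elts y \<longleftrightarrow> P x e) \<longleftrightarrow> y = Coll (\<lambda>x. P x e)" for y
  proof
    assume "\<forall>x\<in>sets. x \<in> elts y \<longleftrightarrow> P x e"
    then have "elts y = {x \<in> sets. P x e}" using elts_sets by blast
    then show "y = Coll (\<lambda>x. P x e)" using Coll_eq by metis
  qed (use elts_Coll'[OF P e] in auto)
  then show "Coll (\<lambda>x. P x e) \<in> sets \<and> (\<forall>y\<in>sets. (\<forall>x\<in>sets. x \<in> elts y \<longleftrightarrow> P x e) \<longleftrightarrow> y = Coll (\<lambda>x. P x e))"
    using set[OF e] by blast
qed

lemma tm_empty [dfn_intros]: "tm K (\<lambda>e. empty)"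
  unfolding empty_def by (rule tm_Coll) (auto intro: dfn_False simp: empty_def[symmetric])

lemma tm_upair0: "tm K (\<lambda>e. upair (e 0) (e (Suc 0)))"
  unfolding upair_def
  by (rule tm_Coll, intro dfn_intros) (auto simp: upair_def[symmetric] image_subset_iff)

lemmas tm_upair [dfn_intros] = tm_subst2[where f = upair, OF _ _ tm_upair0]

lemma tm_opair [dfn_intros]: "tm K F \<Longrightarrow> tm K G \<Longrightarrow> tm K (\<lambda>e. opair (F e) (G e))"
  unfolding opair_def by (intro dfn_intros)

text \<open>Replacement along the identity on \<open>A\<close>. Since \<open>A\<close> is an
  arbitrary class, definability is settled when a class is formed by \<open>Coll\<close>; afterwards
  an inclusion is all that has to be checked.\<close>

lemma separation:
  assumes "b \<in> sets" "elts A \<subseteq> elts b"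
  shows "A \<in> sets"
proof -
  have "dfn UNIV (\<lambda>e. \<exists>x\<in>sets. x \<in> elts A \<and> e 0 = opair x x)"
    by (intro dfn_ex dfn_conj dfn_mem_class UNIV_I dfn_eq tm_opair tm_var)
  then have F: "elts (Coll (\<lambda>p. \<exists>x\<in>sets. x \<in> elts A \<and> p = opair x x)) = {p \<in> sets. \<exists>x\<in>sets. x \<in> elts A \<and> p = opair x x}"
    by (rule elts_Coll)
  obtain y where "y \<in> sets" "elts y = {v \<in> sets. \<exists>u\<in>elts b. opair u v \<in> {p \<in> sets. \<exists>x\<in>sets. x \<in> elts A \<and> p = opair x x}}"
    using replacement[OF assms(1), of "Coll (\<lambda>p. \<exists>x\<in>sets. x \<in> elts A \<and> p = opair x x)"]
    unfolding F using elts_sets opair_eq_iff by (smt (verit, best) mem_Collect_eq)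
  moreover have "{v \<in> sets. \<exists>u\<in>elts b. opair u v \<in> {p \<in> sets. \<exists>x\<in>sets. x \<in> elts A \<and> p = opair x x}} = elts A"
    using assms(2) elts_sets by (auto simp: opair_eq_iff)
  ultimately show ?thesis using extensionality by metis
qed

lemma Coll_sets:
  assumes "dfn K (\<lambda>e. P (e 0) (\<lambda>i. e (Suc i)))" "range e \<subseteq> sets" "b \<in> sets"
    "\<And>x. x \<in> sets \<Longrightarrow> P x e \<Longrightarrow> x \<in> elts b"
  shows "Coll (\<lambda>x. P x e) \<in> sets"
  by (rule separation[OF assms(3)]) (use elts_Coll'[OF assms(1,2)] assms(4) in auto)

lemma replacement_rel:
  assumes "dfn UNIV (\<lambda>e. Q (e 0) (e (Suc 0)))" "a \<in> sets"
    "\<And>u v w. u \<in> elts a \<Longrightarrow> v \<in> sets \<Longrightarrow> w \<in> sets \<Longrightarrow> Q u v \<Longrightarrow> Q u w \<Longrightarrow> v = w"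
  shows "\<exists>b\<in>sets. elts b = {v \<in> sets. \<exists>u\<in>elts a. Q u v}"
proof -
  define F where "F = Coll (\<lambda>p. \<exists>u\<in>sets. \<exists>v\<in>sets. p = opair u v \<and> Q u v)"
  have "dfn UNIV (\<lambda>e. \<exists>u\<in>sets. \<exists>v\<in>sets. e 0 = opair u v \<and> Q u v)"
    by (intro dfn_ex dfn_conj dfn_eq dfn_subst2[where P = Q, OF _ _ assms(1)] dfn_intros)
  then have F: "elts F = {p \<in> sets. \<exists>u\<in>sets. \<exists>v\<in>sets. p = opair u v \<and> Q u v}"
    unfolding F_def by (rule elts_Coll)
  have F': "opair u v \<in> elts F \<longleftrightarrow> Q u v" if "u \<in> sets" "v \<in> sets" for u v
    using that by (auto simp: F opair_eq_iff)
  have "\<exists>y\<in>sets. elts y = {v \<in> sets. \<exists>u\<in>elts a. opair u v \<in> elts F}"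
  proof (rule replacement[OF assms(2)])
    fix u v w assume "v \<in> sets" "w \<in> sets" "opair u v \<in> elts F" "opair u w \<in> elts F" "u \<in> elts a"
    then show "v = w" using F' assms(3) elts_sets by metis
  qed
  moreover have "{v \<in> sets. \<exists>u\<in>elts a. opair u v \<in> elts F} = {v \<in> sets. \<exists>u\<in>elts a. Q u v}"
    using F' elts_sets by blast
  ultimately show ?thesis by simp
qed

lemma replacement_fun:
  assumes "tm UNIV (\<lambda>e. H (e 0))" "a \<in> sets"
  shows "\<exists>b\<in>sets. elts b = H ` elts a"
proof -
  have H: "H x \<in> sets" if "x \<in> sets" for x using tm_sets[OF assms(1), of "\<lambda>_. x"] that by auto
  have "dfn UNIV (\<lambda>e. e (Suc 0) = H (e 0))"
    by (intro dfn_eq tm_var assms(1))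
  then have "\<exists>b\<in>sets. elts b = {v \<in> sets. \<exists>u\<in>elts a. v = H u}"
    by (rule replacement_rel) (use assms(2) in auto)
  moreover have "{v \<in> sets. \<exists>u\<in>elts a. v = H u} = H ` elts a" using H elts_sets by blast
  ultimately show ?thesis by simp
qed

lemma union_sets:
  assumes "x \<in> sets" "y \<in> sets"
  obtains z where "z \<in> sets" "elts z = elts x \<union> elts y"
  using union[of "upair x y"] assms by auto

lemma succ_aux: "x \<in> sets \<Longrightarrow> succ x \<in> sets \<and> elts (succ x) = insert x (elts x)"
proof -
  assume x: "x \<in> sets"
  obtain z where z: "z \<in> sets" "elts z = elts x \<union> elts (upair x x)" using union_sets[of x "upair x x"] x by auto
  have "succ x = z" unfolding succ_def by (rule Coll_eq) (use z x elts_sets in auto)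
  then show ?thesis using z x by auto
qed

lemma succ_sets [simp]: "x \<in> sets \<Longrightarrow> succ x \<in> sets" using succ_aux by blast
lemma elts_succ [simp]: "x \<in> sets \<Longrightarrow> elts (succ x) = insert x (elts x)" using succ_aux by blast

lemma tm_succ0: "tm K (\<lambda>e. succ (e 0))"
  unfolding succ_def
  by (rule tm_Coll, intro dfn_intros) (auto simp: succ_def[symmetric] image_subset_iff)

lemmas tm_succ [dfn_intros] = tm_subst1[where f = succ, OF _ tm_succ0]

definition bigU :: "'c \<Rightarrow> 'c" where
  "bigU x = Coll (\<lambda>z. \<exists>y\<in>elts x. z \<in> elts y)"

lemma bigU_aux: "x \<in> sets \<Longrightarrow> bigU x \<in> sets \<and> elts (bigU x) = (\<Union>y\<in>elts x. elts y)"
proof -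
  assume "x \<in> sets"
  then obtain u where u: "u \<in> sets" "elts u = (\<Union>y\<in>elts x. elts y)" using union by blast
  have "bigU x = u" unfolding bigU_def by (rule Coll_eq) (use u elts_sets in auto)
  then show ?thesis using u by auto
qed

lemma bigU_sets [simp]: "x \<in> sets \<Longrightarrow> bigU x \<in> sets" using bigU_aux by blast
lemma elts_bigU [simp]: "x \<in> sets \<Longrightarrow> elts (bigU x) = (\<Union>y\<in>elts x. elts y)" using bigU_aux by blast

lemma prod_ex:
  assumes "a \<in> sets" "b \<in> sets"
  obtains c where "c \<in> sets" "elts c = {opair x y |x y. x \<in> elts a \<and> y \<in> elts b}"
proof -
  obtain u where u: "u \<in> sets" "elts u = elts a \<union> elts b" using union_sets assms by blast
  obtain v where v: "v \<in> sets" "elts v = {y \<in> sets. elts y \<subseteq> elts u}" using power_set u by blast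
  obtain w where w: "w \<in> sets" "elts w = {y \<in> sets. elts y \<subseteq> elts v}" using power_set v by blast
  have "dfn UNIV (\<lambda>e. \<exists>x\<in>elts a. \<exists>y\<in>elts b. e 0 = opair x y)"
    by (intro dfn_intros tm_UNIV_const assms)
  then have E: "elts (Coll (\<lambda>p. \<exists>x\<in>elts a. \<exists>y\<in>elts b. p = opair x y)) = {p \<in> sets. \<exists>x\<in>elts a. \<exists>y\<in>elts b. p = opair x y}"
    by (rule elts_Coll)
  have "opair x y \<in> elts w" if "x \<in> elts a" "y \<in> elts b" for x y
  proof -
    have xy: "x \<in> sets" "y \<in> sets" using that elts_sets by auto
    then have "elts (opair x y) \<subseteq> elts v" using that u v by (auto simp: opair_def)
    then show ?thesis using w xy by auto
  qed
  then have "elts (Coll (\<lambda>p. \<exists>x\<in>elts a. \<exists>y\<in>elts b. p = opair x y)) \<subseteq> elts w" using E by auto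
  then have "Coll (\<lambda>p. \<exists>x\<in>elts a. \<exists>y\<in>elts b. p = opair x y) \<in> sets" using separation w by blast
  moreover have "elts (Coll (\<lambda>p. \<exists>x\<in>elts a. \<exists>y\<in>elts b. p = opair x y)) = {opair x y |x y. x \<in> elts a \<and> y \<in> elts b}"
    unfolding E using elts_sets by auto
  ultimately show ?thesis using that by blast
qed

text \<open>Foundation for the class of counterexamples, which comprehension provides for definable
  \<open>P\<close>. As the model may be ill-founded from outside, HOL induction is no substitute,
  and every internal induction principle carries a definability premise.\<close>

lemma eps_induct:
  assumes "dfn UNIV (\<lambda>e. P (e 0))" "\<And>x. x \<in> sets \<Longrightarrow> (\<And>y. y \<in> elts x \<Longrightarrow> P y) \<Longrightarrow> P x" "x \<in> sets"
  shows "P x"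
proof (rule ccontr)
  assume "\<not> P x"
  have E: "elts (Coll (\<lambda>x. \<not> P x)) = {x \<in> sets. \<not> P x}"
    using dfn_neg[OF assms(1)] by (rule elts_Coll)
  then have "elts (Coll (\<lambda>x. \<not> P x)) \<noteq> {}" using \<open>\<not> P x\<close> assms(3) by blast
  then obtain z where "z \<in> sets" "\<not> P z" "\<And>y. y \<in> elts z \<Longrightarrow> P y"
    using foundation[of "Coll (\<lambda>x. \<not> P x)"] E elts_sets by blast
  then show False using assms(2) by blast
qed

lemma mem_irrefl: "x \<notin> elts x"
proof
  assume x: "x \<in> elts x"
  then have s: "x \<in> sets" using elts_sets by blast
  show False using foundation[of "upair x x"] s x by auto
qed

lemma mem_asym: "x \<in> elts y \<Longrightarrow> y \<notin> elts x"
proof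
  assume x: "x \<in> elts y" "y \<in> elts x"
  then have s: "x \<in> sets" "y \<in> sets" using elts_sets by blast+
  show False using foundation[of "upair x y"] s x by auto
qed

lemma succ_inj: "x \<in> sets \<Longrightarrow> y \<in> sets \<Longrightarrow> succ x = succ y \<longleftrightarrow> x = y"
  using mem_asym by (metis elts_succ insert_iff)

lemma succ_neq_empty [simp]: "x \<in> sets \<Longrightarrow> succ x \<noteq> empty" "x \<in> sets \<Longrightarrow> empty \<noteq> succ x"
  by (metis elts_succ elts_empty insert_not_empty)+

section \<open>Ordinals\<close>

lemma Ord_sets: "Ord x \<Longrightarrow> x \<in> sets" by (simp add: Ord_def)

lemma Ord_in: "Ord x \<Longrightarrow> y \<in> elts x \<Longrightarrow> Ord y"
  unfolding Ord_def transitive_def using elts_sets by blast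

lemma Ord_trans: "Ord c \<Longrightarrow> a \<in> elts b \<Longrightarrow> b \<in> elts c \<Longrightarrow> a \<in> elts c"
  unfolding Ord_def transitive_def by blast

text \<open>Nested membership induction: in a minimal incomparable pair each ordinal contains the
  elements of the other, so extensionality identifies them.\<close>

lemma Ord_linear: "Ord a \<Longrightarrow> Ord b \<Longrightarrow> a \<in> elts b \<or> a = b \<or> b \<in> elts a"
proof -
  assume ab: "Ord a" "Ord b"
  have "Ord a \<longrightarrow> (\<forall>b\<in>sets. Ord b \<longrightarrow> a \<in> elts b \<or> a = b \<or> b \<in> elts a)"
  proof (rule eps_induct[of "\<lambda>a. Ord a \<longrightarrow> (\<forall>b\<in>sets. Ord b \<longrightarrow> a \<in> elts b \<or> a = b \<or> b \<in> elts a)"])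
    show "dfn UNIV (\<lambda>e. Ord (e 0) \<longrightarrow> (\<forall>b\<in>sets. Ord b \<longrightarrow> e 0 \<in> elts b \<or> e 0 = b \<or> b \<in> elts (e 0)))"
      by (intro dfn_intros)
    show "a \<in> sets" using ab Ord_sets by blast
    fix x assume x: "x \<in> sets"
      and IH: "\<And>y. y \<in> elts x \<Longrightarrow> Ord y \<longrightarrow> (\<forall>b\<in>sets. Ord b \<longrightarrow> y \<in> elts b \<or> y = b \<or> b \<in> elts y)"
    show "Ord x \<longrightarrow> (\<forall>b\<in>sets. Ord b \<longrightarrow> x \<in> elts b \<or> x = b \<or> b \<in> elts x)"
    proof (intro impI ballI)
      fix c assume ox: "Ord x" and c: "c \<in> sets" "Ord c"
      have "Ord c \<longrightarrow> x \<in> elts c \<or> x = c \<or> c \<in> elts x"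
      proof (rule eps_induct[of "\<lambda>c. Ord c \<longrightarrow> x \<in> elts c \<or> x = c \<or> c \<in> elts x"])
        show "dfn UNIV (\<lambda>e. Ord (e 0) \<longrightarrow> x \<in> elts (e 0) \<or> x = e 0 \<or> e 0 \<in> elts x)"
          by (intro dfn_intros tm_UNIV_const x)
        fix z assume z: "z \<in> sets"
          and IH2: "\<And>y. y \<in> elts z \<Longrightarrow> Ord y \<longrightarrow> x \<in> elts y \<or> x = y \<or> y \<in> elts x"
        show "Ord z \<longrightarrow> x \<in> elts z \<or> x = z \<or> z \<in> elts x"
        proof (rule impI, rule ccontr)
          assume oz: "Ord z" and n: "\<not> (x \<in> elts z \<or> x = z \<or> z \<in> elts x)"
          have "elts x = elts z"
          proof (intro equalityI subsetI)
            fix y assume y: "y \<in> elts x"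
            then have "y \<in> elts z \<or> y = z \<or> z \<in> elts y" using IH Ord_in[OF ox] z oz by blast
            then show "y \<in> elts z" using n y ox Ord_trans by blast
          next
            fix y assume y: "y \<in> elts z"
            then have "x \<in> elts y \<or> x = y \<or> y \<in> elts x" using IH2 Ord_in[OF oz] by blast
            then show "y \<in> elts x" using n y oz Ord_trans by blast
          qed
          then show False using n extensionality by blast
        qed
      qed (use c in auto)
      then show "x \<in> elts c \<or> x = c \<or> c \<in> elts x" using c by blast
    qed
  qed
  then show ?thesis using ab Ord_sets by blast
qed

lemma Ord_subset_iff: "Ord a \<Longrightarrow> Ord b \<Longrightarrow> elts a \<subseteq> elts b \<longleftrightarrow> a \<in> elts b \<or> a = b"
  using Ord_linear mem_irrefl Ord_trans by blast

lemma Ord_not_mem_iff: "Ord a \<Longrightarrow> Ord b \<Longrightarrow> a \<notin> elts b \<longleftrightarrow> elts b \<subseteq> elts a"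
  using Ord_linear mem_irrefl Ord_trans by blast

lemma Ord_succ [simp]: "Ord x \<Longrightarrow> Ord (succ x)"
  unfolding Ord_def transitive_def by auto

lemma Ord_empty [simp]: "Ord empty"
  unfolding Ord_def transitive_def by auto

lemma Ord_bigU: "x \<in> sets \<Longrightarrow> (\<And>y. y \<in> elts x \<Longrightarrow> Ord y) \<Longrightarrow> Ord (bigU x)"
  unfolding Ord_def transitive_def by auto

lemma Ord_succ_subset: "Ord b \<Longrightarrow> a \<in> elts b \<Longrightarrow> elts (succ a) \<subseteq> elts b"
  using Ord_trans elts_sets by auto

lemma Ord_max: "Ord a \<Longrightarrow> Ord b \<Longrightarrow> \<exists>c. Ord c \<and> elts a \<subseteq> elts c \<and> elts b \<subseteq> elts c \<and> (c = a \<or> c = b)"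
  by (metis Ord_linear Ord_subset_iff order_refl)

section \<open>The natural numbers\<close>

lemma dfn_inductive: "dfn K (\<lambda>e. \<forall>I\<in>sets. empty \<in> elts I \<and> (\<forall>y\<in>elts I. succ y \<in> elts I) \<longrightarrow> e 0 \<in> elts I)"
  by (intro dfn_intros)

lemma elts_omega: "elts omega = {x \<in> sets. \<forall>I\<in>sets. empty \<in> elts I \<and> (\<forall>y\<in>elts I. succ y \<in> elts I) \<longrightarrow> x \<in> elts I}"
  unfolding omega_def by (rule elts_Coll[OF dfn_inductive])

lemma omega_sets [simp]: "omega \<in> sets"
proof -
  obtain I where "I \<in> sets" "empty \<in> elts I" "\<forall>y\<in>elts I. succ y \<in> elts I" using infinity by blast
  then show ?thesis by (rule_tac separation[of I]) (auto simp: elts_omega)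
qed

lemma tm_omega [dfn_intros]: "tm K (\<lambda>e. omega)"
  unfolding omega_def by (rule tm_Coll[OF dfn_inductive]) (simp add: omega_def[symmetric])

lemma empty_omega [simp]: "empty \<in> elts omega" by (auto simp: elts_omega)
lemma succ_omega [simp]: "m \<in> elts omega \<Longrightarrow> succ m \<in> elts omega" by (auto simp: elts_omega)

lemma omega_induct:
  assumes "dfn UNIV (\<lambda>e. P (e 0))" "P empty" "\<And>m. m \<in> elts omega \<Longrightarrow> P m \<Longrightarrow> P (succ m)" "m \<in> elts omega"
  shows "P m"
proof -
  have d: "dfn UNIV (\<lambda>e. e 0 \<in> elts omega \<and> P (e 0))" by (intro dfn_conj dfn_mem tm_var tm_omega assms(1))
  define C where "C = Coll (\<lambda>x. x \<in> elts omega \<and> P x)"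
  have E: "elts C = {x \<in> elts omega. P x}"
    using elts_Coll[OF d] elts_sets unfolding C_def by blast
  have "C \<in> sets" by (rule separation[OF omega_sets]) (use E in blast)
  moreover have "empty \<in> elts C" "\<forall>y\<in>elts C. succ y \<in> elts C" using assms(2,3) E by auto
  moreover have "\<forall>I\<in>sets. empty \<in> elts I \<and> (\<forall>y\<in>elts I. succ y \<in> elts I) \<longrightarrow> m \<in> elts I"
    using assms(4) unfolding elts_omega by simp
  ultimately have "m \<in> elts C" by blast
  then show ?thesis using E by blast
qed

lemma omega_in_sets [simp]: "m \<in> elts omega \<Longrightarrow> m \<in> sets" by (rule elts_sets)

lemma Ord_omega_in: "m \<in> elts omega \<Longrightarrow> Ord m"
  by (rule omega_induct[of Ord], intro dfn_intros) simp_all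

lemma omega_transitive: "m \<in> elts omega \<Longrightarrow> elts m \<subseteq> elts omega"
  by (rule omega_induct[of "\<lambda>m. elts m \<subseteq> elts omega"], intro dfn_intros) simp_all

lemma Ord_omega [simp]: "Ord omega"
  unfolding Ord_def using Ord_omega_in omega_transitive by (auto simp: transitive_def Ord_def)

section \<open>Functions\<close>

lemma dfn_is_fun0: "dfn K (\<lambda>e. is_fun (e 0) (e (Suc 0)) (e (Suc (Suc 0))))"
  unfolding is_fun_def by (intro dfn_intros)

lemmas dfn_is_fun [dfn_intros] = dfn_subst3[where P = is_fun, OF _ _ _ dfn_is_fun0]

text \<open>\<open>Univ\<close> is a proper class and cannot be the value of a \<open>tm\<close>; as
  a codomain it disappears into the quantifiers over sets, which keeps the condition free of
  parameters.\<close>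

lemma dfn_is_fun_Univ0: "dfn K (\<lambda>e. is_fun (e 0) (e (Suc 0)) Univ)"
  unfolding is_fun_def elts_Univ by (intro dfn_intros)

lemmas dfn_is_fun_Univ = dfn_subst2[where P = "\<lambda>f A. is_fun f A Univ", OF _ _ dfn_is_fun_Univ0]

lemma is_funD1: "is_fun f A B \<Longrightarrow> p \<in> elts f \<Longrightarrow> \<exists>x\<in>elts A. \<exists>y\<in>elts B. p = opair x y"
  by (simp add: is_fun_def)

lemma is_funD2: "is_fun f A B \<Longrightarrow> x \<in> elts A \<Longrightarrow> \<exists>!y. y \<in> elts B \<and> opair x y \<in> elts f"
  by (simp add: is_fun_def)

text \<open>Trades the description in \<open>app\<close> for membership in the graph. Definability
  arguments about function values go through this form.\<close>

lemma is_fun_iff: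
  assumes "is_fun f A B" "x \<in> sets" "y \<in> sets"
  shows "opair x y \<in> elts f \<longleftrightarrow> x \<in> elts A \<and> y = app f x"
proof -
  have ex1: "\<exists>!y. y \<in> elts B \<and> opair z y \<in> elts f" if "z \<in> elts A" for z
    using is_funD2[OF assms(1) that] .
  have dom: "z \<in> elts A \<and> w \<in> elts B" if zw: "opair z w \<in> elts f" "z \<in> sets" "w \<in> sets" for z w
  proof -
    obtain z' w' where "z' \<in> elts A" "w' \<in> elts B" "opair z w = opair z' w'"
      using is_funD1[OF assms(1) zw(1)] by blast
    then show ?thesis using zw opair_eq_iff elts_sets by metis
  qed
  have app: "opair z (app f z) \<in> elts f \<and> app f z \<in> sets" if z: "z \<in> elts A" for z
  proof -
    obtain w where w: "w \<in> elts B" "opair z w \<in> elts f" "\<And>w'. w' \<in> elts B \<Longrightarrow> opair z w' \<in> elts f \<Longrightarrow> w' = w"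
      using ex1[OF z] by blast
    have "app f z = w" unfolding app_def
      by (rule the_equality) (use w dom z elts_sets in blast)+
    then show ?thesis using w elts_sets by blast
  qed
  show ?thesis using app ex1 dom assms(2,3) by metis
qed

lemma is_fun_app:
  assumes "is_fun f A B" "x \<in> elts A"
  shows "app f x \<in> elts B" "opair x (app f x) \<in> elts f" "app f x \<in> sets"
proof -
  obtain y where y: "y \<in> elts B" "opair x y \<in> elts f" using is_funD2[OF assms] by blast
  then have "y = app f x" using is_fun_iff[OF assms(1), of x y] assms(2) elts_sets by blast
  then show "app f x \<in> elts B" "opair x (app f x) \<in> elts f" "app f x \<in> sets" using y elts_sets by auto
qed

lemma elts_fun:
  assumes "is_fun f A B"
  shows "elts f = (\<lambda>x. opair x (app f x)) ` elts A"
proof (intro equalityI subsetI)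
  fix p assume p: "p \<in> elts f"
  then obtain x y where "x \<in> elts A" "y \<in> elts B" "p = opair x y" using is_funD1[OF assms p] by blast
  then show "p \<in> (\<lambda>x. opair x (app f x)) ` elts A" using is_fun_iff[OF assms] p elts_sets by blast
qed (use is_fun_app[OF assms] in auto)

lemma fun_ext:
  assumes "is_fun f A B" "is_fun g A C" "\<And>x. x \<in> elts A \<Longrightarrow> app f x = app g x"
  shows "f = g"
  by (rule extensionality) (use assms elts_fun[OF assms(1)] elts_fun[OF assms(2)] in auto)

lemma is_funI:
  assumes "elts f = (\<lambda>x. opair x (H x)) ` elts A" "\<And>x. x \<in> elts A \<Longrightarrow> H x \<in> elts B"
  shows "is_fun f A B" "\<And>x. x \<in> elts A \<Longrightarrow> app f x = H x"
proof -
  have iff: "opair x y \<in> elts f \<longleftrightarrow> y = H x" if "x \<in> elts A" "y \<in> sets" for x y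
  proof
    assume "opair x y \<in> elts f"
    then obtain x' where "x' \<in> elts A" "opair x y = opair x' (H x')" using assms(1) by auto
    then show "y = H x" using that assms(2) opair_eq_iff elts_sets by metis
  qed (use assms(1) that in auto)
  show f: "is_fun f A B" unfolding is_fun_def
  proof (intro conjI ballI)
    fix p assume "p \<in> elts f"
    then show "\<exists>x\<in>elts A. \<exists>y\<in>elts B. p = opair x y" using assms by auto
  next
    fix x assume "x \<in> elts A"
    then show "\<exists>!y. y \<in> elts B \<and> opair x y \<in> elts f" using iff assms(2) elts_sets by metis
  qed
  show "app f x = H x" if "x \<in> elts A" for x
    using is_fun_app[OF f that] iff that by blast
qed

lemma is_fun_weaken: "is_fun f A B \<Longrightarrow> (\<And>x. x \<in> elts A \<Longrightarrow> app f x \<in> elts C) \<Longrightarrow> is_fun f A C"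
  using is_funI(1)[of f "app f" A C] elts_fun by blast

definition lam :: "'c \<Rightarrow> ('c \<Rightarrow> 'c) \<Rightarrow> 'c" where
  "lam a H = Coll (\<lambda>p. \<exists>x\<in>elts a. p = opair x (H x))"

lemma tm_app1_sets: "tm K (\<lambda>e. H (e 0)) \<Longrightarrow> x \<in> sets \<Longrightarrow> H x \<in> sets"
  using tm_sets[of K "\<lambda>e. H (e 0)" "\<lambda>_. x"] by auto

lemma lam_aux:
  assumes "tm UNIV (\<lambda>e. H (e 0))" "a \<in> sets"
  shows "lam a H \<in> sets" "elts (lam a H) = (\<lambda>x. opair x (H x)) ` elts a"
proof -
  have "tm UNIV (\<lambda>e. opair (e 0) (H (e 0)))" by (intro tm_opair tm_var assms)
  then obtain b where b: "b \<in> sets" "elts b = (\<lambda>x. opair x (H x)) ` elts a"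
    using replacement_fun[where H = "\<lambda>x. opair x (H x)"] assms(2) by blast
  have "lam a H = b" unfolding lam_def
    by (rule Coll_eq) (use b tm_app1_sets[OF assms(1)] elts_sets in auto)
  then show "lam a H \<in> sets" "elts (lam a H) = (\<lambda>x. opair x (H x)) ` elts a" using b by auto
qed

lemma lam_fun:
  assumes "tm UNIV (\<lambda>e. H (e 0))" "a \<in> sets" "\<And>x. x \<in> elts a \<Longrightarrow> H x \<in> elts B"
  shows "is_fun (lam a H) a B" "\<And>x. x \<in> elts a \<Longrightarrow> app (lam a H) x = H x"
  using is_funI[OF lam_aux(2)[OF assms(1,2)] assms(3)] by auto

lemma elts_restrict:
  assumes "b \<in> sets"
  shows "elts (restrict f b) = {opair x y |x y. x \<in> elts b \<and> y \<in> sets \<and> opair x y \<in> elts f}"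
proof -
  have "dfn UNIV (\<lambda>e. e 0 \<in> elts f \<and> (\<exists>x\<in>elts b. \<exists>y\<in>sets. e 0 = opair x y))"
    by (intro dfn_conj dfn_mem_class UNIV_I tm_var dfn_bex dfn_ex dfn_eq dfn_intros tm_UNIV_const assms)
  then have "elts (restrict f b) = {p \<in> sets. p \<in> elts f \<and> (\<exists>x\<in>elts b. \<exists>y\<in>sets. p = opair x y)}"
    unfolding restrict_def by (rule elts_Coll)
  then show ?thesis using elts_sets by auto
qed

lemma restrict_cong:
  assumes "b \<in> sets" "\<And>x y. x \<in> elts b \<Longrightarrow> y \<in> sets \<Longrightarrow> opair x y \<in> elts f \<longleftrightarrow> opair x y \<in> elts g"
  shows "restrict f b = restrict g b"
proof (rule extensionality)
  show "elts (restrict f b) = elts (restrict g b)"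
    unfolding elts_restrict[OF assms(1)] using assms(2) by blast
qed

lemma restrict_sets [simp]: "f \<in> sets \<Longrightarrow> b \<in> sets \<Longrightarrow> restrict f b \<in> sets"
  by (rule separation[of f]) (auto simp: elts_restrict)

lemma tm_restrict0: "tm K (\<lambda>e. restrict (e 0) (e (Suc 0)))"
  unfolding restrict_def
  by (rule tm_Coll, intro dfn_intros) (auto simp: restrict_def[symmetric] image_subset_iff)

lemmas tm_restrict [dfn_intros] = tm_subst2[where f = restrict, OF _ _ tm_restrict0]

section \<open>Transitive closure and recursion\<close>

text \<open>An intersection of transitive supersets instead of the union of an omega-sequence,
  because recursion is not yet available: \<open>recursion\<close> is itself derived from
  \<open>tc\<close>. The set \<open>x\<close> is not put into its own closure.\<close>

definition tc :: "'c \<Rightarrow> 'c" where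
  "tc x = Coll (\<lambda>z. \<forall>t\<in>sets. transitive t \<and> elts x \<subseteq> elts t \<longrightarrow> z \<in> elts t)"

lemma dfn_tc: "dfn K (\<lambda>e. \<forall>t\<in>sets. transitive t \<and> elts (e (Suc 0)) \<subseteq> elts t \<longrightarrow> e 0 \<in> elts t)"
  by (intro dfn_intros)

lemma elts_tc: "x \<in> sets \<Longrightarrow> elts (tc x) = {z \<in> sets. \<forall>t\<in>sets. transitive t \<and> elts x \<subseteq> elts t \<longrightarrow> z \<in> elts t}"
  unfolding tc_def
  using elts_Coll'[where P = "\<lambda>z e. \<forall>t\<in>sets. transitive t \<and> elts (e 0) \<subseteq> elts t \<longrightarrow> z \<in> elts t", OF dfn_tc, of "\<lambda>_. x"]
  by auto

lemma tc_least: "x \<in> sets \<Longrightarrow> t \<in> sets \<Longrightarrow> transitive t \<Longrightarrow> elts x \<subseteq> elts t \<Longrightarrow> elts (tc x) \<subseteq> elts t"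
  by (auto simp: elts_tc)

lemma subset_tc: "x \<in> sets \<Longrightarrow> elts x \<subseteq> elts (tc x)"
  using elts_sets by (auto simp: elts_tc)

lemma transitive_tc: "x \<in> sets \<Longrightarrow> transitive (tc x)"
  unfolding transitive_def[of "tc x"]
proof (intro ballI subsetI)
  fix y z assume x: "x \<in> sets" and y: "y \<in> elts (tc x)" and z: "z \<in> elts y"
  have "z \<in> elts t" if "t \<in> sets" "transitive t" "elts x \<subseteq> elts t" for t
    using tc_least[OF x that] y z that(2) unfolding transitive_def by blast
  then show "z \<in> elts (tc x)" using z elts_sets by (simp add: elts_tc[OF x])
qed

lemma transitive_union_tc:
  assumes t: "elts t = elts x \<union> (\<Union>y\<in>elts x. elts (tc y))"
  shows "transitive t"
  unfolding transitive_def
proof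
  fix y assume "y \<in> elts t"
  then consider "y \<in> elts x" | z where "z \<in> elts x" "y \<in> elts (tc z)" using t by blast
  then show "elts y \<subseteq> elts t"
  proof cases
    case 1
    then show ?thesis using subset_tc t elts_sets by blast
  next
    case 2
    then have "elts y \<subseteq> elts (tc z)" using transitive_tc elts_sets unfolding transitive_def by blast
    then show ?thesis using 2 t by blast
  qed
qed

text \<open>Membership induction: the closures of the elements are sets, replacement collects them,
  and their union together with \<open>x\<close> is transitive. From here on \<open>tc\<close> is a
  set-valued term.\<close>

lemma ex_transitive:
  assumes "x \<in> sets"
  shows "\<exists>t\<in>sets. transitive t \<and> elts x \<subseteq> elts t"
proof (rule eps_induct[of "\<lambda>x. \<exists>t\<in>sets. transitive t \<and> elts x \<subseteq> elts t"])
  show "dfn UNIV (\<lambda>e. \<exists>t\<in>sets. transitive t \<and> elts (e 0) \<subseteq> elts t)" by (intro dfn_intros)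
  fix x assume x: "x \<in> sets" and IH: "\<And>y. y \<in> elts x \<Longrightarrow> \<exists>t\<in>sets. transitive t \<and> elts y \<subseteq> elts t"
  have tcs: "tc y \<in> sets" if "y \<in> elts x" for y
    using IH[OF that] separation tc_least that elts_sets by metis
  \<comment> \<open>The graph of \<open>tc\<close> as a formula; \<open>tc\<close> cannot be used as
    a term yet, since it is known to be a set only at elements of \<open>x\<close>.\<close>
  define Q where "Q y v \<longleftrightarrow> (\<forall>z\<in>sets. z \<in> elts v \<longleftrightarrow> (\<forall>t\<in>sets. transitive t \<and> elts y \<subseteq> elts t \<longrightarrow> z \<in> elts t))" for y v
  have Q: "Q y v \<longleftrightarrow> v = tc y" if "y \<in> sets" for y v
  proof
    assume "Q y v"
    then have "elts v = elts (tc y)" unfolding Q_def elts_tc[OF that] using elts_sets by blast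
    then show "v = tc y" by (rule extensionality)
  qed (simp add: Q_def elts_tc[OF that])
  have "dfn UNIV (\<lambda>e. Q (e 0) (e (Suc 0)))" unfolding Q_def by (intro dfn_intros)
  then have "\<exists>b\<in>sets. elts b = {v \<in> sets. \<exists>u\<in>elts x. Q u v}"
    by (rule replacement_rel[OF _ x]) (use Q elts_sets in auto)
  then obtain b where b: "b \<in> sets" "elts b = {v \<in> sets. \<exists>u\<in>elts x. Q u v}" by blast
  have b': "elts b = tc ` elts x" unfolding b(2) using Q tcs elts_sets by blast
  obtain t where t: "t \<in> sets" "elts t = elts x \<union> elts (bigU b)" using union_sets[of x "bigU b"] b x by auto
  have t2: "elts t = elts x \<union> (\<Union>y\<in>elts x. elts (tc y))" using t b(1) b' by simp
  have "transitive t" by (rule transitive_union_tc[OF t2])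
  then show "\<exists>t\<in>sets. transitive t \<and> elts x \<subseteq> elts t" using t by blast
qed (rule assms)

lemma tc_sets [simp]: "x \<in> sets \<Longrightarrow> tc x \<in> sets"
  using ex_transitive separation tc_least by metis

lemma tm_tc0: "tm K (\<lambda>e. tc (e 0))"
  unfolding tc_def
  by (rule tm_Coll, intro dfn_intros) (auto simp: tc_def[symmetric] image_subset_iff)

lemmas tm_tc [dfn_intros] = tm_subst1[where f = tc, OF _ tm_tc0]

lemma tc_mono_mem:
  assumes "x \<in> sets" "y \<in> elts (tc x)"
  shows "elts (tc y) \<subseteq> elts (tc x)"
  using tc_least[of y "tc x"] assms transitive_tc elts_sets unfolding transitive_def by auto

lemma tc_unfold:
  assumes "x \<in> sets" "z \<in> elts (tc x)"
  shows "z \<in> elts x \<or> (\<exists>y\<in>elts x. z \<in> elts (tc y))"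
proof -
  have "\<exists>b\<in>sets. elts b = tc ` elts x" by (rule replacement_fun) (intro dfn_intros assms)+
  then obtain b where b: "b \<in> sets" "elts b = tc ` elts x" by blast
  obtain t where t: "t \<in> sets" "elts t = elts x \<union> elts (bigU b)" using union_sets[of x "bigU b"] b assms by auto
  have t2: "elts t = elts x \<union> (\<Union>y\<in>elts x. elts (tc y))" using t b by simp
  have "transitive t" by (rule transitive_union_tc[OF t2])
  then show ?thesis using tc_least[OF assms(1) t(1)] t2 assms(2) by blast
qed

text \<open>Course-of-values induction: the hypothesis covers the whole transitive closure, matching
  the recursive calls that \<open>recursion\<close> permits. The proof carries \<open>P\<close> on
  all of \<open>tc x\<close> along.\<close>

lemma tc_induct:
  assumes "dfn UNIV (\<lambda>e. P (e 0))" "\<And>x. x \<in> sets \<Longrightarrow> (\<And>y. y \<in> elts (tc x) \<Longrightarrow> P y) \<Longrightarrow> P x" "x \<in> sets"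
  shows "P x"
proof -
  have "P x \<and> (\<forall>y\<in>elts (tc x). P y)"
  proof (rule eps_induct[of "\<lambda>x. P x \<and> (\<forall>y\<in>elts (tc x). P y)"])
    show "dfn UNIV (\<lambda>e. P (e 0) \<and> (\<forall>y\<in>elts (tc (e 0)). P y))"
      by (intro dfn_conj dfn_ball dfn_subst1[where P = P, OF _ assms(1)] tm_tc tm_var)
    fix x assume x: "x \<in> sets" and IH: "\<And>y. y \<in> elts x \<Longrightarrow> P y \<and> (\<forall>z\<in>elts (tc y). P z)"
    have "\<forall>y\<in>elts (tc x). P y" using tc_unfold[OF x] IH by blast
    then show "P x \<and> (\<forall>y\<in>elts (tc x). P y)" using assms(2)[OF x] by blast
  qed (rule assms(3))
  then show ?thesis by blast
qed

lemma tc_irrefl: "x \<in> sets \<Longrightarrow> x \<notin> elts (tc x)"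
  by (rule tc_induct[of "\<lambda>x. x \<notin> elts (tc x)"], intro dfn_intros) blast+

lemma tc_Ord: "Ord \<alpha> \<Longrightarrow> tc \<alpha> = \<alpha>"
  using tc_least[of \<alpha> \<alpha>] subset_tc by (auto intro!: extensionality simp: Ord_def)

text \<open>The value at \<open>x\<close> may depend on values throughout \<open>tc x\<close>, not
  only at elements; recursion on coded formulas needs this. Attempts on transitive domains agree
  where they overlap, by \<open>tc_induct\<close>, and together cover all sets. The result is again
  a \<open>tm\<close>, though with class parameters allowed.\<close>

lemma recursion:
  assumes G: "tm UNIV (\<lambda>e. G (e 0) (e (Suc 0)))"
  obtains \<Phi> where "tm UNIV (\<lambda>e. \<Phi> (e 0))" "\<And>x. x \<in> sets \<Longrightarrow> \<Phi> x = G x (lam (tc x) \<Phi>)"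
proof -
  have Gs: "G x f \<in> sets" if "x \<in> sets" "f \<in> sets" for x f
    using tm_sets[OF G, of "\<lambda>i. if i = 0 then x else f"] that by auto
  \<comment> \<open>An attempt: a function on a transitive set that obeys the recursion equation at
    each point of its domain. Transitivity keeps all recursive calls inside the domain.\<close>
  define good where "good f t \<longleftrightarrow> transitive t \<and> is_fun f t Univ \<and>
    (\<forall>x\<in>elts t. opair x (G x (restrict f (tc x))) \<in> elts f)" for f t
  have d_good: "dfn UNIV (\<lambda>e. good (e 0) (e (Suc 0)))" unfolding good_def
    by (intro dfn_conj dfn_is_fun_Univ dfn_ball dfn_mem tm_opair tm_subst2[where f = G, OF _ _ G] dfn_intros)
  define Q where "Q x v \<longleftrightarrow> (\<exists>f\<in>sets. \<exists>t\<in>sets. good f t \<and> x \<in> elts t \<and> opair x v \<in> elts f)" for x v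
  have d_Q: "dfn UNIV (\<lambda>e. Q (e 0) (e (Suc 0)))" unfolding Q_def
    by (intro dfn_ex dfn_conj dfn_subst2[where P = good, OF _ _ d_good] dfn_intros)
  have fun_eq: "v = w" if "good f t" "opair x v \<in> elts f" "opair x w \<in> elts f" "x \<in> sets" "v \<in> sets" "w \<in> sets" for f t x v w
    using that is_fun_iff unfolding good_def by metis
  have tc_sub: "elts (tc x) \<subseteq> elts t" if "good f t" "x \<in> elts t" "t \<in> sets" for f t x
    using that tc_least[of x t] elts_sets unfolding good_def transitive_def by blast
  have agree: "\<forall>v\<in>sets. opair x v \<in> elts f \<longleftrightarrow> opair x v \<in> elts g"
    if f: "good f t" "f \<in> sets" "t \<in> sets" and g: "good g u" "g \<in> sets" "u \<in> sets"
      and x: "x \<in> elts t" "x \<in> elts u" for f t g u x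
  proof -
    have "x \<in> elts t \<and> x \<in> elts u \<longrightarrow> (\<forall>v\<in>sets. opair x v \<in> elts f \<longleftrightarrow> opair x v \<in> elts g)"
    proof (rule tc_induct[of "\<lambda>x. x \<in> elts t \<and> x \<in> elts u \<longrightarrow> (\<forall>v\<in>sets. opair x v \<in> elts f \<longleftrightarrow> opair x v \<in> elts g)"])
      show "dfn UNIV (\<lambda>e. e 0 \<in> elts t \<and> e 0 \<in> elts u \<longrightarrow> (\<forall>v\<in>sets. opair (e 0) v \<in> elts f \<longleftrightarrow> opair (e 0) v \<in> elts g))"
        by (intro dfn_intros tm_UNIV_const f g)
      show "x \<in> sets" using x elts_sets by blast
      fix y assume y: "y \<in> sets" and IH: "\<And>z. z \<in> elts (tc y) \<Longrightarrow> z \<in> elts t \<and> z \<in> elts u \<longrightarrow> (\<forall>v\<in>sets. opair z v \<in> elts f \<longleftrightarrow> opair z v \<in> elts g)"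
      show "y \<in> elts t \<and> y \<in> elts u \<longrightarrow> (\<forall>v\<in>sets. opair y v \<in> elts f \<longleftrightarrow> opair y v \<in> elts g)"
      proof
        assume yt: "y \<in> elts t \<and> y \<in> elts u"
        have eq: "restrict f (tc y) = restrict g (tc y)"
        proof (rule restrict_cong)
          fix z v assume "z \<in> elts (tc y)" "v \<in> sets"
          then show "opair z v \<in> elts f \<longleftrightarrow> opair z v \<in> elts g"
            using IH[of z] tc_sub[OF f(1) _ f(3), of y] tc_sub[OF g(1) _ g(3), of y] yt by blast
        qed (use y in simp)
        have s: "G y (restrict f (tc y)) \<in> sets" using Gs y f by simp
        have "opair y (G y (restrict f (tc y))) \<in> elts f" "opair y (G y (restrict f (tc y))) \<in> elts g"
          using f g yt eq unfolding good_def by auto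
        then show "\<forall>v\<in>sets. opair y v \<in> elts f \<longleftrightarrow> opair y v \<in> elts g"
          using fun_eq[OF f(1)] fun_eq[OF g(1)] s y by metis
      qed
    qed
    then show ?thesis using x by blast
  qed
  have Q_fun: "v = w" if "Q x v" "Q x w" "x \<in> sets" "v \<in> sets" "w \<in> sets" for x v w
    using that agree fun_eq unfolding Q_def by metis
  have Q_iff: "Q x v \<longleftrightarrow> opair x v \<in> elts f" if "good f t" "f \<in> sets" "t \<in> sets" "x \<in> elts t" "v \<in> sets" for f t x v
    using that agree unfolding Q_def by metis
  have ex: "\<exists>v\<in>sets. Q x v" if "x \<in> sets" for x
  proof (rule tc_induct[of "\<lambda>x. \<exists>v\<in>sets. Q x v"])
    show "dfn UNIV (\<lambda>e. \<exists>v\<in>sets. Q (e 0) v)"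
      by (intro dfn_ex dfn_subst2[where P = Q, OF _ _ d_Q] tm_var)
    fix x assume x: "x \<in> sets" and IH: "\<And>y. y \<in> elts (tc x) \<Longrightarrow> \<exists>v\<in>sets. Q y v"
    have "dfn UNIV (\<lambda>e. \<exists>v\<in>sets. e (Suc 0) = opair (e 0) v \<and> Q (e 0) v)"
      by (intro dfn_ex dfn_conj dfn_eq tm_opair dfn_subst2[where P = Q, OF _ _ d_Q] tm_var)
    then have "\<exists>f\<in>sets. elts f = {p \<in> sets. \<exists>y\<in>elts (tc x). \<exists>v\<in>sets. p = opair y v \<and> Q y v}"
    proof (rule replacement_rel)
      show "tc x \<in> sets" using x by simp
      fix u v w assume u: "u \<in> elts (tc x)" "\<exists>va\<in>sets. v = opair u va \<and> Q u va" "\<exists>v\<in>sets. w = opair u v \<and> Q u v"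
      then show "v = w" using Q_fun elts_sets by metis
    qed
    then obtain f where f: "f \<in> sets" "elts f = {p \<in> sets. \<exists>y\<in>elts (tc x). \<exists>v\<in>sets. p = opair y v \<and> Q y v}" by blast
    have fQ: "opair y v \<in> elts f \<longleftrightarrow> y \<in> elts (tc x) \<and> Q y v" if "y \<in> sets" "v \<in> sets" for y v
      using f(2) that elts_sets by (auto simp: opair_eq_iff)
    \<comment> \<open>The set \<open>f\<close> tabulates the values below \<open>x\<close>, which
      exist by induction and are unique; one more pair turns it into an attempt with
      \<open>x\<close> in its domain.\<close>
    define p where "p = opair x (G x f)"
    have p: "p \<in> sets" "G x f \<in> sets" using x f Gs by (auto simp: p_def)
    obtain g where g: "g \<in> sets" "elts g = elts f \<union> {p}" using union_sets[of f "upair p p"] f p by auto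
    obtain t where t: "t \<in> sets" "elts t = elts (tc x) \<union> {x}" using union_sets[of "tc x" "upair x x"] x by auto
    have gQ: "opair y v \<in> elts g \<longleftrightarrow> Q y v" if "y \<in> elts (tc x)" "v \<in> sets" for y v
      using g fQ[of y v] that elts_sets[OF that(1)] tc_irrefl[OF x] x p by (auto simp: p_def opair_eq_iff)
    have gx: "opair x v \<in> elts g \<longleftrightarrow> v = G x f" if "v \<in> sets" for v
      using g fQ[of x v] tc_irrefl[OF x] x p that by (auto simp: p_def opair_eq_iff)
    have "good g t" unfolding good_def
    proof (intro conjI ballI)
      show "transitive t" using t x transitive_tc[OF x] subset_tc[OF x] unfolding transitive_def by auto
      show "is_fun g t Univ" unfolding is_fun_def elts_Univ
      proof (intro conjI ballI)
        fix q assume "q \<in> elts g"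
        then show "\<exists>y\<in>elts t. \<exists>v\<in>sets. q = opair y v" using g f t p x by (auto simp: p_def)
      next
        fix y assume "y \<in> elts t"
        then consider "y = x" | "y \<in> elts (tc x)" using t by blast
        then show "\<exists>!v. v \<in> sets \<and> opair y v \<in> elts g"
        proof cases
          case 1
          then show ?thesis using gx p by blast
        next
          case 2
          then show ?thesis using gQ IH Q_fun elts_sets by metis
        qed
      qed
      fix y assume "y \<in> elts t"
      then consider "y = x" | "y \<in> elts (tc x)" using t by blast
      then show "opair y (G y (restrict g (tc y))) \<in> elts g"
      proof cases
        case 1
        have "elts (restrict g (tc x)) = elts f"
        proof -
          have "elts (restrict g (tc x)) = {opair y v |y v. y \<in> elts (tc x) \<and> v \<in> sets \<and> Q y v}"
            using gQ x by (auto simp: elts_restrict)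
          also have "\<dots> = elts f" using f(2) elts_sets by auto
          finally show ?thesis .
        qed
        then have "restrict g (tc x) = f" by (rule extensionality)
        then show ?thesis using 1 gx p by simp
      next
        case 2
        then obtain v h u where h: "v \<in> sets" "h \<in> sets" "u \<in> sets" "good h u" "y \<in> elts u" "opair y v \<in> elts h"
          using IH unfolding Q_def by blast
        have ys: "y \<in> sets" using 2 elts_sets by blast
        have gh: "opair z w \<in> elts g \<longleftrightarrow> opair z w \<in> elts h" if "z \<in> elts (tc y)" "w \<in> sets" for z w
          using gQ[of z w] Q_iff[OF h(4,2,3)] that tc_mono_mem[OF x 2] tc_sub[OF h(4,5,3)] by blast
        have eq: "restrict g (tc y) = restrict h (tc y)" by (rule restrict_cong[OF tc_sets[OF ys] gh])
        have "opair y (G y (restrict h (tc y))) \<in> elts h" using h unfolding good_def by blast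
        then have "Q y (G y (restrict h (tc y)))" using h unfolding Q_def by blast
        then show ?thesis using gQ 2 eq Gs ys h by simp
      qed
    qed
    then have "Q x (G x f)" using g t gx p unfolding Q_def by blast
    then show "\<exists>v\<in>sets. Q x v" using p by blast
  qed (rule that)
  define \<Phi> where "\<Phi> x = (THE v. v \<in> sets \<and> Q x v)" for x
  have \<Phi>: "\<Phi> x \<in> sets \<and> (\<forall>v\<in>sets. Q x v \<longleftrightarrow> v = \<Phi> x)" if x: "x \<in> sets" for x
  proof -
    obtain v where v: "v \<in> sets" "Q x v" using ex[OF x] by blast
    have "\<Phi> x = v" unfolding \<Phi>_def by (rule the_equality) (use v Q_fun x in blast)+
    then show ?thesis using v Q_fun x by blast
  qed
  have t\<Phi>: "tm UNIV (\<lambda>e. \<Phi> (e 0))"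
  proof (rule tm_The[where Q = "\<lambda>y e. Q (e 0) y"])
    show "dfn UNIV (\<lambda>e. Q (e (Suc 0)) (e 0))" by (intro dfn_subst2[where P = Q, OF _ _ d_Q] tm_var)
  qed (use \<Phi> in auto)
  moreover have "\<Phi> x = G x (lam (tc x) \<Phi>)" if x: "x \<in> sets" for x
  proof -
    obtain f t where f: "f \<in> sets" "t \<in> sets" "good f t" "x \<in> elts t"
      using ex[OF x] unfolding Q_def by blast
    have m: "opair y v \<in> elts f \<longleftrightarrow> v = \<Phi> y" if "y \<in> elts (tc x)" "v \<in> sets" for y v
      using Q_iff[OF f(3,1,2)] tc_sub[OF f(3,4,2)] \<Phi> that elts_sets by blast
    have "elts (restrict f (tc x)) = elts (lam (tc x) \<Phi>)"
      unfolding lam_aux(2)[OF t\<Phi> tc_sets[OF x]] elts_restrict[OF tc_sets[OF x]]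
      using m \<Phi> elts_sets by blast
    then have "restrict f (tc x) = lam (tc x) \<Phi>" by (rule extensionality)
    moreover have "opair x (G x (restrict f (tc x))) \<in> elts f" using f unfolding good_def by blast
    moreover have "G x (restrict f (tc x)) \<in> sets" using Gs x f by simp
    ultimately show ?thesis using Q_iff[OF f(3,1,2,4)] \<Phi>[OF x] by metis
  qed
  ultimately show ?thesis using that by blast
qed

section \<open>Least ordinals\<close>

text \<open>The default \<open>empty\<close> makes the operator total with sets as values, as
  \<open>tm\<close> demands.\<close>

definition leastO :: "('c \<Rightarrow> bool) \<Rightarrow> 'c" where
  "leastO P = (if \<exists>\<alpha>. Ord \<alpha> \<and> P \<alpha> then THE \<alpha>. Ord \<alpha> \<and> P \<alpha> \<and> (\<forall>\<beta>\<in>elts \<alpha>. \<not> P \<beta>) else empty)"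

lemma least_unique:
  assumes "Ord \<alpha>" "P \<alpha>" "\<forall>\<beta>\<in>elts \<alpha>. \<not> P \<beta>" "Ord \<beta>" "P \<beta>" "\<forall>\<gamma>\<in>elts \<beta>. \<not> P \<gamma>"
  shows "\<alpha> = \<beta>"
  using Ord_linear[OF assms(1,4)] assms by blast

lemma leastO_eq: "Ord \<alpha> \<Longrightarrow> P \<alpha> \<Longrightarrow> (\<forall>\<beta>\<in>elts \<alpha>. \<not> P \<beta>) \<Longrightarrow> leastO P = \<alpha>"
  unfolding leastO_def using least_unique[of _ P] by (auto intro!: the_equality)

lemma leastO':
  assumes "dfn UNIV (\<lambda>e. P (e 0) (\<lambda>i. e (Suc i)))" "range e \<subseteq> sets" "Ord \<alpha>" "P \<alpha> e"
  shows "Ord (leastO (\<lambda>x. P x e))" "P (leastO (\<lambda>x. P x e)) e" "\<And>\<beta>. \<beta> \<in> elts (leastO (\<lambda>x. P x e)) \<Longrightarrow> \<not> P \<beta> e"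
    "\<And>\<beta>. Ord \<beta> \<Longrightarrow> P \<beta> e \<Longrightarrow> elts (leastO (\<lambda>x. P x e)) \<subseteq> elts \<beta>"
proof -
  have "dfn UNIV (\<lambda>e. Ord (e 0) \<and> P (e 0) (\<lambda>i. e (Suc i)))" by (intro dfn_conj dfn_Ord tm_var assms(1))
  then have E: "elts (Coll (\<lambda>x. Ord x \<and> P x e)) = {x \<in> sets. Ord x \<and> P x e}"
    using elts_Coll'[where P = "\<lambda>x e. Ord x \<and> P x e", OF _ assms(2)] by blast
  then have "elts (Coll (\<lambda>x. Ord x \<and> P x e)) \<noteq> {}" using assms(3,4) Ord_sets by auto
  then obtain \<beta> where \<beta>: "Ord \<beta>" "P \<beta> e" "elts \<beta> \<inter> {x \<in> sets. Ord x \<and> P x e} = {}"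
    using foundation[of "Coll (\<lambda>x. Ord x \<and> P x e)"] unfolding E by blast
  have l: "\<forall>\<gamma>\<in>elts \<beta>. \<not> P \<gamma> e" using \<beta> Ord_in elts_sets by blast
  have eq: "leastO (\<lambda>x. P x e) = \<beta>" by (rule leastO_eq) (use \<beta> l in auto)
  show "Ord (leastO (\<lambda>x. P x e))" "P (leastO (\<lambda>x. P x e)) e" "\<And>\<beta>. \<beta> \<in> elts (leastO (\<lambda>x. P x e)) \<Longrightarrow> \<not> P \<beta> e"
    using \<beta> l eq by auto
  fix \<gamma> assume "Ord \<gamma>" "P \<gamma> e"
  then show "elts (leastO (\<lambda>x. P x e)) \<subseteq> elts \<gamma>" unfolding eq using \<beta>(1) l Ord_not_mem_iff by blast
qed

lemma leastO:
  assumes "dfn UNIV (\<lambda>e. P (e 0))" "Ord \<alpha>" "P \<alpha>"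
  shows "Ord (leastO P)" "P (leastO P)" "\<And>\<beta>. \<beta> \<in> elts (leastO P) \<Longrightarrow> \<not> P \<beta>"
    "\<And>\<beta>. Ord \<beta> \<Longrightarrow> P \<beta> \<Longrightarrow> elts (leastO P) \<subseteq> elts \<beta>"
proof -
  have r: "range (\<lambda>_ :: nat. empty) \<subseteq> sets" by auto
  note L = leastO'[where P = "\<lambda>x e. P x", OF assms(1) r assms(2,3)]
  show "Ord (leastO P)" "P (leastO P)" "\<And>\<beta>. \<beta> \<in> elts (leastO P) \<Longrightarrow> \<not> P \<beta>"
    "\<And>\<beta>. Ord \<beta> \<Longrightarrow> P \<beta> \<Longrightarrow> elts (leastO P) \<subseteq> elts \<beta>"
    by (fact L)+
qed

text \<open>The parameter set \<open>K\<close> is kept. With parameters fixed by an embedding, the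
  least ordinal with a definable property is therefore fixed as well.\<close>

lemma tm_leastO:
  assumes P: "dfn K (\<lambda>e. P (e 0) (\<lambda>i. e (Suc i)))"
  shows "tm K (\<lambda>e. leastO (\<lambda>x. P x e))"
proof (rule tm_The[where Q = "\<lambda>y e. (Ord y \<and> P y e \<and> (\<forall>\<beta>\<in>elts y. \<not> P \<beta> e)) \<or>
    (\<not> (\<exists>\<alpha>\<in>sets. Ord \<alpha> \<and> P \<alpha> e) \<and> y = empty)"])
  have P2: "dfn K (\<lambda>e. P (e 0) (\<lambda>i. e (Suc (Suc i))))"
    using dfn_rename[OF P, of "\<lambda>i. if i = 0 then 0 else Suc i"] by simp
  show "dfn K (\<lambda>e. (Ord (e 0) \<and> P (e 0) (\<lambda>i. e (Suc i)) \<and> (\<forall>\<beta>\<in>elts (e 0). \<not> P \<beta> (\<lambda>i. e (Suc i)))) \<or>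
    (\<not> (\<exists>\<alpha>\<in>sets. Ord \<alpha> \<and> P \<alpha> (\<lambda>i. e (Suc i))) \<and> e 0 = empty))"
    by (intro dfn_disj dfn_conj[OF _ dfn_conj[OF P]] dfn_conj dfn_neg dfn_ex dfn_ball P2 dfn_Ord dfn_eq tm_var tm_empty)
next
  fix e :: "nat \<Rightarrow> 'c" assume e: "range e \<subseteq> sets"
  show "leastO (\<lambda>x. P x e) \<in> sets \<and> (\<forall>y\<in>sets. ((Ord y \<and> P y e \<and> (\<forall>\<beta>\<in>elts y. \<not> P \<beta> e)) \<or>
    (\<not> (\<exists>\<alpha>\<in>sets. Ord \<alpha> \<and> P \<alpha> e) \<and> y = empty)) \<longleftrightarrow> y = leastO (\<lambda>x. P x e))"
  proof (cases "\<exists>\<alpha>. Ord \<alpha> \<and> P \<alpha> e")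
    case True
    then obtain \<alpha> where \<alpha>: "Ord \<alpha>" "P \<alpha> e" by blast
    note L = leastO'[where P = P, OF dfn_mono[OF P subset_UNIV] e \<alpha>]
    have "y = leastO (\<lambda>x. P x e)" if "Ord y" "P y e" "\<forall>\<beta>\<in>elts y. \<not> P \<beta> e" for y
      using leastO_eq[of y "\<lambda>x. P x e"] that by simp
    then show ?thesis using L(1-3) True Ord_sets by blast
  next
    case False
    then show ?thesis by (auto simp: leastO_def)
  qed
qed

text \<open>Collection for ordinals without choice: each witness is replaced by the least one, and
  replacement gives the supremum \<delta>.\<close>

lemma Ord_bound:
  assumes Q: "dfn UNIV (\<lambda>e. Q (e 0) (e (Suc 0)))" and a: "a \<in> sets"
    and ex: "\<And>u. u \<in> elts a \<Longrightarrow> \<exists>\<alpha>. Ord \<alpha> \<and> Q u \<alpha>"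
  obtains \<delta> where "Ord \<delta>" "\<And>u. u \<in> elts a \<Longrightarrow> \<exists>\<alpha>. Ord \<alpha> \<and> Q u \<alpha> \<and> elts \<alpha> \<subseteq> elts \<delta>"
proof -
  have Q': "dfn UNIV (\<lambda>e. Q (e (Suc 0)) (e 0))" by (intro dfn_subst2[where P = Q, OF _ _ Q] tm_var)
  have t: "tm UNIV (\<lambda>e. leastO (Q (e 0)))" by (rule tm_leastO) (rule Q')
  obtain b where b: "b \<in> sets" "elts b = (\<lambda>u. leastO (Q u)) ` elts a"
    using replacement_fun[OF t a] by blast
  have L: "Ord (leastO (Q u)) \<and> Q u (leastO (Q u))" if u: "u \<in> elts a" for u
  proof -
    obtain \<alpha> where \<alpha>: "Ord \<alpha>" "Q u \<alpha>" using ex[OF u] by blast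
    have us: "u \<in> sets" using u elts_sets by blast
    have "dfn UNIV (\<lambda>e. Q u (e 0))"
      by (intro dfn_subst2[where P = Q, OF _ _ Q] tm_var tm_UNIV_const us)
    then show ?thesis using leastO(1,2)[of "Q u", OF _ \<alpha>] by simp
  qed
  have "Ord (bigU b)" by (rule Ord_bigU) (use b L in auto)
  moreover have "\<exists>\<alpha>. Ord \<alpha> \<and> Q u \<alpha> \<and> elts \<alpha> \<subseteq> elts (bigU b)" if "u \<in> elts a" for u
    using L[OF that] b that by (intro exI[of _ "leastO (Q u)"]) auto
  ultimately show ?thesis using that by blast
qed

section \<open>The cumulative hierarchy\<close>

lemma V_function:
  obtains \<Phi> where "tm UNIV (\<lambda>e. \<Phi> (e 0))"
    "\<And>x. x \<in> sets \<Longrightarrow> elts (\<Phi> x) = {z \<in> sets. \<exists>\<gamma>\<in>elts x. elts z \<subseteq> elts (\<Phi> \<gamma>)}"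
proof -
  define G where "G x f = Coll (\<lambda>z. \<exists>\<gamma>\<in>elts x. \<exists>y\<in>sets. opair \<gamma> y \<in> elts f \<and> elts z \<subseteq> elts y)" for x f
  have d: "dfn UNIV (\<lambda>e. \<exists>\<gamma>\<in>elts (e (Suc 0)). \<exists>y\<in>sets. opair \<gamma> y \<in> elts (e (Suc (Suc 0))) \<and> elts (e 0) \<subseteq> elts y)"
    by (intro dfn_intros)
  have tG: "tm UNIV (\<lambda>e. G (e 0) (e (Suc 0)))" unfolding G_def
  proof (rule tm_Coll[OF d])
    fix e :: "nat \<Rightarrow> 'c" assume e: "range e \<subseteq> sets"
    define f where "f = e (Suc 0)"
    have f: "f \<in> sets" using e by (auto simp: f_def)
    \<comment> \<open>Pairs are Kuratowski pairs, so values of \<open>f\<close> lie in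
      \<open>bigU (bigU f)\<close> and their subsets are subsets of the triple union; this bounds
      the class that defines \<open>G\<close>.\<close>
    obtain w where w: "w \<in> sets" "elts w = {y \<in> sets. elts y \<subseteq> elts (bigU (bigU (bigU f)))}"
      using power_set[of "bigU (bigU (bigU f))"] f by auto
    show "Coll (\<lambda>z. \<exists>\<gamma>\<in>elts (e 0). \<exists>y\<in>sets. opair \<gamma> y \<in> elts (e (Suc 0)) \<and> elts z \<subseteq> elts y) \<in> sets"
    proof (rule Coll_sets[where P = "\<lambda>z e. \<exists>\<gamma>\<in>elts (e 0). \<exists>y\<in>sets. opair \<gamma> y \<in> elts (e (Suc 0)) \<and> elts z \<subseteq> elts y", OF d e w(1)])
      fix z assume z: "z \<in> sets" "\<exists>\<gamma>\<in>elts (e 0). \<exists>y\<in>sets. opair \<gamma> y \<in> elts (e (Suc 0)) \<and> elts z \<subseteq> elts y"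
      then obtain \<gamma> y where y: "\<gamma> \<in> sets" "y \<in> sets" "opair \<gamma> y \<in> elts f" "elts z \<subseteq> elts y"
        using elts_sets unfolding f_def by blast
      have "upair \<gamma> y \<in> elts (bigU f)" using y f by (auto simp: opair_def intro!: bexI[of _ "opair \<gamma> y"])
      then have "y \<in> elts (bigU (bigU f))" using y f by (auto intro!: bexI[of _ "upair \<gamma> y"] simp del: elts_bigU simp: elts_bigU[of "bigU f"])
      then have "elts y \<subseteq> elts (bigU (bigU (bigU f)))" using f by (auto simp del: elts_bigU simp: elts_bigU[of "bigU (bigU f)"])
      then show "z \<in> elts w" using w z y by auto
    qed
  qed
  obtain \<Phi> where \<Phi>: "tm UNIV (\<lambda>e. \<Phi> (e 0))" "\<And>x. x \<in> sets \<Longrightarrow> \<Phi> x = G x (lam (tc x) \<Phi>)"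
    by (rule recursion[OF tG]) (rule that)
  have \<Phi>s: "\<Phi> x \<in> sets" if "x \<in> sets" for x using tm_app1_sets[OF \<Phi>(1) that] .
  have "elts (\<Phi> x) = {z \<in> sets. \<exists>\<gamma>\<in>elts x. elts z \<subseteq> elts (\<Phi> \<gamma>)}" if x: "x \<in> sets" for x
  proof -
    let ?f = "lam (tc x) \<Phi>"
    have f: "?f \<in> sets" "elts ?f = (\<lambda>y. opair y (\<Phi> y)) ` elts (tc x)" using lam_aux[OF \<Phi>(1)] x by auto
    have "elts (\<Phi> x) = {z \<in> sets. \<exists>\<gamma>\<in>elts x. \<exists>y\<in>sets. opair \<gamma> y \<in> elts ?f \<and> elts z \<subseteq> elts y}"
      unfolding \<Phi>(2)[OF x] G_def
      using elts_Coll'[where P = "\<lambda>z e. \<exists>\<gamma>\<in>elts (e 0). \<exists>y\<in>sets. opair \<gamma> y \<in> elts (e (Suc 0)) \<and> elts z \<subseteq> elts y",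
          OF d, of "\<lambda>i. if i = 0 then x else ?f"] x f by auto
    moreover have "opair \<gamma> y \<in> elts ?f \<longleftrightarrow> y = \<Phi> \<gamma>" if "\<gamma> \<in> elts x" "y \<in> sets" for \<gamma> y
    proof -
      have "\<gamma> \<in> elts (tc x)" "\<gamma> \<in> sets" using that subset_tc[OF x] elts_sets by auto
      then show ?thesis unfolding f(2) using that \<Phi>s elts_sets by (auto simp: opair_eq_iff)
    qed
    ultimately show ?thesis using \<Phi>s elts_sets by auto
  qed
  with \<Phi>(1) show ?thesis by (rule that)
qed

text \<open>The recursion inside \<open>Vlev\<close> with \<open>app\<close> and \<open>Coll\<close>
  rewritten as membership. It has no parameters, unlike the solution supplied by
  \<open>recursion\<close>, and is what makes the hierarchy accessible to elementarity.\<close>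

definition Vrel :: "'c \<Rightarrow> 'c \<Rightarrow> bool" where
  "Vrel f \<alpha> \<longleftrightarrow> is_fun f (succ \<alpha>) Univ \<and> (\<forall>\<beta>\<in>elts (succ \<alpha>). \<exists>v\<in>sets. opair \<beta> v \<in> elts f \<and>
     (\<forall>z\<in>sets. z \<in> elts v \<longleftrightarrow> (\<exists>\<gamma>\<in>elts \<beta>. \<exists>w\<in>sets. opair \<gamma> w \<in> elts f \<and> elts z \<subseteq> elts w)))"

lemma dfn_Vrel0: "dfn K (\<lambda>e. Vrel (e 0) (e (Suc 0)))"
  unfolding Vrel_def by (intro dfn_conj dfn_is_fun_Univ dfn_intros)

text \<open>Three descriptions of the hierarchy coincide on ordinals: the solution \<Phi> of the
  recursion, which proves existence, the description \<open>Vlev\<close>, and the parameter-free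
  relation \<open>Vrel\<close>.\<close>

lemma Vlev_facts:
  obtains \<Phi> where "tm UNIV (\<lambda>e. \<Phi> (e 0))"
    "\<And>x. x \<in> sets \<Longrightarrow> elts (\<Phi> x) = {z \<in> sets. \<exists>\<gamma>\<in>elts x. elts z \<subseteq> elts (\<Phi> \<gamma>)}"
    "\<And>\<alpha>. Ord \<alpha> \<Longrightarrow> Vlev \<alpha> = \<Phi> \<alpha>"
    "\<And>\<alpha> v. Ord \<alpha> \<Longrightarrow> v \<in> sets \<Longrightarrow> v = \<Phi> \<alpha> \<longleftrightarrow> (\<exists>f\<in>sets. Vrel f \<alpha> \<and> opair \<alpha> v \<in> elts f)"
proof -
  obtain \<Phi> where \<Phi>: "tm UNIV (\<lambda>e. \<Phi> (e 0))"
    "\<And>x. x \<in> sets \<Longrightarrow> elts (\<Phi> x) = {z \<in> sets. \<exists>\<gamma>\<in>elts x. elts z \<subseteq> elts (\<Phi> \<gamma>)}"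
    by (rule V_function) (rule that)
  have \<Phi>s: "\<Phi> x \<in> sets" if "x \<in> sets" for x using tm_app1_sets[OF \<Phi>(1) that] .
  have coll: "Coll (\<lambda>z. \<exists>\<gamma>\<in>elts \<beta>. elts z \<subseteq> elts (app f \<gamma>)) = \<Phi> \<beta>"
    if "\<beta> \<in> sets" "\<And>\<gamma>. \<gamma> \<in> elts \<beta> \<Longrightarrow> app f \<gamma> = \<Phi> \<gamma>" for f \<beta>
    by (rule Coll_eq) (use \<Phi>(2) that in auto)
  let ?cond = "\<lambda>f \<alpha>. is_fun f (succ \<alpha>) Univ \<and>
     (\<forall>\<beta>\<in>elts (succ \<alpha>). app f \<beta> = Coll (\<lambda>x. \<exists>\<gamma>\<in>elts \<beta>. elts x \<subseteq> elts (app f \<gamma>)))"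
  \<comment> \<open>Both \<open>?cond\<close> and \<open>Vrel\<close> imply the hypothesis
    \<open>step\<close>, so this one induction compares either kind of solution with \<Phi>.\<close>
  have ind: "\<forall>\<beta>\<in>elts (succ \<alpha>). app f \<beta> = \<Phi> \<beta>"
    if \<alpha>: "Ord \<alpha>" and f: "f \<in> sets" "is_fun f (succ \<alpha>) Univ"
      and step: "\<And>\<beta>. \<beta> \<in> elts (succ \<alpha>) \<Longrightarrow> (\<And>\<gamma>. \<gamma> \<in> elts \<beta> \<Longrightarrow> app f \<gamma> = \<Phi> \<gamma>) \<Longrightarrow> app f \<beta> = \<Phi> \<beta>" for f \<alpha>
  proof
    fix \<beta> assume \<beta>: "\<beta> \<in> elts (succ \<alpha>)"
    have as: "succ \<alpha> \<in> sets" "Ord (succ \<alpha>)" using \<alpha> Ord_sets by auto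
    have mem: "opair \<beta> (\<Phi> \<beta>) \<in> elts f \<longleftrightarrow> app f \<beta> = \<Phi> \<beta>" if "\<beta> \<in> elts (succ \<alpha>)" for \<beta>
      using is_fun_iff[OF f(2), of \<beta> "\<Phi> \<beta>"] that \<Phi>s elts_sets by auto
    have "\<beta> \<in> elts (succ \<alpha>) \<longrightarrow> opair \<beta> (\<Phi> \<beta>) \<in> elts f"
    proof (rule eps_induct[of "\<lambda>\<beta>. \<beta> \<in> elts (succ \<alpha>) \<longrightarrow> opair \<beta> (\<Phi> \<beta>) \<in> elts f"])
      show "dfn UNIV (\<lambda>e. e 0 \<in> elts (succ \<alpha>) \<longrightarrow> opair (e 0) (\<Phi> (e 0)) \<in> elts f)"
        by (intro dfn_imp dfn_mem tm_opair tm_var \<Phi> tm_UNIV_const f as)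
      show "\<beta> \<in> sets" using \<beta> elts_sets by blast
      fix x assume x: "x \<in> sets" and IH: "\<And>y. y \<in> elts x \<Longrightarrow> y \<in> elts (succ \<alpha>) \<longrightarrow> opair y (\<Phi> y) \<in> elts f"
      show "x \<in> elts (succ \<alpha>) \<longrightarrow> opair x (\<Phi> x) \<in> elts f"
      proof
        assume xa: "x \<in> elts (succ \<alpha>)"
        then have "app f y = \<Phi> y" if "y \<in> elts x" for y
          using IH[OF that] mem Ord_trans[OF as(2) that] by blast
        then show "opair x (\<Phi> x) \<in> elts f" using step[OF xa] mem[OF xa] by blast
      qed
    qed
    then show "app f \<beta> = \<Phi> \<beta>" using \<beta> mem by blast
  qed
  have cond1: "\<forall>\<beta>\<in>elts (succ \<alpha>). app f \<beta> = \<Phi> \<beta>" if \<alpha>: "Ord \<alpha>" and f: "f \<in> sets" "?cond f \<alpha>" for f \<alpha>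
  proof (rule ind[OF \<alpha> f(1)])
    fix \<beta> assume \<beta>: "\<beta> \<in> elts (succ \<alpha>)" "\<And>\<gamma>. \<gamma> \<in> elts \<beta> \<Longrightarrow> app f \<gamma> = \<Phi> \<gamma>"
    have "app f \<beta> = Coll (\<lambda>x. \<exists>\<gamma>\<in>elts \<beta>. elts x \<subseteq> elts (app f \<gamma>))" using f(2) \<beta>(1) by blast
    also have "\<dots> = \<Phi> \<beta>" using coll \<beta> elts_sets by blast
    finally show "app f \<beta> = \<Phi> \<beta>" .
  qed (use f in blast)
  have cond2: "\<forall>\<beta>\<in>elts (succ \<alpha>). app f \<beta> = \<Phi> \<beta>" if \<alpha>: "Ord \<alpha>" and f: "f \<in> sets" "Vrel f \<alpha>" for f \<alpha>
  proof (rule ind[OF \<alpha> f(1)])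
    show ff: "is_fun f (succ \<alpha>) Univ" using f(2) unfolding Vrel_def by blast
    fix \<beta> assume \<beta>: "\<beta> \<in> elts (succ \<alpha>)" "\<And>\<gamma>. \<gamma> \<in> elts \<beta> \<Longrightarrow> app f \<gamma> = \<Phi> \<gamma>"
    obtain v where v: "v \<in> sets" "opair \<beta> v \<in> elts f"
      "\<forall>z\<in>sets. z \<in> elts v \<longleftrightarrow> (\<exists>\<gamma>\<in>elts \<beta>. \<exists>w\<in>sets. opair \<gamma> w \<in> elts f \<and> elts z \<subseteq> elts w)"
      using f(2) \<beta>(1) unfolding Vrel_def by blast
    have bs: "\<beta> \<in> sets" using \<beta> elts_sets by blast
    have sub: "\<gamma> \<in> elts (succ \<alpha>)" if "\<gamma> \<in> elts \<beta>" for \<gamma>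
      using Ord_trans[of "succ \<alpha>" \<gamma> \<beta>] \<alpha> \<beta> that by simp
    have "(\<exists>w\<in>sets. opair \<gamma> w \<in> elts f \<and> elts z \<subseteq> elts w) \<longleftrightarrow> elts z \<subseteq> elts (\<Phi> \<gamma>)" if "\<gamma> \<in> elts \<beta>" for \<gamma> z
      using is_fun_iff[OF ff, of \<gamma>] sub[OF that] \<beta>(2)[OF that] \<Phi>s elts_sets[OF that] by auto
    then have "\<forall>z\<in>sets. z \<in> elts v \<longleftrightarrow> (\<exists>\<gamma>\<in>elts \<beta>. elts z \<subseteq> elts (\<Phi> \<gamma>))" using v(3) by simp
    then have "elts v = elts (\<Phi> \<beta>)" unfolding \<Phi>(2)[OF bs] using elts_sets[of _ v] by auto
    then have "v = \<Phi> \<beta>" by (rule extensionality)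
    then show "app f \<beta> = \<Phi> \<beta>" using is_fun_iff[OF ff bs v(1)] v(2) by auto
  qed
  have F: "lam (succ \<alpha>) \<Phi> \<in> sets \<and> is_fun (lam (succ \<alpha>) \<Phi>) (succ \<alpha>) Univ \<and>
     (\<forall>\<beta>\<in>elts (succ \<alpha>). app (lam (succ \<alpha>) \<Phi>) \<beta> = \<Phi> \<beta>)" if "Ord \<alpha>" for \<alpha>
  proof -
    have as: "succ \<alpha> \<in> sets" using that Ord_sets by simp
    have m: "\<Phi> x \<in> elts Univ" if "x \<in> elts (succ \<alpha>)" for x using \<Phi>s elts_sets[OF that] by simp
    show ?thesis using lam_fun[OF \<Phi>(1) as m] lam_aux(1)[OF \<Phi>(1) as] by blast
  qed
  have sub: "\<gamma> \<in> elts (succ \<alpha>)" if "Ord \<alpha>" "\<beta> \<in> elts (succ \<alpha>)" "\<gamma> \<in> elts \<beta>" for \<alpha> \<beta> \<gamma>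
    using Ord_trans[of "succ \<alpha>" \<gamma> \<beta>] that by simp
  have c1: "?cond (lam (succ \<alpha>) \<Phi>) \<alpha>" if \<alpha>: "Ord \<alpha>" for \<alpha>
  proof (intro conjI ballI)
    show "is_fun (lam (succ \<alpha>) \<Phi>) (succ \<alpha>) Univ" using F[OF \<alpha>] by blast
    fix \<beta> assume \<beta>: "\<beta> \<in> elts (succ \<alpha>)"
    then show "app (lam (succ \<alpha>) \<Phi>) \<beta> = Coll (\<lambda>x. \<exists>\<gamma>\<in>elts \<beta>. elts x \<subseteq> elts (app (lam (succ \<alpha>) \<Phi>) \<gamma>))"
      using F[OF \<alpha>] coll[of \<beta> "lam (succ \<alpha>) \<Phi>"] sub[OF \<alpha> \<beta>] elts_sets[OF \<beta>] by simp
  qed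
  have c2: "Vrel (lam (succ \<alpha>) \<Phi>) \<alpha>" if \<alpha>: "Ord \<alpha>" for \<alpha>
    unfolding Vrel_def
  proof (intro conjI ballI)
    show ff: "is_fun (lam (succ \<alpha>) \<Phi>) (succ \<alpha>) Univ" using F[OF \<alpha>] by blast
    fix \<beta> assume \<beta>: "\<beta> \<in> elts (succ \<alpha>)"
    have bs: "\<beta> \<in> sets" using \<beta> elts_sets by blast
    have "(\<exists>w\<in>sets. opair \<gamma> w \<in> elts (lam (succ \<alpha>) \<Phi>) \<and> elts z \<subseteq> elts w) \<longleftrightarrow> elts z \<subseteq> elts (\<Phi> \<gamma>)" if "\<gamma> \<in> elts \<beta>" for \<gamma> z
      using is_fun_iff[OF ff, of \<gamma>] sub[OF \<alpha> \<beta> that] F[OF \<alpha>] \<Phi>s elts_sets[OF that] by auto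
    then have "\<forall>z\<in>sets. z \<in> elts (\<Phi> \<beta>) \<longleftrightarrow> (\<exists>\<gamma>\<in>elts \<beta>. \<exists>w\<in>sets. opair \<gamma> w \<in> elts (lam (succ \<alpha>) \<Phi>) \<and> elts z \<subseteq> elts w)"
      unfolding \<Phi>(2)[OF bs] by auto
    moreover have "opair \<beta> (\<Phi> \<beta>) \<in> elts (lam (succ \<alpha>) \<Phi>)"
      using is_fun_iff[OF ff bs \<Phi>s[OF bs]] \<beta> F[OF \<alpha>] by simp
    ultimately show "\<exists>v\<in>sets. opair \<beta> v \<in> elts (lam (succ \<alpha>) \<Phi>) \<and>
     (\<forall>z\<in>sets. z \<in> elts v \<longleftrightarrow> (\<exists>\<gamma>\<in>elts \<beta>. \<exists>w\<in>sets. opair \<gamma> w \<in> elts (lam (succ \<alpha>) \<Phi>) \<and> elts z \<subseteq> elts w))"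
      using \<Phi>s[OF bs] by blast
  qed
  have self: "\<alpha> \<in> elts (succ \<alpha>)" "\<alpha> \<in> sets" if "Ord \<alpha>" for \<alpha> using that Ord_sets by auto
  have "Vlev \<alpha> = \<Phi> \<alpha>" if \<alpha>: "Ord \<alpha>" for \<alpha>
    unfolding Vlev_def
  proof (rule the_equality)
    show "\<exists>f\<in>sets. is_fun f (succ \<alpha>) Univ \<and>
     (\<forall>\<beta>\<in>elts (succ \<alpha>). app f \<beta> = Coll (\<lambda>x. \<exists>\<gamma>\<in>elts \<beta>. elts x \<subseteq> elts (app f \<gamma>))) \<and> \<Phi> \<alpha> = app f \<alpha>"
      using c1[OF \<alpha>] F[OF \<alpha>] self[OF \<alpha>] by (intro bexI[of _ "lam (succ \<alpha>) \<Phi>"]) auto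
    fix v assume "\<exists>f\<in>sets. is_fun f (succ \<alpha>) Univ \<and>
     (\<forall>\<beta>\<in>elts (succ \<alpha>). app f \<beta> = Coll (\<lambda>x. \<exists>\<gamma>\<in>elts \<beta>. elts x \<subseteq> elts (app f \<gamma>))) \<and> v = app f \<alpha>"
    then show "v = \<Phi> \<alpha>" using cond1[OF \<alpha>] self[OF \<alpha>] by blast
  qed
  moreover have "v = \<Phi> \<alpha> \<longleftrightarrow> (\<exists>f\<in>sets. Vrel f \<alpha> \<and> opair \<alpha> v \<in> elts f)" if \<alpha>: "Ord \<alpha>" and v: "v \<in> sets" for \<alpha> v
  proof
    assume "v = \<Phi> \<alpha>"
    then have "opair \<alpha> v \<in> elts (lam (succ \<alpha>) \<Phi>)"
      using is_fun_iff[of "lam (succ \<alpha>) \<Phi>" "succ \<alpha>" Univ \<alpha> v] F[OF \<alpha>] v self[OF \<alpha>] by simp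
    then show "\<exists>f\<in>sets. Vrel f \<alpha> \<and> opair \<alpha> v \<in> elts f" using c2[OF \<alpha>] F[OF \<alpha>] by blast
  next
    assume "\<exists>f\<in>sets. Vrel f \<alpha> \<and> opair \<alpha> v \<in> elts f"
    then obtain f where f: "f \<in> sets" "Vrel f \<alpha>" "opair \<alpha> v \<in> elts f" by blast
    then show "v = \<Phi> \<alpha>" using cond2[OF \<alpha> f(1,2)] is_fun_iff[of f "succ \<alpha>" Univ \<alpha> v] v self[OF \<alpha>]
      unfolding Vrel_def by auto
  qed
  ultimately show ?thesis by (intro that[OF \<Phi>])
qed

lemma Vlev_sets [simp]: "Ord \<alpha> \<Longrightarrow> Vlev \<alpha> \<in> sets"
  by (rule Vlev_facts) (simp add: tm_app1_sets Ord_sets)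

lemma elts_Vlev:
  assumes "Ord \<alpha>"
  shows "elts (Vlev \<alpha>) = {z \<in> sets. \<exists>\<gamma>\<in>elts \<alpha>. elts z \<subseteq> elts (Vlev \<gamma>)}"
proof (rule Vlev_facts)
  fix \<Phi> assume "\<And>x. x \<in> sets \<Longrightarrow> elts (\<Phi> x) = {z \<in> sets. \<exists>\<gamma>\<in>elts x. elts z \<subseteq> elts (\<Phi> \<gamma>)}"
    "\<And>\<alpha>. Ord \<alpha> \<Longrightarrow> Vlev \<alpha> = \<Phi> \<alpha>"
  then show ?thesis using assms Ord_in[OF assms] Ord_sets by auto
qed

text \<open>
  Outside the ordinals \<open>Vlev\<close> is an unspecified class, which need not be definable.
\<close>

definition Vz :: "'c \<Rightarrow> 'c" where
  "Vz \<alpha> = (if Ord \<alpha> then Vlev \<alpha> else empty)"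

lemma Vz_Ord [simp]: "Ord \<alpha> \<Longrightarrow> Vz \<alpha> = Vlev \<alpha>" by (simp add: Vz_def)

lemma tm_Vz0: "tm K (\<lambda>e. Vz (e 0))"
proof (rule tm_The[where Q = "\<lambda>v e. (Ord (e 0) \<and> (\<exists>f\<in>sets. Vrel f (e 0) \<and> opair (e 0) v \<in> elts f)) \<or>
    (\<not> Ord (e 0) \<and> v = empty)"])
  show "dfn K (\<lambda>e. (Ord (e (Suc 0)) \<and> (\<exists>f\<in>sets. Vrel f (e (Suc 0)) \<and> opair (e (Suc 0)) (e 0) \<in> elts f)) \<or>
    (\<not> Ord (e (Suc 0)) \<and> e 0 = empty))"
    by (intro dfn_intros dfn_subst2[where P = Vrel, OF _ _ dfn_Vrel0])
next
  fix e :: "nat \<Rightarrow> 'c" assume "range e \<subseteq> sets"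
  show "Vz (e 0) \<in> sets \<and> (\<forall>v\<in>sets. ((Ord (e 0) \<and> (\<exists>f\<in>sets. Vrel f (e 0) \<and> opair (e 0) v \<in> elts f)) \<or>
    (\<not> Ord (e 0) \<and> v = empty)) \<longleftrightarrow> v = Vz (e 0))"
  proof (rule Vlev_facts)
    fix \<Phi> assume *: "\<And>\<alpha>. Ord \<alpha> \<Longrightarrow> Vlev \<alpha> = \<Phi> \<alpha>"
    "\<And>\<alpha> v. Ord \<alpha> \<Longrightarrow> v \<in> sets \<Longrightarrow> v = \<Phi> \<alpha> \<longleftrightarrow> (\<exists>f\<in>sets. Vrel f \<alpha> \<and> opair \<alpha> v \<in> elts f)"
    show ?thesis
    proof (cases "Ord (e 0)")
      case True
      have "(\<exists>f\<in>sets. Vrel f (e 0) \<and> opair (e 0) v \<in> elts f) \<longleftrightarrow> v = Vlev (e 0)" if "v \<in> sets" for v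
        unfolding *(1)[OF True] using *(2)[OF True that] by blast
      then show ?thesis using True by simp
    qed (simp add: Vz_def)
  qed
qed

lemmas tm_Vz [dfn_intros] = tm_subst1[where f = Vz, OF _ tm_Vz0]

lemma V_mono: "Ord a \<Longrightarrow> Ord b \<Longrightarrow> elts a \<subseteq> elts b \<Longrightarrow> elts (Vlev a) \<subseteq> elts (Vlev b)"
  by (auto simp: elts_Vlev)

lemma V_mono_mem: "Ord b \<Longrightarrow> a \<in> elts b \<Longrightarrow> elts (Vlev a) \<subseteq> elts (Vlev b)"
  using V_mono[of a b] Ord_in[of b a] Ord_subset_iff[of a b] by blast

lemma V_transitive: "Ord \<alpha> \<Longrightarrow> transitive (Vlev \<alpha>)"
  unfolding transitive_def
proof
  fix y assume \<alpha>: "Ord \<alpha>" and "y \<in> elts (Vlev \<alpha>)"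
  then obtain \<gamma> where "\<gamma> \<in> elts \<alpha>" "elts y \<subseteq> elts (Vlev \<gamma>)" using elts_Vlev[OF \<alpha>] by blast
  then show "elts y \<subseteq> elts (Vlev \<alpha>)" using V_mono_mem[OF \<alpha>] by blast
qed

lemma V_succ: "Ord \<alpha> \<Longrightarrow> elts (Vlev (succ \<alpha>)) = {x \<in> sets. elts x \<subseteq> elts (Vlev \<alpha>)}"
  using V_mono_mem[of \<alpha>] Ord_sets[of \<alpha>] by (auto simp: elts_Vlev[of "succ \<alpha>"])

lemma Ord_subset_V: "Ord \<beta> \<Longrightarrow> elts \<beta> \<subseteq> elts (Vlev \<beta>)"
proof -
  assume b: "Ord \<beta>"
  have "Ord \<beta> \<longrightarrow> elts \<beta> \<subseteq> elts (Vz \<beta>)"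
  proof (rule eps_induct[of "\<lambda>\<beta>. Ord \<beta> \<longrightarrow> elts \<beta> \<subseteq> elts (Vz \<beta>)"])
    show "dfn UNIV (\<lambda>e. Ord (e 0) \<longrightarrow> elts (e 0) \<subseteq> elts (Vz (e 0)))" by (intro dfn_intros)
    fix x assume "x \<in> sets" and IH: "\<And>y. y \<in> elts x \<Longrightarrow> Ord y \<longrightarrow> elts y \<subseteq> elts (Vz y)"
    then show "Ord x \<longrightarrow> elts x \<subseteq> elts (Vz x)"
      using Ord_in[of x] elts_sets[of _ x] by (auto simp: elts_Vlev[of x])
  qed (use b Ord_sets in auto)
  then show ?thesis using b by simp
qed

lemma Ord_notin_V: "Ord \<beta> \<Longrightarrow> \<beta> \<notin> elts (Vlev \<beta>)"
proof -
  assume b: "Ord \<beta>"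
  have "Ord \<beta> \<longrightarrow> \<beta> \<notin> elts (Vz \<beta>)"
  proof (rule eps_induct[of "\<lambda>\<beta>. Ord \<beta> \<longrightarrow> \<beta> \<notin> elts (Vz \<beta>)"])
    show "dfn UNIV (\<lambda>e. Ord (e 0) \<longrightarrow> e 0 \<notin> elts (Vz (e 0)))" by (intro dfn_intros)
    fix x assume "x \<in> sets" and IH: "\<And>y. y \<in> elts x \<Longrightarrow> Ord y \<longrightarrow> y \<notin> elts (Vz y)"
    then show "Ord x \<longrightarrow> x \<notin> elts (Vz x)"
      using Ord_in[of x] by (auto simp: elts_Vlev[of x])
  qed (use b Ord_sets in auto)
  then show ?thesis using b by simp
qed

lemma Ord_mem_V: "Ord \<alpha> \<Longrightarrow> Ord \<beta> \<Longrightarrow> \<beta> \<in> elts (Vlev \<alpha>) \<longleftrightarrow> \<beta> \<in> elts \<alpha>"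
  using Ord_subset_V[of \<alpha>] Ord_notin_V[of \<alpha>] Ord_linear[of \<alpha> \<beta>] V_transitive[of \<alpha>]
  unfolding transitive_def by blast

text \<open>Membership induction: \<open>Ord_bound\<close> gives one level that includes
  \<open>x\<close>, and \<open>x\<close> belongs to the next.\<close>

lemma ex_V: "x \<in> sets \<Longrightarrow> \<exists>\<alpha>. Ord \<alpha> \<and> x \<in> elts (Vlev \<alpha>)"
proof -
  assume x: "x \<in> sets"
  have "\<exists>\<alpha>\<in>sets. Ord \<alpha> \<and> x \<in> elts (Vz \<alpha>)"
  proof (rule eps_induct[of "\<lambda>x. \<exists>\<alpha>\<in>sets. Ord \<alpha> \<and> x \<in> elts (Vz \<alpha>)"])
    show "dfn UNIV (\<lambda>e. \<exists>\<alpha>\<in>sets. Ord \<alpha> \<and> e 0 \<in> elts (Vz \<alpha>))" by (intro dfn_intros)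
    fix x assume x: "x \<in> sets" and IH: "\<And>y. y \<in> elts x \<Longrightarrow> \<exists>\<alpha>\<in>sets. Ord \<alpha> \<and> y \<in> elts (Vz \<alpha>)"
    have "dfn UNIV (\<lambda>e. e 0 \<in> elts (Vz (e (Suc 0))))" by (intro dfn_intros)
    then obtain \<delta> where \<delta>: "Ord \<delta>" "\<And>u. u \<in> elts x \<Longrightarrow> \<exists>\<alpha>. Ord \<alpha> \<and> u \<in> elts (Vz \<alpha>) \<and> elts \<alpha> \<subseteq> elts \<delta>"
      by (rule Ord_bound[where Q = "\<lambda>u \<alpha>. u \<in> elts (Vz \<alpha>)", OF _ x]) (use IH in blast, rule that)
    have "elts x \<subseteq> elts (Vlev \<delta>)" using \<delta> V_mono[OF _ \<delta>(1)] by (metis Vz_Ord subset_eq)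
    then have "x \<in> elts (Vlev (succ \<delta>))" using V_succ[OF \<delta>(1)] x by blast
    then show "\<exists>\<alpha>\<in>sets. Ord \<alpha> \<and> x \<in> elts (Vz \<alpha>)"
      using \<delta>(1) Ord_sets by (intro bexI[of _ "succ \<delta>"]) auto
  qed (rule x)
  then show ?thesis by auto
qed

text \<open>Witnesses are enclosed in a level instead of being chosen. The relation \<open>Q\<close>
  holds vacuously where no witness exists, so \<open>Ord_bound\<close> applies to every element of
  \<open>a\<close>.\<close>

lemma collection:
  assumes R: "dfn UNIV (\<lambda>e. R (e 0) (e (Suc 0)))" and a: "a \<in> sets"
  obtains \<delta> where "Ord \<delta>" "\<And>x. x \<in> elts a \<Longrightarrow> \<exists>y\<in>sets. R x y \<Longrightarrow> \<exists>y\<in>elts (Vlev \<delta>). R x y"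
proof -
  define Q where "Q x \<alpha> \<longleftrightarrow> ((\<exists>y\<in>sets. R x y) \<longrightarrow> (\<exists>y\<in>elts (Vz \<alpha>). R x y))" for x \<alpha>
  have "dfn UNIV (\<lambda>e. Q (e 0) (e (Suc 0)))" unfolding Q_def
    by (intro dfn_imp dfn_ex dfn_bex tm_Vz dfn_subst2[where P = R, OF _ _ R] tm_var)
  moreover have "\<exists>\<alpha>. Ord \<alpha> \<and> Q x \<alpha>" if "x \<in> elts a" for x
  proof (cases "\<exists>y\<in>sets. R x y")
    case True
    then obtain y where y: "y \<in> sets" "R x y" by blast
    obtain \<alpha> where "Ord \<alpha>" "y \<in> elts (Vlev \<alpha>)" using ex_V[OF y(1)] by blast
    then show ?thesis using y unfolding Q_def by (intro exI[of _ \<alpha>]) auto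
  next
    case False
    then show ?thesis unfolding Q_def by (intro exI[of _ empty]) simp
  qed
  ultimately obtain \<delta> where \<delta>: "Ord \<delta>" "\<And>u. u \<in> elts a \<Longrightarrow> \<exists>\<alpha>. Ord \<alpha> \<and> Q u \<alpha> \<and> elts \<alpha> \<subseteq> elts \<delta>"
    by (rule Ord_bound[where Q = Q, OF _ a]) (assumption, rule that)
  have "\<exists>y\<in>elts (Vlev \<delta>). R x y" if x: "x \<in> elts a" "\<exists>y\<in>sets. R x y" for x
  proof -
    obtain \<alpha> where \<alpha>: "Ord \<alpha>" "Q x \<alpha>" "elts \<alpha> \<subseteq> elts \<delta>" using \<delta>(2)[OF x(1)] by blast
    then obtain y where "y \<in> elts (Vlev \<alpha>)" "R x y" using x(2) unfolding Q_def by auto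
    then show ?thesis using V_mono[OF \<alpha>(1) \<delta>(1) \<alpha>(3)] by blast
  qed
  then show ?thesis using that \<delta>(1) by blast
qed

section \<open>Limit ordinals and the closure of their levels\<close>

definition Limit :: "'c \<Rightarrow> bool" where
  "Limit \<nu> \<longleftrightarrow> Ord \<nu> \<and> empty \<in> elts \<nu> \<and> (\<forall>\<gamma>\<in>elts \<nu>. succ \<gamma> \<in> elts \<nu>)"

lemma Limit_Ord: "Limit \<nu> \<Longrightarrow> Ord \<nu>" by (simp add: Limit_def)

lemma opair_V:
  assumes "Ord \<gamma>" "x \<in> elts (Vlev \<gamma>)" "y \<in> elts (Vlev \<gamma>)"
  shows "opair x y \<in> elts (Vlev (succ (succ \<gamma>)))"
proof -
  have xy: "x \<in> sets" "y \<in> sets" using assms elts_sets by auto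
  then have "upair x x \<in> elts (Vlev (succ \<gamma>))" "upair x y \<in> elts (Vlev (succ \<gamma>))" using assms by (auto simp: V_succ)
  then show ?thesis using xy assms(1) by (auto simp: V_succ[of "succ \<gamma>"] opair_def)
qed

lemma Limit_V_mem:
  assumes "Limit \<nu>" "x \<in> elts (Vlev \<nu>)"
  obtains \<gamma> where "\<gamma> \<in> elts \<nu>" "x \<in> elts (Vlev \<gamma>)"
proof -
  obtain \<gamma> where \<gamma>: "\<gamma> \<in> elts \<nu>" "elts x \<subseteq> elts (Vlev \<gamma>)" "x \<in> sets" using assms elts_Vlev[of \<nu>] by (auto simp: Limit_def)
  moreover have "Ord \<gamma>" using \<gamma> assms Ord_in Limit_Ord by blast
  ultimately have "x \<in> elts (Vlev (succ \<gamma>))" "succ \<gamma> \<in> elts \<nu>" using assms by (auto simp: V_succ Limit_def)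
  then show ?thesis using that by blast
qed

lemma Limit_opair:
  assumes "Limit \<nu>" "x \<in> elts (Vlev \<nu>)" "y \<in> elts (Vlev \<nu>)"
  shows "opair x y \<in> elts (Vlev \<nu>)"
proof -
  obtain a b where ab: "a \<in> elts \<nu>" "x \<in> elts (Vlev a)" "b \<in> elts \<nu>" "y \<in> elts (Vlev b)"
    using Limit_V_mem[OF assms(1)] assms(2,3) by metis
  have o: "Ord a" "Ord b" "Ord \<nu>" using ab Ord_in Limit_Ord assms(1) by blast+
  obtain c where c: "Ord c" "elts a \<subseteq> elts c" "elts b \<subseteq> elts c" "c = a \<or> c = b"
    using Ord_max[OF o(1,2)] by blast
  have "x \<in> elts (Vlev c)" "y \<in> elts (Vlev c)" using ab V_mono o c by blast+
  then have "opair x y \<in> elts (Vlev (succ (succ c)))" using opair_V c by blast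
  moreover have "succ (succ c) \<in> elts \<nu>" using c ab assms(1) unfolding Limit_def by blast
  ultimately show ?thesis using V_mono_mem[OF o(3)] by blast
qed

text \<open>Forming pairs costs two levels and collecting them a third; a limit absorbs all
  three.\<close>

lemma Limit_relation:
  assumes "Limit \<nu>" "\<gamma> \<in> elts \<nu>" "r \<in> sets"
    "\<And>p. p \<in> elts r \<Longrightarrow> \<exists>x\<in>elts (Vlev \<gamma>). \<exists>y\<in>elts (Vlev \<gamma>). p = opair x y"
  shows "r \<in> elts (Vlev \<nu>)"
proof -
  have o: "Ord \<gamma>" "Ord \<nu>" using Ord_in Limit_Ord assms by blast+
  have "elts r \<subseteq> elts (Vlev (succ (succ \<gamma>)))" using assms(4) opair_V[OF o(1)] by blast
  then have "r \<in> elts (Vlev (succ (succ (succ \<gamma>))))" using o assms(3) by (auto simp: V_succ[of "succ (succ \<gamma>)"])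
  moreover have "succ (succ (succ \<gamma>)) \<in> elts \<nu>" using assms(1,2) unfolding Limit_def by blast
  ultimately show ?thesis using V_mono_mem[OF o(2)] by blast
qed

lemma Limit_omega: "Limit omega" unfolding Limit_def by simp

lemma omega_subset_Limit: "Limit \<nu> \<Longrightarrow> elts omega \<subseteq> elts \<nu>"
proof
  fix m assume "Limit \<nu>" "m \<in> elts omega"
  then show "m \<in> elts \<nu>"
    by (intro omega_induct[of "\<lambda>m. m \<in> elts \<nu>" m] dfn_intros tm_UNIV_const) (auto simp: Limit_def Ord_sets)
qed

text \<open>
  Assignments are total functions on \<open>\<omega>\<close>, so reflection at \<open>V\<^sub>\<nu>\<close> is proved for \<open>\<nu>\<close> of uncountable
  cofinality. Without choice such ordinals need not exist; here they are built as suprema of chains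
  whose length is the critical point of the embedding.
\<close>

definition omega_regular :: "'c \<Rightarrow> bool" where
  "omega_regular \<kappa> \<longleftrightarrow> Ord \<kappa> \<and> empty \<in> elts \<kappa> \<and>
     (\<forall>g\<in>sets. is_fun g omega \<kappa> \<longrightarrow> (\<exists>\<delta>\<in>elts \<kappa>. \<forall>m\<in>elts omega. app g m \<in> elts \<delta>))"

text \<open>Regularity applied to the constant sequence with value \<beta>.\<close>

lemma omega_regular_limit:
  assumes "omega_regular \<kappa>" "\<beta> \<in> elts \<kappa>"
  obtains \<delta> where "\<delta> \<in> elts \<kappa>" "\<beta> \<in> elts \<delta>"
proof -
  have bs: "\<beta> \<in> sets" using assms elts_sets by blast
  have t: "tm UNIV (\<lambda>e. (\<lambda>_. \<beta>) (e 0))" using tm_UNIV_const[OF bs] by simp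
  have "is_fun (lam omega (\<lambda>_. \<beta>)) omega \<kappa>" "lam omega (\<lambda>_. \<beta>) \<in> sets" "app (lam omega (\<lambda>_. \<beta>)) empty = \<beta>"
    using lam_fun[OF t omega_sets, of \<kappa>] lam_aux[OF t omega_sets] assms(2) by auto
  then obtain \<delta> where "\<delta> \<in> elts \<kappa>" "\<forall>m\<in>elts omega. app (lam omega (\<lambda>_. \<beta>)) m \<in> elts \<delta>"
    using assms(1) unfolding omega_regular_def by blast
  then show ?thesis using that \<open>app (lam omega (\<lambda>_. \<beta>)) empty = \<beta>\<close> empty_omega by metis
qed

text \<open>The ordinal \<nu> is the supremum of an increasing chain \<open>\<Phi> \<beta>\<close>,
  \<beta> below \<kappa>, in which each stage contains witnesses for all parameters from earlier
  stages. Each value of a sequence from omega into \<open>V_\<nu>\<close> appears at some stage, and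
  by regularity a single stage contains all of them.\<close>

theorem reflection_closure:
  fixes m :: nat
  assumes \<kappa>: "omega_regular \<kappa>" and R: "\<And>i. i < m \<Longrightarrow> dfn UNIV (\<lambda>e. R i (e 0) (e (Suc 0)))" and a0: "Ord \<alpha>0"
  obtains \<nu> where "Limit \<nu>" "\<alpha>0 \<in> elts \<nu>"
    "\<And>s. s \<in> sets \<Longrightarrow> is_fun s omega (Vlev \<nu>) \<Longrightarrow> \<exists>\<gamma>\<in>elts \<nu>. is_fun s omega (Vlev \<gamma>)"
    "\<And>i x y. i < m \<Longrightarrow> x \<in> elts (Vlev \<nu>) \<Longrightarrow> y \<in> sets \<Longrightarrow> R i x y \<Longrightarrow> \<exists>y\<in>elts (Vlev \<nu>). R i x y"
proof -
  \<comment> \<open>\<open>F \<gamma> \<delta>\<close>: the level \<delta> has witnesses for every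
    solvable instance with parameter in the level \<gamma>, for all of the finitely many
    relations.\<close>
  define F where "F \<gamma> \<delta> \<longleftrightarrow> (\<forall>i<m. \<forall>x\<in>elts (Vz \<gamma>). (\<exists>y\<in>sets. R i x y) \<longrightarrow> (\<exists>y\<in>elts (Vz \<delta>). R i x y))" for \<gamma> \<delta>
  have dF: "dfn UNIV (\<lambda>e. F (e 0) (e (Suc 0)))" unfolding F_def
  proof (rule dfn_all_less)
    fix i assume i: "i < m"
    show "dfn UNIV (\<lambda>e. \<forall>x\<in>elts (Vz (e 0)). (\<exists>y\<in>sets. R i x y) \<longrightarrow> (\<exists>y\<in>elts (Vz (e (Suc 0))). R i x y))"
      by (intro dfn_ball dfn_imp dfn_ex dfn_bex tm_Vz dfn_subst2[where P = "R i", OF _ _ R[OF i]] tm_var)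
  qed
  have F_mono: "F \<gamma> \<delta>'" if "F \<gamma> \<delta>" "Ord \<delta>" "Ord \<delta>'" "elts \<delta> \<subseteq> elts \<delta>'" for \<gamma> \<delta> \<delta>'
  proof -
    have sub: "elts (Vz \<delta>) \<subseteq> elts (Vz \<delta>')" using V_mono[OF that(2-4)] that by simp
    show ?thesis unfolding F_def
    proof (intro allI impI ballI)
      fix i x assume "i < m" "x \<in> elts (Vz \<gamma>)" "\<exists>y\<in>sets. R i x y"
      then have "\<exists>y\<in>elts (Vz \<delta>). R i x y" using that(1) unfolding F_def by simp
      then show "\<exists>y\<in>elts (Vz \<delta>'). R i x y" using sub by blast
    qed
  qed
  have F_ex: "\<exists>\<delta>. Ord \<delta> \<and> F \<gamma> \<delta>" if \<gamma>: "Ord \<gamma>" for \<gamma>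
  proof -
    have "k \<le> m \<Longrightarrow> \<exists>\<delta>. Ord \<delta> \<and> (\<forall>i<k. \<forall>x\<in>elts (Vz \<gamma>). (\<exists>y\<in>sets. R i x y) \<longrightarrow> (\<exists>y\<in>elts (Vz \<delta>). R i x y))" for k
    proof (induction k)
      case 0
      then show ?case by (auto intro!: exI[of _ empty])
    next
      case (Suc k)
      then obtain \<delta> where \<delta>: "Ord \<delta>" "\<forall>i<k. \<forall>x\<in>elts (Vz \<gamma>). (\<exists>y\<in>sets. R i x y) \<longrightarrow> (\<exists>y\<in>elts (Vz \<delta>). R i x y)" by auto
      have k: "k < m" using Suc.prems by simp
      obtain \<delta>' where \<delta>': "Ord \<delta>'" "\<And>x. x \<in> elts (Vlev \<gamma>) \<Longrightarrow> \<exists>y\<in>sets. R k x y \<Longrightarrow> \<exists>y\<in>elts (Vlev \<delta>'). R k x y"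
        by (rule collection[OF R[OF k] Vlev_sets[OF \<gamma>]]) (rule that)
      obtain c where c: "Ord c" "elts \<delta> \<subseteq> elts c" "elts \<delta>' \<subseteq> elts c" using Ord_max[OF \<delta>(1) \<delta>'(1)] by blast
      have s: "elts (Vz \<delta>) \<subseteq> elts (Vz c)" "elts (Vlev \<delta>') \<subseteq> elts (Vz c)"
        using V_mono c \<delta>(1) \<delta>'(1) by simp_all
      have "\<exists>y\<in>elts (Vz c). R i x y" if i: "i < Suc k" and x: "x \<in> elts (Vz \<gamma>)" and y: "\<exists>y\<in>sets. R i x y" for i x
      proof (cases "i = k")
        case True
        then have "\<exists>y\<in>elts (Vlev \<delta>'). R i x y" using \<delta>'(2)[of x] x y \<gamma> by simp
        then show ?thesis using s(2) by blast
      next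
        case False
        then have "\<exists>y\<in>elts (Vz \<delta>). R i x y" using \<delta>(2) i x y by simp
        then show ?thesis using s(1) by blast
      qed
      then show ?case using c(1) by blast
    qed
    then show ?thesis unfolding F_def by blast
  qed
  \<comment> \<open>\<open>f\<close> stands for the chain constructed so far, but the recursion step
    must be a term on arbitrary sets. The guard \<open>Ord v\<close> keeps the requirement
    satisfiable for each of them.\<close>
  define S where "S f \<delta> \<longleftrightarrow> \<alpha>0 \<in> elts \<delta> \<and>
    (\<forall>u\<in>sets. \<forall>v\<in>sets. opair u v \<in> elts f \<longrightarrow> Ord v \<longrightarrow> v \<in> elts \<delta> \<and> F v \<delta>)" for f \<delta>
  have dS: "dfn UNIV (\<lambda>e. S (e 0) (e (Suc 0)))" unfolding S_def
    by (intro dfn_conj dfn_mem dfn_all dfn_imp dfn_Ord tm_opair dfn_subst2[where P = F, OF _ _ dF]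
        tm_var tm_UNIV_const Ord_sets[OF a0])
  have exS: "\<exists>\<delta>. Ord \<delta> \<and> S f \<delta>" if f: "f \<in> sets" for f
  proof -
    define Q where "Q v \<delta> \<longleftrightarrow> (Ord v \<longrightarrow> v \<in> elts \<delta> \<and> F v \<delta>)" for v \<delta>
    have dQ: "dfn UNIV (\<lambda>e. Q (e 0) (e (Suc 0)))" unfolding Q_def
      by (intro dfn_conj dfn_mem dfn_imp dfn_Ord dfn_subst2[where P = F, OF _ _ dF] tm_var)
    have exQ: "\<exists>\<delta>. Ord \<delta> \<and> Q v \<delta>" for v
    proof (cases "Ord v")
      case True
      then obtain \<delta> where \<delta>: "Ord \<delta>" "F v \<delta>" using F_ex by blast
      obtain c where c: "Ord c" "elts \<delta> \<subseteq> elts c" "elts (succ v) \<subseteq> elts c"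
        using Ord_max[OF \<delta>(1) Ord_succ[OF True]] by blast
      then have "v \<in> elts c" using True Ord_sets by auto
      then show ?thesis using F_mono[OF \<delta>(2,1) c(1,2)] c(1) unfolding Q_def by blast
    next
      case False
      then show ?thesis unfolding Q_def using Ord_empty by blast
    qed
    have a: "bigU (bigU f) \<in> sets" using f by simp
    obtain \<delta> where \<delta>: "Ord \<delta>" "\<And>u. u \<in> elts (bigU (bigU f)) \<Longrightarrow> \<exists>\<alpha>. Ord \<alpha> \<and> Q u \<alpha> \<and> elts \<alpha> \<subseteq> elts \<delta>"
      by (rule Ord_bound[where Q = Q, OF dQ a exQ]) (rule that)
    obtain c where c: "Ord c" "elts \<delta> \<subseteq> elts c" "elts (succ \<alpha>0) \<subseteq> elts c"
      using Ord_max[OF \<delta>(1) Ord_succ[OF a0]] by blast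
    have "S f c" unfolding S_def
    proof (intro conjI ballI impI)
      show "\<alpha>0 \<in> elts c" using c a0 Ord_sets by auto
      fix u v assume uv: "u \<in> sets" "v \<in> sets" "opair u v \<in> elts f" "Ord v"
      have "upair u v \<in> elts (opair u v)" "v \<in> elts (upair u v)" using uv by (auto simp: opair_def)
      then have "v \<in> elts (bigU (bigU f))" using f uv(3) by (auto simp del: elts_upair)
      then obtain \<alpha> where \<alpha>: "Ord \<alpha>" "Q v \<alpha>" "elts \<alpha> \<subseteq> elts \<delta>" using \<delta>(2) by blast
      have "elts \<alpha> \<subseteq> elts c" using \<alpha> c by blast
      then show "v \<in> elts c" "F v c" using \<alpha> uv(4) F_mono[OF _ \<alpha>(1) c(1)] unfolding Q_def by blast+
    qed
    then show ?thesis using c(1) by blast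
  qed
  define G where "G x f = leastO (S f)" for x f :: 'c
  have dS': "dfn UNIV (\<lambda>e. S (e (Suc (Suc 0))) (e 0))" by (intro dfn_subst2[where P = S, OF _ _ dS] tm_var)
  have tG: "tm UNIV (\<lambda>e. G (e 0) (e (Suc 0)))" unfolding G_def
    by (rule tm_leastO) (rule dS')
  have G: "Ord (G x f)" "S f (G x f)" if f: "f \<in> sets" for x f
  proof -
    have "dfn UNIV (\<lambda>e. S f (e 0))" by (intro dfn_subst2[where P = S, OF _ _ dS] tm_var tm_UNIV_const f)
    then show "Ord (G x f)" "S f (G x f)" unfolding G_def using exS[OF f] leastO(1,2)[of "S f"] by auto
  qed
  obtain \<Phi> where t\<Phi>: "tm UNIV (\<lambda>e. \<Phi> (e 0))" and \<Phi>: "\<And>x. x \<in> sets \<Longrightarrow> \<Phi> x = G x (lam (tc x) \<Phi>)"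
    by (rule recursion[OF tG]) (rule that)
  have lam_sets: "lam (tc x) \<Phi> \<in> sets" if "x \<in> sets" for x using lam_aux(1)[OF t\<Phi>] that by simp
  have \<Phi>_Ord: "Ord (\<Phi> x)" if "x \<in> sets" for x using G(1)[OF lam_sets[OF that], of x] \<Phi>[OF that] by simp
  have \<Phi>_a0: "\<alpha>0 \<in> elts (\<Phi> x)" if "x \<in> sets" for x
    using G(2)[OF lam_sets[OF that], of x] \<Phi>[OF that] unfolding S_def by simp
  have \<Phi>_step: "\<Phi> \<gamma> \<in> elts (\<Phi> \<beta>) \<and> F (\<Phi> \<gamma>) (\<Phi> \<beta>)" if \<beta>: "Ord \<beta>" and \<gamma>: "\<gamma> \<in> elts \<beta>" for \<beta> \<gamma>
  proof -
    have bs: "\<beta> \<in> sets" "\<gamma> \<in> sets" using \<beta> \<gamma> Ord_sets elts_sets by auto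
    have "S (lam \<beta> \<Phi>) (\<Phi> \<beta>)" using G(2)[OF lam_sets[OF bs(1)], of \<beta>] \<Phi>[OF bs(1)] tc_Ord[OF \<beta>] by simp
    moreover have "opair \<gamma> (\<Phi> \<gamma>) \<in> elts (lam \<beta> \<Phi>)" using lam_aux(2)[OF t\<Phi> bs(1)] \<gamma> by auto
    ultimately show ?thesis using bs \<Phi>_Ord[OF bs(2)] Ord_sets unfolding S_def by blast
  qed
  have k: "Ord \<kappa>" "\<kappa> \<in> sets" "empty \<in> elts \<kappa>" using \<kappa> Ord_sets unfolding omega_regular_def by auto
  obtain b where b: "b \<in> sets" "elts b = \<Phi> ` elts \<kappa>" using replacement_fun[OF t\<Phi> k(2)] by blast
  define \<nu> where "\<nu> = bigU b"
  have \<nu>: "elts \<nu> = (\<Union>\<beta>\<in>elts \<kappa>. elts (\<Phi> \<beta>))" unfolding \<nu>_def using b by simp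
  have o\<nu>: "Ord \<nu>" unfolding \<nu>_def by (rule Ord_bigU) (use b \<Phi>_Ord elts_sets in auto)
  have \<Phi>in: "\<exists>\<delta>\<in>elts \<kappa>. \<beta> \<in> elts \<delta> \<and> \<Phi> \<beta> \<in> elts (\<Phi> \<delta>) \<and> F (\<Phi> \<beta>) (\<Phi> \<delta>)" if "\<beta> \<in> elts \<kappa>" for \<beta>
  proof (rule omega_regular_limit[OF \<kappa> that])
    fix \<delta> assume "\<delta> \<in> elts \<kappa>" "\<beta> \<in> elts \<delta>"
    then show ?thesis using \<Phi>_step[of \<delta> \<beta>] Ord_in[OF k(1)] by blast
  qed
  have \<Phi>\<nu>: "\<Phi> \<beta> \<in> elts \<nu>" if "\<beta> \<in> elts \<kappa>" for \<beta> using \<Phi>in[OF that] \<nu> by auto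
  have V\<nu>: "\<exists>\<beta>\<in>elts \<kappa>. x \<in> elts (Vlev (\<Phi> \<beta>))" if x: "x \<in> elts (Vlev \<nu>)" for x
  proof -
    obtain \<gamma> where \<gamma>: "\<gamma> \<in> elts \<nu>" "elts x \<subseteq> elts (Vlev \<gamma>)" "x \<in> sets" using x elts_Vlev[OF o\<nu>] by auto
    then obtain \<beta> where \<beta>: "\<beta> \<in> elts \<kappa>" "\<gamma> \<in> elts (\<Phi> \<beta>)" using \<nu> by auto
    then have "x \<in> elts (Vlev (\<Phi> \<beta>))" using elts_Vlev[OF \<Phi>_Ord[of \<beta>]] \<gamma> elts_sets by auto
    then show ?thesis using \<beta> by blast
  qed
  have V\<Phi>: "elts (Vlev (\<Phi> \<beta>)) \<subseteq> elts (Vlev \<nu>)" if "\<beta> \<in> elts \<kappa>" for \<beta>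
    using V_mono_mem[OF o\<nu> \<Phi>\<nu>[OF that]] .
  have "Limit \<nu>" unfolding Limit_def
  proof (intro conjI ballI)
    show "Ord \<nu>" by (rule o\<nu>)
    have "\<alpha>0 \<in> elts \<nu>" using \<nu> k(3) \<Phi>_a0[of empty] by auto
    then show "empty \<in> elts \<nu>" using Ord_linear[OF o\<nu> Ord_empty] by auto
    fix \<gamma> assume "\<gamma> \<in> elts \<nu>"
    then obtain \<beta> where \<beta>: "\<beta> \<in> elts \<kappa>" "\<gamma> \<in> elts (\<Phi> \<beta>)" using \<nu> by auto
    obtain \<delta> where \<delta>: "\<delta> \<in> elts \<kappa>" "\<Phi> \<beta> \<in> elts (\<Phi> \<delta>)" using \<Phi>in[OF \<beta>(1)] by blast
    have o: "Ord (\<Phi> \<beta>)" "Ord (\<Phi> \<delta>)" "Ord \<gamma>" using \<Phi>_Ord \<beta> \<delta> elts_sets Ord_in by blast+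
    have "elts (succ \<gamma>) \<subseteq> elts (\<Phi> \<beta>)" using Ord_succ_subset[OF o(1) \<beta>(2)] .
    then have "succ \<gamma> \<in> elts (\<Phi> \<beta>) \<or> succ \<gamma> = \<Phi> \<beta>" using Ord_subset_iff o by simp
    then have "succ \<gamma> \<in> elts (\<Phi> \<delta>)" using \<delta> Ord_trans[OF o(2)] by auto
    then show "succ \<gamma> \<in> elts \<nu>" using \<nu> \<delta> by auto
  qed
  moreover have "\<alpha>0 \<in> elts \<nu>" using \<nu> k(3) \<Phi>_a0[of empty] by auto
  moreover have "\<exists>\<gamma>\<in>elts \<nu>. is_fun s omega (Vlev \<gamma>)" if s: "s \<in> sets" "is_fun s omega (Vlev \<nu>)" for s
  proof -
    \<comment> \<open>The \<open>n\<close>-th value of \<open>s\<close> is present at stage \<beta>.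
      The least such stages form a sequence in \<kappa>, obtained without choice, to which
      regularity applies.\<close>
    define T where "T n \<beta> \<longleftrightarrow> (\<exists>y\<in>sets. opair n y \<in> elts s \<and> y \<in> elts (Vz (\<Phi> \<beta>)))" for n \<beta>
    have dT: "dfn UNIV (\<lambda>e. T (e (Suc 0)) (e 0))" unfolding T_def
      by (intro dfn_ex dfn_conj dfn_mem tm_opair tm_var tm_UNIV_const s(1) tm_Vz tm_subst1[where f = \<Phi>, OF _ t\<Phi>])
    have tT: "tm UNIV (\<lambda>e. leastO (T (e 0)))" by (rule tm_leastO) (rule dT)
    have T: "leastO (T n) \<in> elts \<kappa> \<and> T n (leastO (T n))" if n: "n \<in> elts omega" for n
    proof -
      have "app s n \<in> elts (Vlev \<nu>)" using is_fun_app(1)[OF s(2) n] .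
      then obtain \<beta> where \<beta>: "\<beta> \<in> elts \<kappa>" "app s n \<in> elts (Vlev (\<Phi> \<beta>))" using V\<nu> by blast
      have "T n \<beta>" unfolding T_def
        using is_fun_app(2,3)[OF s(2) n] \<beta> \<Phi>_Ord[of \<beta>] elts_sets[OF \<beta>(1)] by auto
      moreover have "Ord \<beta>" using \<beta> Ord_in[OF k(1)] by blast
      moreover have "dfn UNIV (\<lambda>e. T n (e 0))"
        by (rule dfn_subst2[where P = "\<lambda>\<beta> n. T n \<beta>"])
           (intro tm_var tm_UNIV_const omega_in_sets n dT)+
      ultimately have L: "Ord (leastO (T n))" "T n (leastO (T n))" "elts (leastO (T n)) \<subseteq> elts \<beta>"
        using leastO(1,2,4)[of "T n" \<beta>] by auto
      then have "leastO (T n) \<in> elts \<kappa>"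
        using Ord_subset_iff[OF L(1) \<open>Ord \<beta>\<close>] \<beta>(1) Ord_trans[OF k(1)] by blast
      then show ?thesis using L by blast
    qed
    define g where "g = lam omega (\<lambda>n. leastO (T n))"
    have g: "g \<in> sets" "is_fun g omega \<kappa>" "\<And>n. n \<in> elts omega \<Longrightarrow> app g n = leastO (T n)"
      unfolding g_def using lam_aux(1)[OF tT omega_sets] lam_fun[OF tT omega_sets, of \<kappa>] T by auto
    then obtain \<delta> where \<delta>: "\<delta> \<in> elts \<kappa>" "\<forall>n\<in>elts omega. app g n \<in> elts \<delta>"
      using \<kappa> unfolding omega_regular_def by blast
    have od: "Ord \<delta>" using \<delta> Ord_in[OF k(1)] by blast
    have "app s n \<in> elts (Vlev (\<Phi> \<delta>))" if n: "n \<in> elts omega" for n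
    proof -
      have gn: "leastO (T n) \<in> elts \<delta>" using bspec[OF \<delta>(2) n] g(3)[OF n] by simp
      obtain y where y: "y \<in> sets" "opair n y \<in> elts s" "y \<in> elts (Vz (\<Phi> (leastO (T n))))"
        using T[OF n] unfolding T_def by blast
      have "y = app s n" using is_fun_iff[OF s(2), of n y] y n by auto
      moreover have "Ord (\<Phi> (leastO (T n)))" "Ord (\<Phi> \<delta>)" using \<Phi>_Ord gn \<delta>(1) elts_sets by blast+
      moreover have "\<Phi> (leastO (T n)) \<in> elts (\<Phi> \<delta>)" using \<Phi>_step[OF od gn] by blast
      ultimately show ?thesis using y V_mono_mem[of "\<Phi> \<delta>" "\<Phi> (leastO (T n))"] by auto
    qed
    then have "is_fun s omega (Vlev (\<Phi> \<delta>))" using is_fun_weaken[OF s(2)] by blast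
    then show ?thesis using \<Phi>\<nu>[OF \<delta>(1)] by blast
  qed
  moreover have "\<exists>y\<in>elts (Vlev \<nu>). R i x y" if i: "i < m" and x: "x \<in> elts (Vlev \<nu>)" and y: "y \<in> sets" "R i x y" for i x y
  proof -
    obtain \<beta> where \<beta>: "\<beta> \<in> elts \<kappa>" "x \<in> elts (Vlev (\<Phi> \<beta>))" using V\<nu>[OF x] by blast
    obtain \<delta> where \<delta>: "\<delta> \<in> elts \<kappa>" "F (\<Phi> \<beta>) (\<Phi> \<delta>)" using \<Phi>in[OF \<beta>(1)] by blast
    have "Ord (\<Phi> \<beta>)" "Ord (\<Phi> \<delta>)" using \<Phi>_Ord \<beta> \<delta> elts_sets by blast+
    then have "\<exists>y\<in>elts (Vlev (\<Phi> \<delta>)). R i x y" using \<delta>(2) i \<beta>(2) y unfolding F_def by auto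
    then show ?thesis using V\<Phi>[OF \<delta>(1)] by blast
  qed
  ultimately show ?thesis by (rule that)
qed

section \<open>Coded formulas\<close>

lemma tm_codes [dfn_intros]:
  "tm K F \<Longrightarrow> tm K G \<Longrightarrow> tm K (\<lambda>e. cMem (F e) (G e))"
  "tm K F \<Longrightarrow> tm K G \<Longrightarrow> tm K (\<lambda>e. cEq (F e) (G e))"
  "tm K F \<Longrightarrow> tm K (\<lambda>e. cNeg (F e))"
  "tm K F \<Longrightarrow> tm K G \<Longrightarrow> tm K (\<lambda>e. cConj (F e) (G e))"
  "tm K F \<Longrightarrow> tm K G \<Longrightarrow> tm K (\<lambda>e. cEx (F e) (G e))"
  unfolding cMem_def cEq_def cNeg_def cConj_def cEx_def by (intro dfn_intros; assumption)+

lemma codes_sets [simp]: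
  "a \<in> sets \<Longrightarrow> b \<in> sets \<Longrightarrow> cMem a b \<in> sets"
  "a \<in> sets \<Longrightarrow> b \<in> sets \<Longrightarrow> cEq a b \<in> sets"
  "a \<in> sets \<Longrightarrow> cNeg a \<in> sets"
  "a \<in> sets \<Longrightarrow> b \<in> sets \<Longrightarrow> cConj a b \<in> sets"
  "a \<in> sets \<Longrightarrow> b \<in> sets \<Longrightarrow> cEx a b \<in> sets"
  unfolding cMem_def cEq_def cNeg_def cConj_def cEx_def by simp_all

lemma codes_eq [simp]:
  "a \<in> sets \<Longrightarrow> b \<in> sets \<Longrightarrow> a' \<in> sets \<Longrightarrow> b' \<in> sets \<Longrightarrow> cMem a b = cMem a' b' \<longleftrightarrow> a = a' \<and> b = b'"
  "a \<in> sets \<Longrightarrow> b \<in> sets \<Longrightarrow> a' \<in> sets \<Longrightarrow> b' \<in> sets \<Longrightarrow> cEq a b = cEq a' b' \<longleftrightarrow> a = a' \<and> b = b'"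
  "a \<in> sets \<Longrightarrow> a' \<in> sets \<Longrightarrow> cNeg a = cNeg a' \<longleftrightarrow> a = a'"
  "a \<in> sets \<Longrightarrow> b \<in> sets \<Longrightarrow> a' \<in> sets \<Longrightarrow> b' \<in> sets \<Longrightarrow> cConj a b = cConj a' b' \<longleftrightarrow> a = a' \<and> b = b'"
  "a \<in> sets \<Longrightarrow> b \<in> sets \<Longrightarrow> a' \<in> sets \<Longrightarrow> b' \<in> sets \<Longrightarrow> cEx a b = cEx a' b' \<longleftrightarrow> a = a' \<and> b = b'"
  unfolding cMem_def cEq_def cNeg_def cConj_def cEx_def by (simp_all add: opair_eq_iff)

lemma codes_distinct [simp]:
  assumes "a \<in> sets" "b \<in> sets" "a' \<in> sets" "b' \<in> sets"
  shows "cMem a b \<noteq> cEq a' b'" "cMem a b \<noteq> cNeg a'" "cMem a b \<noteq> cConj a' b'" "cMem a b \<noteq> cEx a' b'"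
    "cEq a b \<noteq> cMem a' b'" "cEq a b \<noteq> cNeg a'" "cEq a b \<noteq> cConj a' b'" "cEq a b \<noteq> cEx a' b'"
    "cNeg a \<noteq> cMem a' b'" "cNeg a \<noteq> cEq a' b'" "cNeg a \<noteq> cConj a' b'" "cNeg a \<noteq> cEx a' b'"
    "cConj a b \<noteq> cMem a' b'" "cConj a b \<noteq> cEq a' b'" "cConj a b \<noteq> cNeg a'" "cConj a b \<noteq> cEx a' b'"
    "cEx a b \<noteq> cMem a' b'" "cEx a b \<noteq> cEq a' b'" "cEx a b \<noteq> cNeg a'" "cEx a b \<noteq> cConj a' b'"
  unfolding cMem_def cEq_def cNeg_def cConj_def cEx_def using assms by (simp_all add: opair_eq_iff succ_inj)

lemma dfn_form_closed0: "dfn K (\<lambda>e. form_closed (e 0))"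
  unfolding form_closed_def by (intro dfn_intros)

lemmas dfn_form_closed [dfn_intros] = dfn_subst1[where P = form_closed, OF _ dfn_form_closed0]

lemma dfn_delta0_closed0: "dfn K (\<lambda>e. delta0_closed (e 0))"
  unfolding delta0_closed_def by (intro dfn_intros)

lemmas dfn_delta0_closed [dfn_intros] = dfn_subst1[where P = delta0_closed, OF _ dfn_delta0_closed0]

lemma elts_Form: "elts Form = {p \<in> sets. \<forall>F\<in>sets. form_closed F \<longrightarrow> p \<in> elts F}"
  unfolding Form_def by (rule elts_Coll[where K = UNIV]) (intro dfn_intros)

lemma elts_Delta0: "elts Delta0 = {p \<in> sets. \<forall>F\<in>sets. delta0_closed F \<longrightarrow> p \<in> elts F}"
  unfolding Delta0_def by (rule elts_Coll[where K = UNIV]) (intro dfn_intros)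

lemma Form_least: "F \<in> sets \<Longrightarrow> form_closed F \<Longrightarrow> elts Form \<subseteq> elts F"
  unfolding elts_Form by blast

text \<open>At omega this exhibits a set closed under the formation rules, so that
  \<open>Form\<close> is a set; at a larger \<nu> it places all coded formulas inside
  \<open>V_\<nu>\<close>.\<close>

lemma V_form_closed:
  assumes "Limit \<nu>"
  shows "form_closed (Vlev \<nu>)"
proof -
  have w: "elts omega \<subseteq> elts (Vlev \<nu>)"
    using omega_subset_Limit[OF assms] Ord_subset_V[OF Limit_Ord[OF assms]] by blast
  have n: "empty \<in> elts (Vlev \<nu>)" "succ empty \<in> elts (Vlev \<nu>)" "succ (succ empty) \<in> elts (Vlev \<nu>)"
    "succ (succ (succ empty)) \<in> elts (Vlev \<nu>)" "succ (succ (succ (succ empty))) \<in> elts (Vlev \<nu>)"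
    using w by auto
  show ?thesis unfolding form_closed_def cMem_def cEq_def cNeg_def cConj_def cEx_def
    using Limit_opair[OF assms] n w by (simp add: subset_iff)
qed

lemma Form_sets [simp]: "Form \<in> sets"
  using separation[of "Vlev omega" Form] Form_least[OF _ V_form_closed[OF Limit_omega]] by simp

lemma Form_subset_V: "Limit \<nu> \<Longrightarrow> elts Form \<subseteq> elts (Vlev \<nu>)"
  using Form_least[OF _ V_form_closed] Limit_Ord by simp

lemma Form_in_sets [simp]: "p \<in> elts Form \<Longrightarrow> p \<in> sets" by (rule elts_sets)

lemma form_closed_Form: "form_closed Form"
  unfolding form_closed_def elts_Form by (auto simp: form_closed_def)

lemma Form_intros [simp]:
  "a \<in> elts omega \<Longrightarrow> b \<in> elts omega \<Longrightarrow> cMem a b \<in> elts Form"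
  "a \<in> elts omega \<Longrightarrow> b \<in> elts omega \<Longrightarrow> cEq a b \<in> elts Form"
  "p \<in> elts Form \<Longrightarrow> cNeg p \<in> elts Form"
  "p \<in> elts Form \<Longrightarrow> q \<in> elts Form \<Longrightarrow> cConj p q \<in> elts Form"
  "a \<in> elts omega \<Longrightarrow> p \<in> elts Form \<Longrightarrow> cEx a p \<in> elts Form"
  using form_closed_Form unfolding form_closed_def by auto

lemma Form_induct:
  assumes "dfn UNIV (\<lambda>e. P (e 0))"
    and "\<And>a b. a \<in> elts omega \<Longrightarrow> b \<in> elts omega \<Longrightarrow> P (cMem a b)"
    and "\<And>a b. a \<in> elts omega \<Longrightarrow> b \<in> elts omega \<Longrightarrow> P (cEq a b)"
    and "\<And>p. p \<in> elts Form \<Longrightarrow> P p \<Longrightarrow> P (cNeg p)"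
    and "\<And>p q. p \<in> elts Form \<Longrightarrow> q \<in> elts Form \<Longrightarrow> P p \<Longrightarrow> P q \<Longrightarrow> P (cConj p q)"
    and "\<And>a p. a \<in> elts omega \<Longrightarrow> p \<in> elts Form \<Longrightarrow> P p \<Longrightarrow> P (cEx a p)"
    and "p \<in> elts Form"
  shows "P p"
proof -
  define C where "C = Coll (\<lambda>x. x \<in> elts Form \<and> P x)"
  have "dfn UNIV (\<lambda>e. e 0 \<in> elts Form \<and> P (e 0))" by (intro dfn_conj dfn_mem tm_var tm_UNIV_const Form_sets assms(1))
  then have E: "elts C = {x \<in> elts Form. P x}" unfolding C_def using elts_sets by (subst elts_Coll) auto
  have "C \<in> sets" by (rule separation[OF Form_sets]) (use E in blast)
  moreover have "form_closed C" unfolding form_closed_def E using assms(2-6) by simp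
  ultimately show ?thesis using Form_least[of C] assms(7) E by blast
qed

lemma tm_Form [dfn_intros]: "tm K (\<lambda>e. Form)"
  unfolding Form_def by (rule tm_Coll, intro dfn_intros) (simp add: Form_def[symmetric])

lemma Delta0_subset_Form: "elts Delta0 \<subseteq> elts Form"
proof -
  have "delta0_closed Form" unfolding delta0_closed_def by simp
  then show ?thesis unfolding elts_Delta0 using Form_sets by blast
qed

lemma Delta0_sets [simp]: "Delta0 \<in> sets"
  using separation[OF Form_sets Delta0_subset_Form] .

lemma tm_Delta0 [dfn_intros]: "tm K (\<lambda>e. Delta0)"
  unfolding Delta0_def by (rule tm_Coll, intro dfn_intros) (simp add: Delta0_def[symmetric])

lemma Delta0_induct:
  assumes "dfn UNIV (\<lambda>e. P (e 0))"
    and "\<And>a b. a \<in> elts omega \<Longrightarrow> b \<in> elts omega \<Longrightarrow> P (cMem a b)"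
    and "\<And>a b. a \<in> elts omega \<Longrightarrow> b \<in> elts omega \<Longrightarrow> P (cEq a b)"
    and "\<And>p. p \<in> elts Form \<Longrightarrow> P p \<Longrightarrow> P (cNeg p)"
    and "\<And>p q. p \<in> elts Form \<Longrightarrow> q \<in> elts Form \<Longrightarrow> P p \<Longrightarrow> P q \<Longrightarrow> P (cConj p q)"
    and "\<And>a b p. a \<in> elts omega \<Longrightarrow> b \<in> elts omega \<Longrightarrow> a \<noteq> b \<Longrightarrow> p \<in> elts Form \<Longrightarrow> P p \<Longrightarrow> P (cEx a (cConj (cMem a b) p))"
    and "p \<in> elts Delta0"
  shows "P p"
proof -
  define C where "C = Coll (\<lambda>x. x \<in> elts Form \<and> P x)"
  have "dfn UNIV (\<lambda>e. e 0 \<in> elts Form \<and> P (e 0))" by (intro dfn_conj dfn_mem tm_var tm_UNIV_const Form_sets assms(1))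
  then have E: "elts C = {x \<in> elts Form. P x}" unfolding C_def using elts_sets by (subst elts_Coll) auto
  have "C \<in> sets" by (rule separation[OF Form_sets]) (use E in blast)
  moreover have "delta0_closed C" unfolding delta0_closed_def E using assms(2-6) by simp
  ultimately have "p \<in> elts C" using assms(7) unfolding elts_Delta0 by blast
  then show ?thesis using E by blast
qed

section \<open>Assignments\<close>

lemma dfn_assignment0: "dfn K (\<lambda>e. assignment (e 0) (e (Suc 0)))"
proof -
  have "dfn K (\<lambda>e. is_fun (e (Suc 0)) omega (e 0))" by (intro dfn_intros)
  then show ?thesis by (rule dfn_cong) (auto simp: assignment_def)
qed

lemmas dfn_assignment [dfn_intros] = dfn_subst2[where P = assignment, OF _ _ dfn_assignment0]

lemma assignments_ex:
  assumes "M \<in> sets"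
  obtains A where "A \<in> sets" "elts A = {s. assignment M s}"
proof -
  obtain c where c: "c \<in> sets" "elts c = {opair x y |x y. x \<in> elts omega \<and> y \<in> elts M}"
    by (rule prod_ex[OF omega_sets assms]) (rule that)
  obtain w where w: "w \<in> sets" "elts w = {y \<in> sets. elts y \<subseteq> elts c}" using power_set[OF c(1)] by blast
  define A where "A = Coll (assignment M)"
  have "dfn UNIV (\<lambda>e. assignment M (e 0))" by (intro dfn_intros tm_UNIV_const assms)
  then have E: "elts A = {s. assignment M s}" unfolding A_def using assignment_def by (subst elts_Coll) auto
  have "elts A \<subseteq> elts w"
  proof
    fix s assume "s \<in> elts A"
    then have "s \<in> sets" "is_fun s omega M" using E unfolding assignment_def by auto
    moreover from this have "elts s \<subseteq> elts c" unfolding c(2) using is_funD1[of s omega M] by blast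
    ultimately show "s \<in> elts w" using w by simp
  qed
  then have "A \<in> sets" using separation w by blast
  then show ?thesis using that E by blast
qed

lemma elts_upd:
  assumes "s \<in> sets" "a \<in> sets" "x \<in> sets"
  shows "elts (upd s a x) = {p \<in> elts s. \<not> (\<exists>y\<in>sets. p = opair a y)} \<union> {opair a x}"
proof -
  have "dfn UNIV (\<lambda>e. (e 0 \<in> elts s \<and> \<not> (\<exists>y\<in>sets. e 0 = opair a y)) \<or> e 0 = opair a x)"
    by (intro dfn_intros tm_UNIV_const assms)
  then have "elts (upd s a x) = {p \<in> sets. (p \<in> elts s \<and> \<not> (\<exists>y\<in>sets. p = opair a y)) \<or> p = opair a x}"
    unfolding upd_def by (rule elts_Coll)
  then show ?thesis using assms elts_sets by auto
qed

lemma upd_sets [simp]: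
  assumes "s \<in> sets" "a \<in> sets" "x \<in> sets"
  shows "upd s a x \<in> sets"
proof -
  obtain z where z: "z \<in> sets" "elts z = elts s \<union> elts (upair (opair a x) (opair a x))"
    by (rule union_sets[of s "upair (opair a x) (opair a x)"]) (use assms in auto)
  show ?thesis by (rule separation[OF z(1)]) (use z elts_upd[OF assms] assms in auto)
qed

lemma tm_upd0: "tm K (\<lambda>e. upd (e 0) (e (Suc 0)) (e (Suc (Suc 0))))"
  unfolding upd_def by (rule tm_Coll, intro dfn_intros, fold upd_def) (auto simp: image_subset_iff)

lemmas tm_upd [dfn_intros] = tm_subst3[where f = upd, OF _ _ _ tm_upd0]

lemma assignment_upd:
  assumes "assignment M s" "a \<in> elts omega" "x \<in> elts M"
  shows "assignment M (upd s a x)" "\<And>b. b \<in> elts omega \<Longrightarrow> app (upd s a x) b = (if b = a then x else app s b)"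
proof -
  have s: "s \<in> sets" "is_fun s omega M" using assms unfolding assignment_def by auto
  have ax: "a \<in> sets" "x \<in> sets" using assms elts_sets by auto
  have E: "elts (upd s a x) = (\<lambda>b. opair b (if b = a then x else app s b)) ` elts omega"
  proof (intro equalityI subsetI)
    fix p assume "p \<in> elts (upd s a x)"
    then consider "p = opair a x" | "p \<in> elts s" "\<not> (\<exists>y\<in>sets. p = opair a y)" using elts_upd[OF s(1) ax] by blast
    then show "p \<in> (\<lambda>b. opair b (if b = a then x else app s b)) ` elts omega"
    proof cases
      case 1
      then show ?thesis using assms(2) by (intro image_eqI[of _ _ a]) auto
    next
      case 2
      then obtain b where b: "b \<in> elts omega" "p = opair b (app s b)" using elts_fun[OF s(2)] by blast
      have "b \<noteq> a" using 2(2) b is_fun_app(3)[OF s(2) b(1)] by blast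
      then show ?thesis using b by (intro image_eqI[of _ _ b]) auto
    qed
  next
    fix p assume "p \<in> (\<lambda>b. opair b (if b = a then x else app s b)) ` elts omega"
    then obtain b where b: "b \<in> elts omega" "p = opair b (if b = a then x else app s b)" by blast
    have sb: "app s b \<in> sets" "opair b (app s b) \<in> elts s" using is_fun_app[OF s(2) b(1)] by auto
    show "p \<in> elts (upd s a x)"
      unfolding elts_upd[OF s(1) ax] using b sb ax by (auto simp: opair_eq_iff)
  qed
  have m: "(if b = a then x else app s b) \<in> elts M" if "b \<in> elts omega" for b
    using assms(3) is_fun_app(1)[OF s(2) that] by simp
  show "assignment M (upd s a x)" unfolding assignment_def using is_funI(1)[OF E m] s ax by simp
  show "\<And>b. b \<in> elts omega \<Longrightarrow> app (upd s a x) b = (if b = a then x else app s b)"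
    using is_funI(2)[OF E m] by simp
qed

lemma assignment_app: "assignment M s \<Longrightarrow> a \<in> elts omega \<Longrightarrow> app s a \<in> elts M"
  unfolding assignment_def using is_fun_app(1) by blast

lemma assignment_sets: "assignment M s \<Longrightarrow> s \<in> sets" unfolding assignment_def by blast

lemma assignment_mono: "assignment M s \<Longrightarrow> elts M \<subseteq> elts N \<Longrightarrow> assignment N s"
  unfolding assignment_def using is_fun_weaken is_fun_app(1) by blast

lemma assignment_mem:
  assumes "assignment M s" "a \<in> elts omega" "b \<in> elts omega"
  shows "app s a \<in> elts (app s b) \<longleftrightarrow> (\<exists>u\<in>sets. \<exists>v\<in>sets. opair a u \<in> elts s \<and> opair b v \<in> elts s \<and> u \<in> elts v)"
    "app s a = app s b \<longleftrightarrow> (\<exists>u\<in>sets. opair a u \<in> elts s \<and> opair b u \<in> elts s)"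
proof -
  have f: "is_fun s omega M" using assms unfolding assignment_def by blast
  have *: "opair a u \<in> elts s \<longleftrightarrow> u = app s a" "opair b u \<in> elts s \<longleftrightarrow> u = app s b" if "u \<in> sets" for u
    using is_fun_iff[OF f, of _ u] that assms by auto
  have "app s a \<in> sets" "app s b \<in> sets" using is_fun_app(3)[OF f] assms by auto
  then show "app s a \<in> elts (app s b) \<longleftrightarrow> (\<exists>u\<in>sets. \<exists>v\<in>sets. opair a u \<in> elts s \<and> opair b v \<in> elts s \<and> u \<in> elts v)"
    "app s a = app s b \<longleftrightarrow> (\<exists>u\<in>sets. opair a u \<in> elts s \<and> opair b u \<in> elts s)" using * by auto
qed

section \<open>Satisfaction\<close>

text \<open>Only the atomic clauses mention \<open>app\<close>; they are rewritten through the graph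
  of the assignment.\<close>

lemma dfn_sat_relation0: "dfn K (\<lambda>e. sat_relation (e 0) (e (Suc 0)))"
proof -
  define Q where "Q M S \<longleftrightarrow> (\<forall>s\<in>sets. assignment M s \<longrightarrow>
     (\<forall>a\<in>elts omega. \<forall>b\<in>elts omega.
        (opair (cMem a b) s \<in> elts S \<longleftrightarrow> (\<exists>u\<in>sets. \<exists>v\<in>sets. opair a u \<in> elts s \<and> opair b v \<in> elts s \<and> u \<in> elts v)) \<and>
        (opair (cEq a b) s \<in> elts S \<longleftrightarrow> (\<exists>u\<in>sets. opair a u \<in> elts s \<and> opair b u \<in> elts s))) \<and>
     (\<forall>p\<in>elts Form. opair (cNeg p) s \<in> elts S \<longleftrightarrow> opair p s \<notin> elts S) \<and>
     (\<forall>p\<in>elts Form. \<forall>q\<in>elts Form.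
        opair (cConj p q) s \<in> elts S \<longleftrightarrow> opair p s \<in> elts S \<and> opair q s \<in> elts S) \<and>
     (\<forall>a\<in>elts omega. \<forall>p\<in>elts Form.
        opair (cEx a p) s \<in> elts S \<longleftrightarrow> (\<exists>x\<in>elts M. opair p (upd s a x) \<in> elts S)))" for M S
  have "dfn K (\<lambda>e. Q (e 0) (e (Suc 0)))" unfolding Q_def by (intro dfn_intros)
  moreover have "Q M S \<longleftrightarrow> sat_relation M S" for M S
  proof -
    have all: "(\<forall>s. assignment M s \<longrightarrow> X s) \<longleftrightarrow> (\<forall>s\<in>sets. assignment M s \<longrightarrow> X s)" for X
      using assignment_sets by blast
    show ?thesis unfolding Q_def sat_relation_def all
      by (intro ball_cong refl imp_cong conj_cong) (simp_all add: assignment_mem)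
  qed
  ultimately show ?thesis by simp
qed

lemmas dfn_sat_relation [dfn_intros] = dfn_subst2[where P = sat_relation, OF _ _ dfn_sat_relation0]

lemma dfn_Sat0: "dfn K (\<lambda>e. Sat (e 0) (e (Suc 0)) (e (Suc (Suc 0))))"
  unfolding Sat_def by (intro dfn_intros)

lemmas dfn_Sat [dfn_intros] = dfn_subst3[where P = Sat, OF _ _ _ dfn_Sat0]

lemma opair_tc:
  assumes "x \<in> sets" "y \<in> sets"
  shows "x \<in> elts (tc (opair x y))" "y \<in> elts (tc (opair x y))"
proof -
  have "upair x y \<in> elts (opair x y)" using assms by (simp add: opair_def)
  then have "upair x y \<in> elts (tc (opair x y))" using subset_tc[of "opair x y"] assms by auto
  then have "elts (upair x y) \<subseteq> elts (tc (opair x y))"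
    using bspec[OF transitive_tc[of "opair x y", unfolded transitive_def]] opair_sets[OF assms] by blast
  then show "x \<in> elts (tc (opair x y))" "y \<in> elts (tc (opair x y))" using assms by auto
qed

text \<open>Immediate subformulas sit inside nested pairs, in the transitive closure of the code;
  this licenses recursion on formulas through \<open>recursion\<close>.\<close>

lemma codes_tc:
  "p \<in> sets \<Longrightarrow> p \<in> elts (tc (cNeg p))"
  "p \<in> sets \<Longrightarrow> q \<in> sets \<Longrightarrow> p \<in> elts (tc (cConj p q))"
  "p \<in> sets \<Longrightarrow> q \<in> sets \<Longrightarrow> q \<in> elts (tc (cConj p q))"
  "a \<in> sets \<Longrightarrow> p \<in> sets \<Longrightarrow> p \<in> elts (tc (cEx a p))"
proof -
  have 2: "x \<in> elts (tc (opair n (opair x y))) \<and> y \<in> elts (tc (opair n (opair x y)))"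
    if "n \<in> sets" "x \<in> sets" "y \<in> sets" for n x y
    using opair_tc[of n "opair x y"] tc_mono_mem[of "opair n (opair x y)" "opair x y"] opair_tc[of x y] that by auto
  show "p \<in> sets \<Longrightarrow> p \<in> elts (tc (cNeg p))" unfolding cNeg_def by (simp add: opair_tc)
  show "p \<in> sets \<Longrightarrow> q \<in> sets \<Longrightarrow> p \<in> elts (tc (cConj p q))"
    "p \<in> sets \<Longrightarrow> q \<in> sets \<Longrightarrow> q \<in> elts (tc (cConj p q))" unfolding cConj_def by (simp_all add: 2)
  show "a \<in> sets \<Longrightarrow> p \<in> sets \<Longrightarrow> p \<in> elts (tc (cEx a p))" unfolding cEx_def by (simp add: 2)
qed

text \<open>Recursion on codes assigns to \<open>p\<close> the set \<open>\<Phi> p\<close> of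
  assignments satisfying it. These values are sets because all assignments into \<open>M\<close>
  form a set, which would fail for the universe in place of \<open>M\<close>.\<close>

lemma sat_relation_ex:
  assumes M: "M \<in> sets"
  shows "\<exists>S\<in>sets. sat_relation M S"
proof -
  obtain A where A: "A \<in> sets" "elts A = {s. assignment M s}" by (rule assignments_ex[OF M]) (rule that)
  \<comment> \<open>The Tarski clauses for one step: \<open>f\<close> lists the values at
    subformulas, and \<open>app\<close> is avoided so that the clauses form a formula.\<close>
  define step where "step p f s \<longleftrightarrow>
    (\<exists>a\<in>elts omega. \<exists>b\<in>elts omega. p = cMem a b \<and> (\<exists>u\<in>sets. \<exists>v\<in>sets. opair a u \<in> elts s \<and> opair b v \<in> elts s \<and> u \<in> elts v)) \<or>
    (\<exists>a\<in>elts omega. \<exists>b\<in>elts omega. p = cEq a b \<and> (\<exists>u\<in>sets. opair a u \<in> elts s \<and> opair b u \<in> elts s)) \<or>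
    (\<exists>q\<in>sets. \<exists>v\<in>sets. p = cNeg q \<and> opair q v \<in> elts f \<and> s \<notin> elts v) \<or>
    (\<exists>q\<in>sets. \<exists>r\<in>sets. \<exists>v\<in>sets. \<exists>w\<in>sets. p = cConj q r \<and> opair q v \<in> elts f \<and> opair r w \<in> elts f \<and> s \<in> elts v \<and> s \<in> elts w) \<or>
    (\<exists>a\<in>elts omega. \<exists>q\<in>sets. \<exists>v\<in>sets. p = cEx a q \<and> opair q v \<in> elts f \<and> (\<exists>x\<in>elts M. upd s a x \<in> elts v))" for p f s
  define G where "G p f = Coll (\<lambda>s. s \<in> elts A \<and> step p f s)" for p f
  have d: "dfn UNIV (\<lambda>e. e 0 \<in> elts A \<and> step (e (Suc 0)) (e (Suc (Suc 0))) (e 0))"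
    unfolding step_def by (intro dfn_intros tm_UNIV_const A M)
  have tG: "tm UNIV (\<lambda>e. G (e 0) (e (Suc 0)))" unfolding G_def
  proof (rule tm_Coll[OF d])
    fix e :: "nat \<Rightarrow> 'c" assume e: "range e \<subseteq> sets"
    show "Coll (\<lambda>s. s \<in> elts A \<and> step (e 0) (e (Suc 0)) s) \<in> sets"
      by (rule Coll_sets[where P = "\<lambda>s e. s \<in> elts A \<and> step (e 0) (e (Suc 0)) s", OF d e A(1)]) simp
  qed
  obtain \<Phi> where t\<Phi>: "tm UNIV (\<lambda>e. \<Phi> (e 0))" and \<Phi>: "\<And>x. x \<in> sets \<Longrightarrow> \<Phi> x = G x (lam (tc x) \<Phi>)"
    by (rule recursion[OF tG]) (rule that)
  have \<Phi>s: "\<Phi> x \<in> sets" if "x \<in> sets" for x using tm_app1_sets[OF t\<Phi> that] .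
  have el: "s \<in> elts (\<Phi> p) \<longleftrightarrow> assignment M s \<and> step p (lam (tc p) \<Phi>) s" if p: "p \<in> sets" for p s
  proof -
    have f: "lam (tc p) \<Phi> \<in> sets" using lam_aux(1)[OF t\<Phi>] p by simp
    have "elts (Coll (\<lambda>s. s \<in> elts A \<and> step p (lam (tc p) \<Phi>) s)) = {s \<in> sets. s \<in> elts A \<and> step p (lam (tc p) \<Phi>) s}"
      using elts_Coll'[where P = "\<lambda>s e. s \<in> elts A \<and> step (e 0) (e (Suc 0)) s",
          OF d, of "\<lambda>i. if i = 0 then p else lam (tc p) \<Phi>"] p f by auto
    then show ?thesis unfolding \<Phi>[OF p] G_def using A(2) assignment_sets by auto
  qed
  have lam: "opair q v \<in> elts (lam (tc p) \<Phi>) \<longleftrightarrow> v = \<Phi> q" if "p \<in> sets" "q \<in> elts (tc p)" "v \<in> sets" for p q v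
  proof -
    have q: "q \<in> sets" using that elts_sets by blast
    show ?thesis using lam_aux(2)[OF t\<Phi>, of "tc p"] that q \<Phi>s elts_sets by (auto simp: opair_eq_iff)
  qed
  have sMem: "s \<in> elts (\<Phi> (cMem a b)) \<longleftrightarrow> app s a \<in> elts (app s b)"
    "s \<in> elts (\<Phi> (cEq a b)) \<longleftrightarrow> app s a = app s b"
    if s: "assignment M s" and ab: "a \<in> elts omega" "b \<in> elts omega" for s a b
  proof -
    have ss: "a \<in> sets" "b \<in> sets" using ab by auto
    show "s \<in> elts (\<Phi> (cMem a b)) \<longleftrightarrow> app s a \<in> elts (app s b)"
      using el[of "cMem a b" s] s ss ab unfolding assignment_mem(1)[OF s ab] step_def by auto
    show "s \<in> elts (\<Phi> (cEq a b)) \<longleftrightarrow> app s a = app s b"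
      using el[of "cEq a b" s] s ss ab unfolding assignment_mem(2)[OF s ab] step_def by auto
  qed
  have sNeg: "s \<in> elts (\<Phi> (cNeg q)) \<longleftrightarrow> s \<notin> elts (\<Phi> q)" if s: "assignment M s" and q: "q \<in> sets" for s q
  proof -
    have "step (cNeg q) (lam (tc (cNeg q)) \<Phi>) s \<longleftrightarrow> (\<exists>v\<in>sets. opair q v \<in> elts (lam (tc (cNeg q)) \<Phi>) \<and> s \<notin> elts v)"
      unfolding step_def using q by auto
    also have "\<dots> \<longleftrightarrow> s \<notin> elts (\<Phi> q)" using lam[of "cNeg q" q] codes_tc(1)[OF q] q \<Phi>s by auto
    finally show ?thesis using el[of "cNeg q"] q s by simp
  qed
  have sConj: "s \<in> elts (\<Phi> (cConj q r)) \<longleftrightarrow> s \<in> elts (\<Phi> q) \<and> s \<in> elts (\<Phi> r)" if s: "assignment M s" and q: "q \<in> sets" "r \<in> sets" for s q r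
  proof -
    have "step (cConj q r) (lam (tc (cConj q r)) \<Phi>) s \<longleftrightarrow> (\<exists>v\<in>sets. \<exists>w\<in>sets. opair q v \<in> elts (lam (tc (cConj q r)) \<Phi>) \<and> opair r w \<in> elts (lam (tc (cConj q r)) \<Phi>) \<and> s \<in> elts v \<and> s \<in> elts w)"
      unfolding step_def using q by auto
    also have "\<dots> \<longleftrightarrow> s \<in> elts (\<Phi> q) \<and> s \<in> elts (\<Phi> r)"
      using lam[of "cConj q r" q] lam[of "cConj q r" r] codes_tc(2,3)[OF q] q \<Phi>s by auto
    finally show ?thesis using el[of "cConj q r"] q s by simp
  qed
  have sEx: "s \<in> elts (\<Phi> (cEx a q)) \<longleftrightarrow> (\<exists>x\<in>elts M. upd s a x \<in> elts (\<Phi> q))" if s: "assignment M s" and q: "a \<in> elts omega" "q \<in> sets" for s a q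
  proof -
    have as: "a \<in> sets" using q by simp
    have "step (cEx a q) (lam (tc (cEx a q)) \<Phi>) s \<longleftrightarrow> (\<exists>v\<in>sets. opair q v \<in> elts (lam (tc (cEx a q)) \<Phi>) \<and> (\<exists>x\<in>elts M. upd s a x \<in> elts v))"
      unfolding step_def using q as by auto
    also have "\<dots> \<longleftrightarrow> (\<exists>x\<in>elts M. upd s a x \<in> elts (\<Phi> q))"
      using lam[of "cEx a q" q] codes_tc(4)[OF as q(2)] q as \<Phi>s by auto
    finally show ?thesis using el[of "cEx a q"] q as s by simp
  qed
  obtain c where c: "c \<in> sets" "elts c = {opair x y |x y. x \<in> elts Form \<and> y \<in> elts A}"
    by (rule prod_ex[OF Form_sets A(1)]) (rule that)
  define S where "S = Coll (\<lambda>z. \<exists>p\<in>elts Form. \<exists>s\<in>elts A. z = opair p s \<and> s \<in> elts (\<Phi> p))"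
  have "dfn UNIV (\<lambda>e. \<exists>p\<in>elts Form. \<exists>s\<in>elts A. e 0 = opair p s \<and> s \<in> elts (\<Phi> p))"
    by (intro dfn_bex dfn_conj dfn_eq dfn_mem tm_opair tm_Form tm_UNIV_const A tm_subst1[where f = \<Phi>, OF _ t\<Phi>] tm_var)
  then have E: "elts S = {z \<in> sets. \<exists>p\<in>elts Form. \<exists>s\<in>elts A. z = opair p s \<and> s \<in> elts (\<Phi> p)}"
    unfolding S_def by (rule elts_Coll)
  have "elts S \<subseteq> elts c" unfolding E c(2) by blast
  then have Ss: "S \<in> sets" using separation c by blast
  have S: "opair p s \<in> elts S \<longleftrightarrow> s \<in> elts (\<Phi> p)" if "p \<in> elts Form" "assignment M s" for p s
  proof -
    have "p \<in> sets" "s \<in> sets" "s \<in> elts A" using that assignment_sets A(2) by auto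
    then show ?thesis unfolding E using that elts_sets[of _ A] by (auto simp: opair_eq_iff)
  qed
  have "sat_relation M S" unfolding sat_relation_def
  proof (intro allI impI conjI ballI)
    fix s assume s: "assignment M s"
    fix a b assume ab: "a \<in> elts omega" "b \<in> elts omega"
    show "opair (cMem a b) s \<in> elts S \<longleftrightarrow> app s a \<in> elts (app s b)" using S sMem(1) s ab by simp
    show "opair (cEq a b) s \<in> elts S \<longleftrightarrow> app s a = app s b" using S sMem(2) s ab by simp
  next
    fix s p assume s: "assignment M s" and p: "p \<in> elts Form"
    show "opair (cNeg p) s \<in> elts S \<longleftrightarrow> opair p s \<notin> elts S" using S sNeg s p by simp
    fix q assume q: "q \<in> elts Form"
    show "opair (cConj p q) s \<in> elts S \<longleftrightarrow> opair p s \<in> elts S \<and> opair q s \<in> elts S" using S sConj s p q by simp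
  next
    fix s a p assume s: "assignment M s" and a: "a \<in> elts omega" and p: "p \<in> elts Form"
    have "opair (cEx a p) s \<in> elts S \<longleftrightarrow> (\<exists>x\<in>elts M. upd s a x \<in> elts (\<Phi> p))" using S sEx s a p by simp
    also have "\<dots> \<longleftrightarrow> (\<exists>x\<in>elts M. opair p (upd s a x) \<in> elts S)" using S[OF p] assignment_upd(1)[OF s a] by simp
    finally show "opair (cEx a p) s \<in> elts S \<longleftrightarrow> (\<exists>x\<in>elts M. opair p (upd s a x) \<in> elts S)" .
  qed
  then show ?thesis using Ss by blast
qed

lemma sat_relationD:
  assumes "sat_relation M S" "assignment M s"
  shows "a \<in> elts omega \<Longrightarrow> b \<in> elts omega \<Longrightarrow> opair (cMem a b) s \<in> elts S \<longleftrightarrow> app s a \<in> elts (app s b)"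
    "a \<in> elts omega \<Longrightarrow> b \<in> elts omega \<Longrightarrow> opair (cEq a b) s \<in> elts S \<longleftrightarrow> app s a = app s b"
    "p \<in> elts Form \<Longrightarrow> opair (cNeg p) s \<in> elts S \<longleftrightarrow> opair p s \<notin> elts S"
    "p \<in> elts Form \<Longrightarrow> q \<in> elts Form \<Longrightarrow> opair (cConj p q) s \<in> elts S \<longleftrightarrow> opair p s \<in> elts S \<and> opair q s \<in> elts S"
    "a \<in> elts omega \<Longrightarrow> p \<in> elts Form \<Longrightarrow> opair (cEx a p) s \<in> elts S \<longleftrightarrow> (\<exists>x\<in>elts M. opair p (upd s a x) \<in> elts S)"
  using assms unfolding sat_relation_def by simp_all

text \<open>Makes the existential quantifier in \<open>Sat\<close> harmless: any satisfaction
  relation may be used to evaluate a formula, and the Tarski clauses pass to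
  \<open>Sat\<close>.\<close>

lemma sat_relation_unique:
  assumes M: "M \<in> sets" and S: "S \<in> sets" "sat_relation M S" and T: "T \<in> sets" "sat_relation M T"
    and p: "p \<in> elts Form" and s: "assignment M s"
  shows "opair p s \<in> elts S \<longleftrightarrow> opair p s \<in> elts T"
proof -
  have "\<forall>s\<in>sets. assignment M s \<longrightarrow> (opair p s \<in> elts S \<longleftrightarrow> opair p s \<in> elts T)"
  proof (rule Form_induct[of "\<lambda>p. \<forall>s\<in>sets. assignment M s \<longrightarrow> (opair p s \<in> elts S \<longleftrightarrow> opair p s \<in> elts T)", OF _ _ _ _ _ _ p])
    show "dfn UNIV (\<lambda>e. \<forall>s\<in>sets. assignment M s \<longrightarrow> (opair (e 0) s \<in> elts S \<longleftrightarrow> opair (e 0) s \<in> elts T))"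
      by (intro dfn_intros tm_UNIV_const M S T)
  next
    fix a p assume a: "a \<in> elts omega" and p: "p \<in> elts Form"
      and IH: "\<forall>s\<in>sets. assignment M s \<longrightarrow> (opair p s \<in> elts S \<longleftrightarrow> opair p s \<in> elts T)"
    show "\<forall>s\<in>sets. assignment M s \<longrightarrow> (opair (cEx a p) s \<in> elts S \<longleftrightarrow> opair (cEx a p) s \<in> elts T)"
    proof (intro ballI impI)
      fix s assume s: "assignment M s"
      have "opair p (upd s a x) \<in> elts S \<longleftrightarrow> opair p (upd s a x) \<in> elts T" if "x \<in> elts M" for x
        using IH assignment_upd(1)[OF s a that] assignment_sets by blast
      then show "opair (cEx a p) s \<in> elts S \<longleftrightarrow> opair (cEx a p) s \<in> elts T"
        using sat_relationD(5)[OF S(2) s a p] sat_relationD(5)[OF T(2) s a p] by simp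
    qed
  qed (use sat_relationD(1-4)[OF S(2)] sat_relationD(1-4)[OF T(2)] in simp_all)
  then show ?thesis using s assignment_sets by blast
qed

lemma Sat_iff:
  assumes "M \<in> sets" "S \<in> sets" "sat_relation M S" "p \<in> elts Form" "assignment M s"
  shows "Sat M p s \<longleftrightarrow> opair p s \<in> elts S"
  using sat_relation_unique[OF assms(1) _ _ assms(2,3,4,5)] assms(2,3) unfolding Sat_def by blast

lemma Sat_simps:
  assumes M: "M \<in> sets" and s: "assignment M s"
  shows "a \<in> elts omega \<Longrightarrow> b \<in> elts omega \<Longrightarrow> Sat M (cMem a b) s \<longleftrightarrow> app s a \<in> elts (app s b)"
    "a \<in> elts omega \<Longrightarrow> b \<in> elts omega \<Longrightarrow> Sat M (cEq a b) s \<longleftrightarrow> app s a = app s b"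
    "p \<in> elts Form \<Longrightarrow> Sat M (cNeg p) s \<longleftrightarrow> \<not> Sat M p s"
    "p \<in> elts Form \<Longrightarrow> q \<in> elts Form \<Longrightarrow> Sat M (cConj p q) s \<longleftrightarrow> Sat M p s \<and> Sat M q s"
    "a \<in> elts omega \<Longrightarrow> p \<in> elts Form \<Longrightarrow> Sat M (cEx a p) s \<longleftrightarrow> (\<exists>x\<in>elts M. Sat M p (upd s a x))"
proof -
  obtain S where S: "S \<in> sets" "sat_relation M S" using sat_relation_ex[OF M] by blast
  note I = Sat_iff[OF M S]
  note D = sat_relationD[OF S(2) s]
  show "a \<in> elts omega \<Longrightarrow> b \<in> elts omega \<Longrightarrow> Sat M (cMem a b) s \<longleftrightarrow> app s a \<in> elts (app s b)"
    "a \<in> elts omega \<Longrightarrow> b \<in> elts omega \<Longrightarrow> Sat M (cEq a b) s \<longleftrightarrow> app s a = app s b"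
    "p \<in> elts Form \<Longrightarrow> Sat M (cNeg p) s \<longleftrightarrow> \<not> Sat M p s"
    "p \<in> elts Form \<Longrightarrow> q \<in> elts Form \<Longrightarrow> Sat M (cConj p q) s \<longleftrightarrow> Sat M p s \<and> Sat M q s"
    using I[OF _ s] D by simp_all
  assume a: "a \<in> elts omega" and p: "p \<in> elts Form"
  show "Sat M (cEx a p) s \<longleftrightarrow> (\<exists>x\<in>elts M. Sat M p (upd s a x))"
    using I[OF _ s, of "cEx a p"] D(5)[OF a p] I[OF p] assignment_upd(1)[OF s a] a p by simp
qed

section \<open>Definability of the classes of correct cardinals\<close>

lemma is_bij_iff:
  "is_bij f A B \<longleftrightarrow> is_fun f A B \<and> (\<forall>y\<in>elts B. \<exists>!x. x \<in> elts A \<and> opair x y \<in> elts f)"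
proof -
  have "(x \<in> elts A \<and> app f x = y) \<longleftrightarrow> (x \<in> elts A \<and> opair x y \<in> elts f)"
    if "is_fun f A B" "y \<in> elts B" for x y
    using is_fun_iff[OF that(1), of x y] elts_sets[OF that(2)] elts_sets[of x A] by auto
  then have "(\<exists>!x. x \<in> elts A \<and> app f x = y) \<longleftrightarrow> (\<exists>!x. x \<in> elts A \<and> opair x y \<in> elts f)"
    if "is_fun f A B" "y \<in> elts B" for y
    using that by simp
  then show ?thesis unfolding is_bij_def by (intro conj_cong ball_cong refl)
qed

lemma dfn_is_bij0: "dfn K (\<lambda>e. is_bij (e 0) (e (Suc 0)) (e (Suc (Suc 0))))"
  unfolding is_bij_iff by (intro dfn_intros)

lemmas dfn_is_bij [dfn_intros] = dfn_subst3[where P = is_bij, OF _ _ _ dfn_is_bij0]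

lemma dfn_Card0: "dfn K (\<lambda>e. Card (e 0))"
  unfolding Card_def by (intro dfn_intros)

lemmas dfn_Card [dfn_intros] = dfn_subst1[where P = Card, OF _ dfn_Card0]

lemma dfn_Limit0: "dfn K (\<lambda>e. Limit (e 0))"
  unfolding Limit_def by (intro dfn_intros)

lemmas dfn_Limit [dfn_intros] = dfn_subst1[where P = Limit, OF _ dfn_Limit0]

lemma dfn_sigma_form0: "dfn K (\<lambda>e. sigma_form n (e 0))"
proof (induction n)
  case 0
  then show ?case unfolding sigma_form.simps by (intro dfn_intros)
next
  case (Suc n)
  show ?case unfolding sigma_form.simps
    by (intro dfn_bex dfn_ex dfn_conj dfn_subst1[where P = "sigma_form n", OF _ Suc] dfn_intros)
qed

lemmas dfn_sigma_form [dfn_intros] = dfn_subst1[where P = "sigma_form n" for n, OF _ dfn_sigma_form0]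

text \<open>One formula for each \<open>n\<close>, produced by induction in the metatheory.\<close>

lemma dfn_sigma_true0: "dfn K (\<lambda>e. sigma_true n (e 0) (e (Suc 0)))"
proof (induction n)
  case 0
  then show ?case unfolding sigma_true.simps by (intro dfn_intros)
next
  case (Suc n)
  show ?case unfolding sigma_true.simps
    by (intro dfn_bex dfn_ex dfn_conj dfn_neg dfn_subst2[where P = "sigma_true n", OF _ _ Suc] dfn_intros)
qed

lemmas dfn_sigma_true [dfn_intros] = dfn_subst2[where P = "sigma_true n" for n, OF _ _ dfn_sigma_true0]

lemma sigma_form_sets: "sigma_form n p \<Longrightarrow> p \<in> sets"
  by (cases n) (auto dest: elts_sets)

text \<open>The original quantifiers range over classes and mention \<open>Vlev\<close>; both are
  replaced by expressions that the calculus accepts.\<close>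

lemma C_class_iff: "C_class n \<nu> \<longleftrightarrow> Card \<nu> \<and>
   (\<forall>p\<in>sets. \<forall>s\<in>sets. sigma_form n p \<longrightarrow> assignment (Vz \<nu>) s \<longrightarrow> (Sat (Vz \<nu>) p s \<longleftrightarrow> sigma_true n p s))"
proof (cases "Card \<nu>")
  case True
  then have "Ord \<nu>" by (simp add: Card_def)
  then show ?thesis unfolding C_class_def
    using sigma_form_sets[of n] assignment_sets[of "Vlev \<nu>"] by auto
qed (simp add: C_class_def)

lemma dfn_C_class0: "dfn K (\<lambda>e. C_class n (e 0))"
  unfolding C_class_iff by (intro dfn_intros)

lemmas dfn_C_class [dfn_intros] = dfn_subst1[where P = "C_class n" for n, OF _ dfn_C_class0]

section \<open>Reflection\<close>

text \<open>In the bounded case a witness found in \<open>N\<close> is an element of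
  \<open>app s b\<close>, hence of \<open>M\<close> by transitivity of \<open>M\<close>.\<close>

lemma Delta0_absolute_subset:
  assumes M: "M \<in> sets" "transitive M" and N: "N \<in> sets" "elts M \<subseteq> elts N"
    and p: "p \<in> elts Delta0" and s: "assignment M s"
  shows "Sat M p s \<longleftrightarrow> Sat N p s"
proof -
  have "\<forall>s\<in>sets. assignment M s \<longrightarrow> (Sat M p s \<longleftrightarrow> Sat N p s)"
  proof (rule Delta0_induct[of "\<lambda>p. \<forall>s\<in>sets. assignment M s \<longrightarrow> (Sat M p s \<longleftrightarrow> Sat N p s)", OF _ _ _ _ _ _ p])
    show "dfn UNIV (\<lambda>e. \<forall>s\<in>sets. assignment M s \<longrightarrow> (Sat M (e 0) s \<longleftrightarrow> Sat N (e 0) s))"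
      by (intro dfn_intros tm_UNIV_const M N)
  next
    fix a b p assume ab: "a \<in> elts omega" "b \<in> elts omega" "a \<noteq> b" and p: "p \<in> elts Form"
      and IH: "\<forall>s\<in>sets. assignment M s \<longrightarrow> (Sat M p s \<longleftrightarrow> Sat N p s)"
    show "\<forall>s\<in>sets. assignment M s \<longrightarrow> (Sat M (cEx a (cConj (cMem a b) p)) s \<longleftrightarrow> Sat N (cEx a (cConj (cMem a b) p)) s)"
    proof (intro ballI impI)
      fix s assume s: "assignment M s"
      have sN: "assignment N s" using assignment_mono[OF s N(2)] .
      \<comment> \<open>Because \<open>a \<noteq> b\<close>, the update at \<open>a\<close> leaves
        the bound \<open>app s b\<close> unchanged.\<close>
      have 1: "Sat M (cConj (cMem a b) p) (upd s a x) \<longleftrightarrow> x \<in> elts (app s b) \<and> Sat M p (upd s a x)" if "x \<in> elts M" for x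
        using Sat_simps(1,4)[OF M(1) assignment_upd(1)[OF s ab(1) that]] assignment_upd(2)[OF s ab(1) that] ab p by simp
      have 2: "Sat N (cConj (cMem a b) p) (upd s a x) \<longleftrightarrow> x \<in> elts (app s b) \<and> Sat N p (upd s a x)" if "x \<in> elts N" for x
        using Sat_simps(1,4)[OF N(1) assignment_upd(1)[OF sN ab(1) that]] assignment_upd(2)[OF sN ab(1) that] ab p by simp
      have sub: "elts (app s b) \<subseteq> elts M" using assignment_app[OF s ab(2)] M(2) unfolding transitive_def by blast
      have 3: "Sat M p (upd s a x) \<longleftrightarrow> Sat N p (upd s a x)" if "x \<in> elts M" for x
        using IH assignment_upd(1)[OF s ab(1) that] assignment_sets by blast
      have "(\<exists>x\<in>elts M. Sat M (cConj (cMem a b) p) (upd s a x)) \<longleftrightarrow> (\<exists>x\<in>elts N. Sat N (cConj (cMem a b) p) (upd s a x))"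
        using 1 2 3 sub N(2) by blast
      then show "Sat M (cEx a (cConj (cMem a b) p)) s \<longleftrightarrow> Sat N (cEx a (cConj (cMem a b) p)) s"
        using Sat_simps(5)[OF M(1) s, of a "cConj (cMem a b) p"] Sat_simps(5)[OF N(1) sN, of a "cConj (cMem a b) p"] ab p by simp
    qed
  qed (use Sat_simps(1-4)[OF M(1)] Sat_simps(1-4)[OF N(1)] assignment_mono[OF _ N(2)] in simp_all)
  then show ?thesis using s assignment_sets by blast
qed

lemma Delta0_absolute:
  assumes "M \<in> sets" "transitive M" "N \<in> sets" "transitive N" "p \<in> elts Delta0" "assignment M s" "assignment N s"
  shows "Sat M p s \<longleftrightarrow> Sat N p s"
proof -
  obtain U where U: "U \<in> sets" "elts U = elts M \<union> elts N" by (rule union_sets[OF assms(1,3)]) (rule that)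
  then show ?thesis
    using Delta0_absolute_subset[OF assms(1,2) U(1) _ assms(5,6)] Delta0_absolute_subset[OF assms(3,4) U(1) _ assms(5,7)] by blast
qed

lemma sigma_form_Form: "sigma_form n p \<Longrightarrow> p \<in> elts Form"
  by (induction n arbitrary: p) (use Delta0_subset_Form in auto)

text \<open>A Tarski-Vaught test level by level: \<open>cl\<close> brings a witness for the leading
  quantifier into \<open>V_\<nu>\<close>, and \<Delta>0 absoluteness starts the induction.\<close>

lemma C_conditions:
  assumes \<nu>: "Limit \<nu>" and card: "Card \<nu>"
    and cl: "\<And>i q s a x. i < n \<Longrightarrow> q \<in> elts Form \<Longrightarrow> assignment (Vlev \<nu>) s \<Longrightarrow> a \<in> elts omega \<Longrightarrow> x \<in> sets \<Longrightarrow>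
      \<not> sigma_true i q (upd s a x) \<Longrightarrow> \<exists>x\<in>elts (Vlev \<nu>). \<not> sigma_true i q (upd s a x)"
  shows "i \<le> n \<Longrightarrow> C_class i \<nu>"
proof (induction i)
  case 0
  have o: "Ord \<nu>" using \<nu> Limit_Ord by blast
  have "Sat (Vlev \<nu>) p s \<longleftrightarrow> (\<exists>M\<in>sets. transitive M \<and> assignment M s \<and> Sat M p s)"
    if "p \<in> elts Delta0" "assignment (Vlev \<nu>) s" for p s
    using Delta0_absolute[OF Vlev_sets[OF o] V_transitive[OF o] _ _ that] that(2) Vlev_sets[OF o] V_transitive[OF o] by blast
  then show ?case unfolding C_class_def using card by simp
next
  case (Suc i)
  then have C: "C_class i \<nu>" and i: "i < n" by simp_all
  have o: "Ord \<nu>" using \<nu> Limit_Ord by blast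
  show ?case unfolding C_class_def
  proof (intro conjI card allI impI)
    fix p s assume p: "sigma_form (Suc i) p" and s: "assignment (Vlev \<nu>) s"
    obtain a q where aq: "a \<in> elts omega" "q \<in> sets" "sigma_form i q" "p = cEx a (cNeg q)" using p by auto
    have q: "q \<in> elts Form" using sigma_form_Form[OF aq(3)] .
    have "Sat (Vlev \<nu>) p s \<longleftrightarrow> (\<exists>x\<in>elts (Vlev \<nu>). \<not> Sat (Vlev \<nu>) q (upd s a x))"
      unfolding aq(4) using Sat_simps(5)[OF Vlev_sets[OF o] s aq(1), of "cNeg q"] q
        Sat_simps(3)[OF Vlev_sets[OF o] assignment_upd(1)[OF s aq(1)] q] by simp
    also have "\<dots> \<longleftrightarrow> (\<exists>x\<in>elts (Vlev \<nu>). \<not> sigma_true i q (upd s a x))"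
      using C aq(3) assignment_upd(1)[OF s aq(1)] unfolding C_class_def by simp
    also have "\<dots> \<longleftrightarrow> (\<exists>x\<in>sets. \<not> sigma_true i q (upd s a x))"
      using cl[OF i q s aq(1)] elts_sets by blast
    also have "\<dots> \<longleftrightarrow> sigma_true (Suc i) p s"
      unfolding aq(4) sigma_true.simps using aq(1,2) by auto
    finally show "Sat (Vlev \<nu>) p s \<longleftrightarrow> sigma_true (Suc i) p s" .
  qed
qed

lemma bij_app:
  assumes "is_bij f A B" "y \<in> elts B"
  obtains x where "x \<in> elts A" "app f x = y"
  using assms unfolding is_bij_def by blast

text \<open>Uniqueness of the order type: \<open>f\<close> and \<open>g\<close> carry the same
  relation on \<open>A\<close> isomorphically onto membership on a transitive set, so they are the
  same collapse.\<close>

lemma ordinal_of_relation_unique: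
  assumes f: "f \<in> sets" "is_bij f A y" and g: "g \<in> sets" "is_bij g A z" and A: "A \<in> sets"
    and o: "Ord y" "Ord z"
    and eq: "\<And>u v. u \<in> elts A \<Longrightarrow> v \<in> elts A \<Longrightarrow> app f u \<in> elts (app f v) \<longleftrightarrow> app g u \<in> elts (app g v)"
  shows "y = z"
proof -
  have ff: "is_fun f A y" and gg: "is_fun g A z" using f g unfolding is_bij_def by auto
  have mem: "opair u w \<in> elts f \<longleftrightarrow> w = app f u" "opair u w \<in> elts g \<longleftrightarrow> w = app g u" if "u \<in> elts A" "w \<in> sets" for u w
    using is_fun_iff[OF ff, of u w] is_fun_iff[OF gg, of u w] that elts_sets by auto
  \<comment> \<open>The induction runs over the value \<open>w\<close>, where membership is
    well-founded; \<open>A\<close> only carries the order induced from the ordinals.\<close>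
  have ind: "\<forall>u\<in>elts A. opair u w \<in> elts f \<longrightarrow> opair u w \<in> elts g" if "w \<in> sets" for w
  proof (rule eps_induct[of "\<lambda>w. \<forall>u\<in>elts A. opair u w \<in> elts f \<longrightarrow> opair u w \<in> elts g", OF _ _ that])
    show "dfn UNIV (\<lambda>e. \<forall>u\<in>elts A. opair u (e 0) \<in> elts f \<longrightarrow> opair u (e 0) \<in> elts g)"
      by (intro dfn_intros tm_UNIV_const f g A)
    fix w assume w: "w \<in> sets" and IH: "\<And>c. c \<in> elts w \<Longrightarrow> \<forall>u\<in>elts A. opair u c \<in> elts f \<longrightarrow> opair u c \<in> elts g"
    have IH': "app g v = app f v" if "v \<in> elts A" "app f v \<in> elts w" for v
      using IH[OF that(2)] mem[OF that(1)] that elts_sets by metis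
    show "\<forall>u\<in>elts A. opair u w \<in> elts f \<longrightarrow> opair u w \<in> elts g"
    proof (intro ballI impI)
      fix u assume u: "u \<in> elts A" "opair u w \<in> elts f"
      then have fu: "app f u = w" using mem(1)[OF u(1) w] by simp
      have "elts w = elts (app g u)"
      proof (intro equalityI subsetI)
        fix c assume c: "c \<in> elts w"
        have "w \<in> elts y" using is_fun_app(1)[OF ff u(1)] fu by simp
        then have "c \<in> elts y" using Ord_trans[OF o(1) c] by blast
        then obtain v where v: "v \<in> elts A" "app f v = c" by (rule bij_app[OF f(2)])
        then have "app g v \<in> elts (app g u)" using eq[OF v(1) u(1)] fu c by simp
        then show "c \<in> elts (app g u)" using IH'[OF v(1)] v(2) c by simp
      next
        fix d assume d: "d \<in> elts (app g u)"
        then have "d \<in> elts z" using Ord_trans[OF o(2) d is_fun_app(1)[OF gg u(1)]] by blast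
        then obtain v where v: "v \<in> elts A" "app g v = d" by (rule bij_app[OF g(2)])
        then have "app f v \<in> elts w" using eq[OF v(1) u(1)] fu d by simp
        then show "d \<in> elts w" using IH'[OF v(1)] v(2) by simp
      qed
      then have "w = app g u" by (rule extensionality)
      then show "opair u w \<in> elts g" using mem(2)[OF u(1) w] by simp
    qed
  qed
  have fg: "app f u = app g u" if "u \<in> elts A" for u
  proof -
    have "app f u \<in> sets" "opair u (app f u) \<in> elts f" using is_fun_app(2,3)[OF ff that] by auto
    then show ?thesis using ind[of "app f u"] mem(2)[OF that] that by blast
  qed
  have "elts y = elts z"
  proof (intro equalityI subsetI)
    fix c assume "c \<in> elts y"
    then obtain v where "v \<in> elts A" "app f v = c" by (rule bij_app[OF f(2)])
    then show "c \<in> elts z" using is_fun_app(1)[OF gg, of v] fg by simp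
  next
    fix c assume "c \<in> elts z"
    then obtain v where "v \<in> elts A" "app g v = c" by (rule bij_app[OF g(2)])
    then show "c \<in> elts y" using is_fun_app(1)[OF ff, of v] fg by simp
  qed
  then show ?thesis by (rule extensionality)
qed

text \<open>
  If \<open>V\<^sub>\<nu>\<close> is closed under this relation, then \<open>\<nu>\<close> is a cardinal: a bijection of some \<open>\<alpha> < \<nu>\<close> with
  \<open>\<nu>\<close> induces a well-order \<open>r\<close> of \<open>\<alpha>\<close> in \<open>V\<^sub>\<nu>\<close>, and \<open>(\<alpha>, r)\<close> is related to \<open>\<nu>\<close> only.
\<close>

definition hartogs :: "'c \<Rightarrow> 'c \<Rightarrow> bool" where
  "hartogs x y \<longleftrightarrow> Ord y \<and> (\<exists>\<alpha>\<in>sets. \<exists>r\<in>sets. \<exists>f\<in>sets. x = opair \<alpha> r \<and> is_bij f \<alpha> y \<and>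
     (\<forall>u\<in>elts \<alpha>. \<forall>v\<in>elts \<alpha>. opair u v \<in> elts r \<longleftrightarrow>
        (\<exists>u'\<in>sets. \<exists>v'\<in>sets. opair u u' \<in> elts f \<and> opair v v' \<in> elts f \<and> u' \<in> elts v')))"

lemma dfn_hartogs0: "dfn K (\<lambda>e. hartogs (e 0) (e (Suc 0)))"
  unfolding hartogs_def by (intro dfn_intros)

lemma hartogs_rel:
  assumes "is_bij f \<alpha> y" "u \<in> elts \<alpha>" "v \<in> elts \<alpha>"
  shows "(\<exists>u'\<in>sets. \<exists>v'\<in>sets. opair u u' \<in> elts f \<and> opair v v' \<in> elts f \<and> u' \<in> elts v') \<longleftrightarrow> app f u \<in> elts (app f v)"
proof -
  have f: "is_fun f \<alpha> y" using assms unfolding is_bij_def by blast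
  have "opair w c \<in> elts f \<longleftrightarrow> c = app f w" if "w \<in> elts \<alpha>" "c \<in> sets" for w c
    using is_fun_iff[OF f, of w c] that elts_sets by auto
  then show ?thesis using assms is_fun_app(3)[OF f] by auto
qed

lemma hartogs_unique:
  assumes "hartogs x y" "hartogs x z"
  shows "y = z"
proof -
  obtain \<alpha> r f where f: "\<alpha> \<in> sets" "r \<in> sets" "f \<in> sets" "x = opair \<alpha> r" "is_bij f \<alpha> y" "Ord y"
    "\<forall>u\<in>elts \<alpha>. \<forall>v\<in>elts \<alpha>. opair u v \<in> elts r \<longleftrightarrow> (\<exists>u'\<in>sets. \<exists>v'\<in>sets. opair u u' \<in> elts f \<and> opair v v' \<in> elts f \<and> u' \<in> elts v')"
    using assms(1) unfolding hartogs_def by blast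
  obtain \<beta> q g where g: "\<beta> \<in> sets" "q \<in> sets" "g \<in> sets" "x = opair \<beta> q" "is_bij g \<beta> z" "Ord z"
    "\<forall>u\<in>elts \<beta>. \<forall>v\<in>elts \<beta>. opair u v \<in> elts q \<longleftrightarrow> (\<exists>u'\<in>sets. \<exists>v'\<in>sets. opair u u' \<in> elts g \<and> opair v v' \<in> elts g \<and> u' \<in> elts v')"
    using assms(2) unfolding hartogs_def by blast
  have e: "\<beta> = \<alpha>" "q = r" using f(1,2,4) g(1,2,4) opair_eq_iff by auto
  show ?thesis
  proof (rule ordinal_of_relation_unique[OF f(3,5) g(3) g(5)[unfolded e] f(1,6) g(6)])
    fix u v assume uv: "u \<in> elts \<alpha>" "v \<in> elts \<alpha>"
    show "app f u \<in> elts (app f v) \<longleftrightarrow> app g u \<in> elts (app g v)"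
      using f(7) g(7)[unfolded e] hartogs_rel[OF f(5) uv] hartogs_rel[OF g(5)[unfolded e] uv] uv by simp
  qed
qed

lemma Card_of_closure:
  assumes \<nu>: "Limit \<nu>" and cl: "\<And>x y. x \<in> elts (Vlev \<nu>) \<Longrightarrow> y \<in> sets \<Longrightarrow> hartogs x y \<Longrightarrow> \<exists>y\<in>elts (Vlev \<nu>). hartogs x y"
  shows "Card \<nu>"
proof -
  have o: "Ord \<nu>" using \<nu> Limit_Ord by blast
  have "False" if \<alpha>: "\<alpha> \<in> elts \<nu>" and f: "f \<in> sets" "is_bij f \<alpha> \<nu>" for \<alpha> f
  proof -
    have as: "\<alpha> \<in> sets" "Ord \<alpha>" using \<alpha> elts_sets Ord_in[OF o] by auto
    obtain c where c: "c \<in> sets" "elts c = {opair x y |x y. x \<in> elts \<alpha> \<and> y \<in> elts \<alpha>}"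
      by (rule prod_ex[OF as(1) as(1)]) (rule that)
    define r where "r = Coll (\<lambda>p. \<exists>u\<in>elts \<alpha>. \<exists>v\<in>elts \<alpha>. p = opair u v \<and>
      (\<exists>u'\<in>sets. \<exists>v'\<in>sets. opair u u' \<in> elts f \<and> opair v v' \<in> elts f \<and> u' \<in> elts v'))"
    have "dfn UNIV (\<lambda>e. \<exists>u\<in>elts \<alpha>. \<exists>v\<in>elts \<alpha>. e 0 = opair u v \<and>
      (\<exists>u'\<in>sets. \<exists>v'\<in>sets. opair u u' \<in> elts f \<and> opair v v' \<in> elts f \<and> u' \<in> elts v'))"
      by (intro dfn_intros tm_UNIV_const as f)
    then have E: "elts r = {p \<in> sets. \<exists>u\<in>elts \<alpha>. \<exists>v\<in>elts \<alpha>. p = opair u v \<and>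
      (\<exists>u'\<in>sets. \<exists>v'\<in>sets. opair u u' \<in> elts f \<and> opair v v' \<in> elts f \<and> u' \<in> elts v')}"
      unfolding r_def by (rule elts_Coll)
    have rs: "r \<in> sets" by (rule separation[OF c(1)]) (unfold E c(2), blast)
    have rel: "opair u v \<in> elts r \<longleftrightarrow> (\<exists>u'\<in>sets. \<exists>v'\<in>sets. opair u u' \<in> elts f \<and> opair v v' \<in> elts f \<and> u' \<in> elts v')"
      if "u \<in> elts \<alpha>" "v \<in> elts \<alpha>" for u v
    proof -
      have s: "u \<in> sets" "v \<in> sets" using that elts_sets by auto
      have "(\<exists>u1\<in>elts \<alpha>. \<exists>v1\<in>elts \<alpha>. opair u v = opair u1 v1 \<and> X u1 v1) \<longleftrightarrow> X u v" for X
        using that s opair_eq_iff elts_sets by metis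
      then show ?thesis unfolding E using s by simp
    qed
    have "r \<in> elts (Vlev \<nu>)"
    proof (rule Limit_relation[OF \<nu> \<alpha> rs])
      fix p assume "p \<in> elts r"
      then obtain u v where "u \<in> elts \<alpha>" "v \<in> elts \<alpha>" "p = opair u v" unfolding E by blast
      then show "\<exists>x\<in>elts (Vlev \<alpha>). \<exists>y\<in>elts (Vlev \<alpha>). p = opair x y" using Ord_subset_V[OF as(2)] by blast
    qed
    moreover have "\<alpha> \<in> elts (Vlev \<nu>)" using Ord_mem_V[OF o as(2)] \<alpha> by simp
    ultimately have x: "opair \<alpha> r \<in> elts (Vlev \<nu>)" using Limit_opair[OF \<nu>] by blast
    have h: "hartogs (opair \<alpha> r) \<nu>" unfolding hartogs_def using o as rs f rel by blast
    then obtain y where "y \<in> elts (Vlev \<nu>)" "hartogs (opair \<alpha> r) y" using cl[OF x Ord_sets[OF o]] by blast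
    then show False using hartogs_unique[OF h] Ord_notin_V[OF o] by blast
  qed
  then show ?thesis unfolding Card_def using o by blast
qed

text \<open>Closure under one relation for cardinality and one for each level of truth below
  \<open>n\<close>. The Tarski-Vaught instances have assignments among their parameters, so these
  must be elements of \<open>V_\<nu>\<close>; the clause on omega-sequences in
  \<open>reflection_closure\<close> provides this.\<close>

theorem C_class_unbounded:
  assumes \<kappa>: "omega_regular \<kappa>" and a0: "Ord \<alpha>0"
  obtains \<nu> where "Limit \<nu>" "\<alpha>0 \<in> elts \<nu>" "\<And>i. i \<le> n \<Longrightarrow> C_class i \<nu>"
proof -
  \<comment> \<open>The formula, the variable and the assignment are packed into a single parameter
    \<open>x\<close>, since the closure theorem handles binary relations; \<open>y\<close> refutes
    the matrix.\<close>
  define W where "W i x y \<longleftrightarrow> (\<exists>q\<in>sets. \<exists>a\<in>sets. \<exists>s\<in>sets. x = opair q (opair a s) \<and> \<not> sigma_true i q (upd s a y))" for i x y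
  define R where "R i = (case i of 0 \<Rightarrow> hartogs | Suc k \<Rightarrow> W k)" for i
  have dW: "dfn UNIV (\<lambda>e. W i (e 0) (e (Suc 0)))" for i unfolding W_def by (intro dfn_intros)
  have dR: "dfn UNIV (\<lambda>e. R i (e 0) (e (Suc 0)))" for i
    by (cases i) (simp_all add: R_def dW dfn_hartogs0)
  \<comment> \<open>Starting above omega as well ensures that graphs of sequences from omega into a
    level below \<nu> have bounded rank below \<nu>.\<close>
  obtain \<alpha>1 where \<alpha>1: "Ord \<alpha>1" "elts \<alpha>0 \<subseteq> elts \<alpha>1" "elts omega \<subseteq> elts \<alpha>1"
    using Ord_max[OF a0 Ord_omega] by blast
  obtain \<nu> where \<nu>: "Limit \<nu>" "\<alpha>1 \<in> elts \<nu>"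
    "\<And>s. s \<in> sets \<Longrightarrow> is_fun s omega (Vlev \<nu>) \<Longrightarrow> \<exists>\<gamma>\<in>elts \<nu>. is_fun s omega (Vlev \<gamma>)"
    "\<And>i x y. i < Suc n \<Longrightarrow> x \<in> elts (Vlev \<nu>) \<Longrightarrow> y \<in> sets \<Longrightarrow> R i x y \<Longrightarrow> \<exists>y\<in>elts (Vlev \<nu>). R i x y"
    by (rule reflection_closure[OF \<kappa>, where R = R and m = "Suc n", OF dR \<alpha>1(1)]) (rule that)
  have o: "Ord \<nu>" using \<nu>(1) Limit_Ord by blast
  have \<omega>in: "omega \<in> elts \<nu>" and a0in: "\<alpha>0 \<in> elts \<nu>"
    using \<alpha>1 \<nu>(2) Ord_subset_iff[OF _ \<alpha>1(1)] a0 Ord_omega Ord_trans[OF o, of _ \<alpha>1] by blast+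
  have card: "Card \<nu>"
    by (rule Card_of_closure[OF \<nu>(1)]) (use \<nu>(4)[of 0] in \<open>simp add: R_def\<close>)
  have w: "elts omega \<subseteq> elts (Vlev \<nu>)"
    using omega_subset_Limit[OF \<nu>(1)] Ord_subset_V[OF o] by blast
  have sV: "s \<in> elts (Vlev \<nu>)" if s: "assignment (Vlev \<nu>) s" for s
  proof -
    have ss: "s \<in> sets" "is_fun s omega (Vlev \<nu>)" using s unfolding assignment_def by auto
    obtain \<gamma> where \<gamma>: "\<gamma> \<in> elts \<nu>" "is_fun s omega (Vlev \<gamma>)" using \<nu>(3)[OF ss] by blast
    have og: "Ord \<gamma>" using \<gamma> Ord_in[OF o] by blast
    obtain c where c: "Ord c" "elts \<gamma> \<subseteq> elts c" "elts omega \<subseteq> elts c" "c = \<gamma> \<or> c = omega"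
      using Ord_max[OF og Ord_omega] by blast
    have cin: "c \<in> elts \<nu>" using c(4) \<gamma>(1) \<omega>in by blast
    show ?thesis
    proof (rule Limit_relation[OF \<nu>(1) cin ss(1)])
      fix p assume "p \<in> elts s"
      then obtain a y where "a \<in> elts omega" "y \<in> elts (Vlev \<gamma>)" "p = opair a y" using is_funD1[OF \<gamma>(2)] by blast
      then show "\<exists>x\<in>elts (Vlev c). \<exists>y\<in>elts (Vlev c). p = opair x y"
        using V_mono[OF og c(1,2)] Ord_subset_V[OF c(1)] c(3) by blast
    qed
  qed
  show ?thesis
  proof (rule that[OF \<nu>(1) a0in])
    fix i assume i: "i \<le> n"
    show "C_class i \<nu>"
    proof (rule C_conditions[OF \<nu>(1) card _ i])
      fix i q s a x assume *: "i < n" "q \<in> elts Form" "assignment (Vlev \<nu>) s" "a \<in> elts omega" "x \<in> sets"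
        "\<not> sigma_true i q (upd s a x)"
      have qs: "q \<in> sets" "a \<in> sets" "s \<in> sets" using * assignment_sets by auto
      have "q \<in> elts (Vlev \<nu>)" "a \<in> elts (Vlev \<nu>)" using * Form_subset_V[OF \<nu>(1)] w by auto
      then have X: "opair q (opair a s) \<in> elts (Vlev \<nu>)" using sV[OF *(3)] Limit_opair[OF \<nu>(1)] by blast
      have "W i (opair q (opair a s)) x" unfolding W_def using qs *(6) by blast
      then have "\<exists>y\<in>elts (Vlev \<nu>). W i (opair q (opair a s)) y"
        using \<nu>(4)[of "Suc i", OF _ X *(5)] *(1) by (simp add: R_def)
      then obtain y where y: "y \<in> elts (Vlev \<nu>)" "W i (opair q (opair a s)) y" by blast
      then have "\<not> sigma_true i q (upd s a y)" unfolding W_def using qs by (auto simp: opair_eq_iff)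
      then show "\<exists>x\<in>elts (Vlev \<nu>). \<not> sigma_true i q (upd s a x)" using y by blast
    qed
  qed
qed

section \<open>Union and application as total terms\<close>

lemma tm_bigU0: "tm K (\<lambda>e. bigU (e 0))"
  unfolding bigU_def by (rule tm_Coll, intro dfn_intros, fold bigU_def) (auto simp: image_subset_iff)

lemmas tm_bigU [dfn_intros] = tm_subst1[where f = bigU, OF _ tm_bigU0]

text \<open>
  Outside the domain of a function \<open>app\<close> is an unspecified class, which need not be definable.
\<close>

definition appz :: "'c \<Rightarrow> 'c \<Rightarrow> 'c" where
  "appz f x = Coll (\<lambda>z. \<exists>y\<in>sets. opair x y \<in> elts f \<and> z \<in> elts y)"

lemma appz_aux:
  assumes "f \<in> sets" "x \<in> sets"
  shows "appz f x \<in> sets" "elts (appz f x) = {z \<in> sets. \<exists>y\<in>sets. opair x y \<in> elts f \<and> z \<in> elts y}"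
proof -
  have "dfn UNIV (\<lambda>e. \<exists>y\<in>sets. opair x y \<in> elts f \<and> e 0 \<in> elts y)" by (intro dfn_intros tm_UNIV_const assms)
  then show E: "elts (appz f x) = {z \<in> sets. \<exists>y\<in>sets. opair x y \<in> elts f \<and> z \<in> elts y}"
    unfolding appz_def by (rule elts_Coll)
  show "appz f x \<in> sets"
  proof (rule separation[of "bigU (bigU (bigU f))"])
    show "elts (appz f x) \<subseteq> elts (bigU (bigU (bigU f)))"
    proof
      fix z assume "z \<in> elts (appz f x)"
      then obtain y where y: "y \<in> sets" "opair x y \<in> elts f" "z \<in> elts y" using E by blast
      have "upair x y \<in> elts (opair x y)" "y \<in> elts (upair x y)" using y assms by (auto simp: opair_def)
      then show "z \<in> elts (bigU (bigU (bigU f)))" using assms(1) y(2,3) by (auto simp del: elts_upair)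
    qed
  qed (use assms in simp)
qed

lemma tm_appz0: "tm K (\<lambda>e. appz (e 0) (e (Suc 0)))"
  unfolding appz_def by (rule tm_Coll, intro dfn_intros, fold appz_def) (auto simp: image_subset_iff appz_aux)

lemma appz_eq: "f \<in> sets \<Longrightarrow> is_fun f A B \<Longrightarrow> x \<in> elts A \<Longrightarrow> appz f x = app f x"
proof (rule extensionality)
  assume f: "f \<in> sets" "is_fun f A B" and x: "x \<in> elts A"
  have xs: "x \<in> sets" using x elts_sets by blast
  have "opair x y \<in> elts f \<longleftrightarrow> y = app f x" if "y \<in> sets" for y using is_fun_iff[OF f(2) xs that] x by blast
  then show "elts (appz f x) = elts (app f x)"
    unfolding appz_aux(2)[OF f(1) xs] using is_fun_app(3)[OF f(2) x] elts_sets by auto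
qed

text \<open>Union acts as the predecessor, which the recursion for the critical sequence
  uses.\<close>

lemma bigU_succ: "Ord m \<Longrightarrow> bigU (succ m) = m"
  by (rule extensionality) (auto simp: Ord_sets dest: Ord_trans)

end

section \<open>The action of the embedding on sets\<close>

locale nbg_embedding = nbg +
  fixes j
  assumes elementary: "elementary_V j" and nontrivial: "nontrivial_V j"
begin

definition J :: "'a \<Rightarrow> 'a" where "J x = app j x"

definition Fixed :: "'a set" where "Fixed = {x \<in> sets. J x = x}"

lemma j_fun: "is_fun j Univ Univ"
  using elementary unfolding elementary_V_def by blast

lemma J_sets [simp]: "x \<in> sets \<Longrightarrow> J x \<in> sets"
  using is_fun_app(3)[OF j_fun, of x] by (simp add: J_def)

text \<open>The class \<open>j\<close> occurs as a parameter. Formulas with \<open>J\<close> are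
  therefore admissible in comprehension, recursion and induction, but not in
  \<open>elementarity\<close>.\<close>

lemma tm_J: "tm UNIV (\<lambda>e. J (e 0))"
proof (rule tm_The[where Q = "\<lambda>y e. opair (e 0) y \<in> elts j"])
  show "dfn UNIV (\<lambda>e. opair (e (Suc 0)) (e 0) \<in> elts j)" by (intro dfn_mem_class UNIV_I dfn_intros)
  fix e :: "nat \<Rightarrow> 'a" assume "range e \<subseteq> sets"
  then have e: "e 0 \<in> sets" by blast
  then show "J (e 0) \<in> sets \<and> (\<forall>x\<in>sets. opair (e 0) x \<in> elts j \<longleftrightarrow> x = J (e 0))"
    using is_fun_iff[OF j_fun e] by (auto simp: J_def[symmetric])
qed

lemmas tm_J' = tm_subst1[where f = J, OF _ tm_J]

text \<open>Applying \<open>j\<close> to the whole environment leaves the parameter block untouched,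
  because its members are fixed, and moves just the remaining entries.\<close>

lemma elementarity:
  assumes "dfn Fixed P" "range e \<subseteq> sets"
  shows "P e \<longleftrightarrow> P (\<lambda>i. J (e i))"
proof -
  obtain p ps where ps: "set ps \<subseteq> Fixed" and p: "\<And>e. range e \<subseteq> sets \<Longrightarrow> tru p (penv ps e) \<longleftrightarrow> P e"
    using assms(1) by (rule dfnE) (rule that)
  have nth: "ps ! i \<in> sets \<and> J (ps ! i) = ps ! i" if "i < length ps" for i
    using ps nth_mem[OF that] unfolding Fixed_def by blast
  have "range (penv ps e) \<subseteq> sets" using nth assms(2) by (auto simp: penv_def)
  then have "tru p (penv ps e) \<longleftrightarrow> tru p (\<lambda>i. app j (penv ps e i))"
    using elementary unfolding elementary_V_def by blast
  moreover have "(\<lambda>i. app j (penv ps e i)) = penv ps (\<lambda>i. J (e i))"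
    using nth by (auto simp: penv_def J_def[symmetric])
  moreover have "range (\<lambda>i. J (e i)) \<subseteq> sets" using assms(2) by auto
  ultimately show ?thesis using p[OF assms(2)] p[of "\<lambda>i. J (e i)"] by simp
qed

lemma elementarity1:
  assumes "dfn Fixed (\<lambda>e. P (e 0))" "x \<in> sets"
  shows "P x \<longleftrightarrow> P (J x)"
  using elementarity[OF assms(1), of "\<lambda>_. x"] assms(2) by auto

lemma elementarity2:
  assumes "dfn Fixed (\<lambda>e. P (e 0) (e (Suc 0)))" "x \<in> sets" "y \<in> sets"
  shows "P x y \<longleftrightarrow> P (J x) (J y)"
  using elementarity[OF assms(1), of "\<lambda>i. if i = 0 then x else y"] assms(2,3) by auto

lemma elementarity3:
  assumes "dfn Fixed (\<lambda>e. P (e 0) (e (Suc 0)) (e (Suc (Suc 0))))" "x \<in> sets" "y \<in> sets" "z \<in> sets"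
  shows "P x y z \<longleftrightarrow> P (J x) (J y) (J z)"
  using elementarity[OF assms(1), of "\<lambda>i. if i = 0 then x else if i = 1 then y else z"] assms(2-4) by auto

text \<open>The condition of being equal to \<open>a\<close> is definable from fixed parameters and
  true of \<open>a\<close>, hence true of \<open>J a\<close>.\<close>

lemma tm_Fixed:
  assumes "tm Fixed (\<lambda>e. a)"
  shows "a \<in> Fixed"
proof -
  have a: "a \<in> sets" using tm_sets[OF assms, of "\<lambda>_. empty"] by auto
  have "dfn Fixed (\<lambda>e. e 0 = a)" using assms unfolding tm_def by simp
  then show ?thesis using elementarity1[of "\<lambda>x. x = a", OF _ a] a unfolding Fixed_def by simp
qed

lemma Fixed_J: "a \<in> Fixed \<Longrightarrow> J a = a"
  by (simp add: Fixed_def)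

lemma tm_Fixed_const: "a \<in> Fixed \<Longrightarrow> tm Fixed (\<lambda>e. a)"
  by (rule tm_const) (simp_all add: Fixed_def)

lemma J_tm1:
  assumes "tm Fixed (\<lambda>e. f (e 0))" "x \<in> sets"
  shows "J (f x) = f (J x)"
proof -
  have "dfn Fixed (\<lambda>e. e 0 = f (e (Suc 0)))" using assms unfolding tm_def by simp
  then show ?thesis using elementarity2[of "\<lambda>y x. y = f x", OF _ tm_app1_sets[OF assms] assms(2)] by simp
qed

lemma J_tm2:
  assumes "tm Fixed (\<lambda>e. f (e 0) (e (Suc 0)))" "x \<in> sets" "y \<in> sets"
  shows "J (f x y) = f (J x) (J y)"
proof -
  have s: "f x y \<in> sets" using tm_sets[OF assms(1), of "\<lambda>i. if i = 0 then x else y"] assms(2,3) by auto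
  have "dfn Fixed (\<lambda>e. e 0 = f (e (Suc 0)) (e (Suc (Suc 0))))" using assms unfolding tm_def by simp
  then show ?thesis using elementarity3[of "\<lambda>z x y. z = f x y", OF _ s assms(2,3)] by simp
qed

lemma J_opair: "x \<in> sets \<Longrightarrow> y \<in> sets \<Longrightarrow> J (opair x y) = opair (J x) (J y)"
  by (rule J_tm2) (intro dfn_intros)

lemma J_mem: "x \<in> sets \<Longrightarrow> y \<in> sets \<Longrightarrow> J x \<in> elts (J y) \<longleftrightarrow> x \<in> elts y"
  using elementarity2[of "\<lambda>x y. x \<in> elts y"] dfn_mem_var by blast

lemma J_memI: "y \<in> sets \<Longrightarrow> x \<in> elts y \<Longrightarrow> J x \<in> elts (J y)"
  using J_mem[of x y] elts_sets by blast

lemma J_subset: "x \<in> sets \<Longrightarrow> y \<in> sets \<Longrightarrow> elts (J x) \<subseteq> elts (J y) \<longleftrightarrow> elts x \<subseteq> elts y"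
  using elementarity2[of "\<lambda>x y. elts x \<subseteq> elts y", OF dfn_subset[OF tm_var tm_var]] by blast

lemma J_Ord: "x \<in> sets \<Longrightarrow> Ord (J x) \<longleftrightarrow> Ord x"
  using elementarity1[of Ord, OF dfn_Ord0] by blast

lemma J_Card: "x \<in> sets \<Longrightarrow> Card (J x) \<longleftrightarrow> Card x"
  using elementarity1[of Card, OF dfn_Card0] by blast

lemma J_empty [simp]: "J empty = empty" using tm_Fixed[OF tm_empty] Fixed_J by blast
lemma J_omega [simp]: "J omega = omega" using tm_Fixed[OF tm_omega] Fixed_J by blast
lemma J_Form [simp]: "J Form = Form" using tm_Fixed[OF tm_Form] Fixed_J by blast

lemma J_succ: "x \<in> sets \<Longrightarrow> J (succ x) = succ (J x)"
  by (rule J_tm1[where f = succ]) (intro dfn_intros)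

lemma J_fun:
  assumes "f \<in> sets" "A \<in> sets" "is_fun f A Univ"
  shows "is_fun (J f) (J A) Univ" "\<And>x. x \<in> elts A \<Longrightarrow> app (J f) (J x) = J (app f x)"
proof -
  show Jf: "is_fun (J f) (J A) Univ"
    using elementarity2[of "\<lambda>f A. is_fun f A Univ", OF dfn_is_fun_Univ0 assms(1,2)] assms(3) by blast
  fix x assume x: "x \<in> elts A"
  then have "opair x (app f x) \<in> elts f" and s: "x \<in> sets" "app f x \<in> sets"
    using is_fun_app[OF assms(3)] elts_sets by blast+
  then have "opair (J x) (J (app f x)) \<in> elts (J f)" using J_memI[OF assms(1)] J_opair by metis
  then show "app (J f) (J x) = J (app f x)" using is_fun_iff[OF Jf, of "J x" "J (app f x)"] s by simp
qed

lemma is_fun_Univ: "is_fun f A B \<Longrightarrow> is_fun f A Univ"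
  using is_fun_weaken is_fun_app(3) by (metis elts_Univ)

text \<open>Internal induction with \<open>j\<close> as a class parameter, so nonstandard elements
  of the model's \<open>omega\<close> are covered.\<close>

lemma J_omega_in [simp]: "m \<in> elts omega \<Longrightarrow> J m = m"
  by (rule omega_induct[of "\<lambda>m. J m = m"], intro dfn_eq tm_J tm_var) (simp_all add: J_succ)

text \<open>This connects the two notions of elementarity: coded formulas, nonstandard ones
  included, do not move when \<open>j\<close> is applied to a statement about
  \<open>Sat\<close>.\<close>

lemma J_Form_in: "p \<in> elts Form \<Longrightarrow> J p = p"
proof (rule Form_induct[of "\<lambda>p. J p = p"])
  show "dfn UNIV (\<lambda>e. J (e 0) = e 0)" by (intro dfn_eq tm_J tm_var)
  have t: "tm Fixed (\<lambda>e. cMem (e 0) (e (Suc 0)))" "tm Fixed (\<lambda>e. cEq (e 0) (e (Suc 0)))" "tm Fixed (\<lambda>e. cNeg (e 0))"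
    "tm Fixed (\<lambda>e. cConj (e 0) (e (Suc 0)))" "tm Fixed (\<lambda>e. cEx (e 0) (e (Suc 0)))" by (intro dfn_intros)+
  show "J (cMem a b) = cMem a b" if "a \<in> elts omega" "b \<in> elts omega" for a b using J_tm2[OF t(1)] that by simp
  show "J (cEq a b) = cEq a b" if "a \<in> elts omega" "b \<in> elts omega" for a b using J_tm2[OF t(2)] that by simp
  show "J (cNeg p) = cNeg p" if "p \<in> elts Form" "J p = p" for p using J_tm1[OF t(3)] that by simp
  show "J (cConj p q) = cConj p q" if "p \<in> elts Form" "q \<in> elts Form" "J p = p" "J q = q" for p q using J_tm2[OF t(4)] that by simp
  show "J (cEx a p) = cEx a p" if "a \<in> elts omega" "p \<in> elts Form" "J p = p" for a p using J_tm2[OF t(5)] that by simp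
qed

lemma J_V: "Ord \<alpha> \<Longrightarrow> J (Vlev \<alpha>) = Vlev (J \<alpha>)"
  using J_tm1[OF tm_Vz0, of \<alpha>] Ord_sets[of \<alpha>] J_Ord[of \<alpha>] by simp

section \<open>The critical point\<close>

text \<open>If \<beta> were least with \<open>J \<beta> \<in> elts \<beta>\<close>, applying
  \<open>J\<close> would show the same of the smaller ordinal \<open>J \<beta>\<close>.\<close>

lemma J_increasing:
  assumes "Ord \<alpha>"
  shows "elts \<alpha> \<subseteq> elts (J \<alpha>)"
proof (rule ccontr)
  assume "\<not> elts \<alpha> \<subseteq> elts (J \<alpha>)"
  then have "J \<alpha> \<in> elts \<alpha>" using Ord_not_mem_iff[of "J \<alpha>" \<alpha>] assms J_Ord Ord_sets by blast
  moreover have d: "dfn UNIV (\<lambda>e. J (e 0) \<in> elts (e 0))" by (intro dfn_mem tm_J tm_var)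
  ultimately obtain \<beta> where \<beta>: "Ord \<beta>" "J \<beta> \<in> elts \<beta>" "\<And>\<gamma>. \<gamma> \<in> elts \<beta> \<Longrightarrow> J \<gamma> \<notin> elts \<gamma>"
    using leastO(1-3)[OF d assms] by blast
  then show False using J_memI[OF Ord_sets[OF \<beta>(1)] \<beta>(2)] by blast
qed

text \<open>If all ordinals were fixed, so would be all levels. A moved set \<open>y\<close> in the
  least possible level has fixed elements, and so has \<open>J y\<close>, which is included in the
  same earlier level; hence both have the same elements.\<close>

lemma moved_ordinal: "\<exists>\<alpha>. Ord \<alpha> \<and> J \<alpha> \<noteq> \<alpha>"
proof (rule ccontr)
  assume "\<not> (\<exists>\<alpha>. Ord \<alpha> \<and> J \<alpha> \<noteq> \<alpha>)"
  then have fx: "J \<alpha> = \<alpha>" if "Ord \<alpha>" for \<alpha> using that by blast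
  obtain x where x: "x \<in> sets" "J x \<noteq> x" using nontrivial unfolding nontrivial_V_def J_def by blast
  obtain \<alpha> where \<alpha>: "Ord \<alpha>" "x \<in> elts (Vlev \<alpha>)" using ex_V[OF x(1)] by blast
  define P where "P \<alpha> \<longleftrightarrow> (\<exists>x\<in>elts (Vz \<alpha>). J x \<noteq> x)" for \<alpha>
  have d: "dfn UNIV (\<lambda>e. P (e 0))" unfolding P_def by (intro dfn_bex dfn_neg dfn_eq tm_J' dfn_intros)
  have "P \<alpha>" unfolding P_def using \<alpha> x by auto
  then obtain \<beta> where \<beta>: "Ord \<beta>" "P \<beta>" "\<And>\<gamma>. \<gamma> \<in> elts \<beta> \<Longrightarrow> \<not> P \<gamma>" using leastO(1-3)[OF d \<alpha>(1)] by blast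
  then obtain y where y: "y \<in> elts (Vlev \<beta>)" "J y \<noteq> y" unfolding P_def by auto
  then obtain \<gamma> where \<gamma>: "\<gamma> \<in> elts \<beta>" "elts y \<subseteq> elts (Vlev \<gamma>)" "y \<in> sets" using elts_Vlev[OF \<beta>(1)] by blast
  have og: "Ord \<gamma>" using \<gamma> Ord_in[OF \<beta>(1)] by blast
  have fixV: "J z = z" if "z \<in> elts (Vlev \<gamma>)" for z using \<beta>(3)[OF \<gamma>(1)] that og unfolding P_def by auto
  have "elts (J y) \<subseteq> elts (J (Vlev \<gamma>))" using J_subset[OF \<gamma>(3) Vlev_sets[OF og]] \<gamma>(2) by blast
  then have sub: "elts (J y) \<subseteq> elts (Vlev \<gamma>)" using J_V[OF og] fx[OF og] by simp
  have "elts (J y) = elts y"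
  proof (intro equalityI subsetI)
    fix z assume z: "z \<in> elts (J y)"
    then have "J z = z" "z \<in> sets" using sub fixV elts_sets by blast+
    then show "z \<in> elts y" using J_mem[of z y] z \<gamma>(3) by simp
  next
    fix z assume z: "z \<in> elts y"
    then have "J z = z" using \<gamma>(2) fixV by blast
    then show "z \<in> elts (J y)" using J_memI[OF \<gamma>(3) z] by simp
  qed
  then show False using y(2) extensionality by blast
qed

definition \<kappa> :: 'a where "\<kappa> = leastO (\<lambda>\<alpha>. J \<alpha> \<noteq> \<alpha>)"

lemma \<kappa>: "Ord \<kappa>" "J \<kappa> \<noteq> \<kappa>" "\<And>\<beta>. \<beta> \<in> elts \<kappa> \<Longrightarrow> J \<beta> = \<beta>"
proof -
  have d: "dfn UNIV (\<lambda>e. J (e 0) \<noteq> e 0)" by (intro dfn_neg dfn_eq tm_J tm_var)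
  obtain \<alpha> where \<alpha>: "Ord \<alpha>" "J \<alpha> \<noteq> \<alpha>" using moved_ordinal by blast
  note L = leastO(1-3)[where P = "\<lambda>\<alpha>. J \<alpha> \<noteq> \<alpha>", OF d \<alpha>]
  show "Ord \<kappa>" "J \<kappa> \<noteq> \<kappa>" "\<And>\<beta>. \<beta> \<in> elts \<kappa> \<Longrightarrow> J \<beta> = \<beta>" using L unfolding \<kappa>_def by blast+
qed

lemma \<kappa>_sets [simp]: "\<kappa> \<in> sets" using \<kappa>(1) Ord_sets by blast

lemma crit_j: "crit j Univ = \<kappa>"
  unfolding crit_def
proof (rule the_equality)
  show "\<kappa> \<in> elts Univ \<and> Ord \<kappa> \<and> app j \<kappa> \<noteq> \<kappa> \<and> (\<forall>\<beta>\<in>elts \<kappa>. \<beta> \<in> elts Univ \<longrightarrow> app j \<beta> = \<beta>)"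
    using \<kappa> by (simp add: J_def)
  fix \<alpha> assume a: "\<alpha> \<in> elts Univ \<and> Ord \<alpha> \<and> app j \<alpha> \<noteq> \<alpha> \<and> (\<forall>\<beta>\<in>elts \<alpha>. \<beta> \<in> elts Univ \<longrightarrow> app j \<beta> = \<beta>)"
  then have "\<forall>\<beta>\<in>elts \<alpha>. J \<beta> = \<beta>" using elts_sets unfolding J_def by simp
  moreover have "Ord \<alpha>" "J \<alpha> \<noteq> \<alpha>" using a unfolding J_def by auto
  ultimately show "\<alpha> = \<kappa>" using least_unique[of \<alpha> "\<lambda>\<alpha>. J \<alpha> \<noteq> \<alpha>" \<kappa>] \<kappa> by blast
qed

lemma \<kappa>_moved: "\<kappa> \<in> elts (J \<kappa>)"
  using Ord_subset_iff[OF \<kappa>(1), of "J \<kappa>"] J_increasing[OF \<kappa>(1)] J_Ord \<kappa> by auto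

lemma omega_in_\<kappa>: "omega \<in> elts \<kappa>"
proof -
  have "omega \<noteq> \<kappa>" using \<kappa>(2) J_omega by metis
  moreover have "\<kappa> \<notin> elts omega" using \<kappa>(2) J_omega_in by metis
  ultimately show ?thesis using Ord_linear[OF Ord_omega \<kappa>(1)] by blast
qed

text \<open>Ordinals below \<kappa> are fixed, and from \<kappa> on the values are at least
  \<open>J \<kappa>\<close>, which exceeds \<kappa>.\<close>

lemma \<kappa>_not_J: "Ord y \<Longrightarrow> J y \<noteq> \<kappa>"
proof
  assume y: "Ord y" "J y = \<kappa>"
  show False
  proof (cases "y \<in> elts \<kappa>")
    case True
    then show ?thesis using \<kappa>(3)[of y] y mem_irrefl by auto
  next
    case False
    then have "elts \<kappa> \<subseteq> elts y" using Ord_not_mem_iff[OF y(1) \<kappa>(1)] by blast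
    then have "elts (J \<kappa>) \<subseteq> elts \<kappa>" using J_subset[of \<kappa> y] y Ord_sets by auto
    then show ?thesis using \<kappa>_moved mem_irrefl by blast
  qed
qed

text \<open>For \<open>g\<close> from omega into \<kappa>, \<open>J g\<close> has the same values,
  as \<open>J\<close> moves neither arguments nor values. So \<kappa> bounds \<open>J g\<close>
  below \<open>J \<kappa>\<close>, and elementarity gives a bound for \<open>g\<close> below
  \<kappa>.\<close>

lemma \<kappa>_regular: "omega_regular \<kappa>"
  unfolding omega_regular_def
proof (intro conjI ballI impI)
  show "Ord \<kappa>" by (rule \<kappa>)
  show "empty \<in> elts \<kappa>" using Ord_trans[OF \<kappa>(1) empty_omega omega_in_\<kappa>] .
  fix g assume g: "g \<in> sets" "is_fun g omega \<kappa>"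
  define Q where "Q g k \<longleftrightarrow> (\<exists>\<delta>\<in>elts k. \<forall>m\<in>elts omega. \<exists>y\<in>elts \<delta>. opair m y \<in> elts g)" for g k
  have dQ: "dfn Fixed (\<lambda>e. Q (e 0) (e (Suc 0)))" unfolding Q_def by (intro dfn_intros)
  note Jg = J_fun[OF g(1) omega_sets is_fun_Univ[OF g(2)]]
  have "\<exists>y\<in>elts \<kappa>. opair m y \<in> elts (J g)" if m: "m \<in> elts omega" for m
  proof -
    have gm: "app g m \<in> elts \<kappa>" using is_fun_app(1)[OF g(2) m] .
    have "app (J g) m = app g m" using Jg(2)[OF m] \<kappa>(3)[OF gm] m by simp
    moreover have "opair m (app (J g) m) \<in> elts (J g)" by (rule is_fun_app(2)[OF Jg(1)]) (simp add: m)
    ultimately have "opair m (app g m) \<in> elts (J g)" by simp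
    then show ?thesis using gm by blast
  qed
  then have "Q (J g) (J \<kappa>)" unfolding Q_def using \<kappa>_moved by blast
  then have "Q g \<kappa>" using elementarity2[of Q, OF dQ g(1) \<kappa>_sets] by blast
  then obtain \<delta> where \<delta>: "\<delta> \<in> elts \<kappa>" "\<forall>m\<in>elts omega. \<exists>y\<in>elts \<delta>. opair m y \<in> elts g" unfolding Q_def by blast
  have "app g m \<in> elts \<delta>" if m: "m \<in> elts omega" for m
  proof -
    obtain y where y: "y \<in> elts \<delta>" "opair m y \<in> elts g" using \<delta>(2) m by blast
    have "y = app g m" using is_fun_iff[OF g(2), of m y] y m elts_sets[OF y(1)] by simp
    then show ?thesis using y by simp
  qed
  then show "\<exists>\<delta>\<in>elts \<kappa>. \<forall>m\<in>elts omega. app g m \<in> elts \<delta>" using \<delta> by blast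
qed

lemma J_bij:
  assumes "f \<in> sets" "\<alpha> \<in> sets" "\<beta> \<in> sets" "is_bij f \<alpha> \<beta>"
  shows "is_bij (J f) (J \<alpha>) (J \<beta>)"
  using elementarity3[of is_bij, OF dfn_is_bij0 assms(1-3)] assms(4) by blast

text \<open>Since \<open>J\<close> fixes \<alpha> and its elements, every element of
  \<open>J \<beta>\<close> has the form \<open>J (app f x)\<close>; but \<kappa> is no such value.
  Applied to \<beta> = \<kappa> and to \<beta> = \<open>lambda\<close>, this shows that neither is
  collapsed below \<kappa>.\<close>

lemma fixed_bij_range:
  assumes "f \<in> sets" "\<alpha> \<in> elts \<kappa>" "Ord \<beta>" "is_bij f \<alpha> \<beta>"
  shows "\<kappa> \<notin> elts (J \<beta>)"
proof
  assume k: "\<kappa> \<in> elts (J \<beta>)"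
  have s: "\<alpha> \<in> sets" "\<beta> \<in> sets" using assms elts_sets Ord_sets by auto
  have b: "is_bij (J f) \<alpha> (J \<beta>)" using J_bij[OF assms(1) s assms(4)] \<kappa>(3)[OF assms(2)] by simp
  obtain x where x: "x \<in> elts \<alpha>" "app (J f) x = \<kappa>" by (rule bij_app[OF b k])
  have f: "is_fun f \<alpha> \<beta>" using assms(4) unfolding is_bij_def by blast
  have "J x = x" using \<kappa>(3) Ord_trans[OF \<kappa>(1) x(1) assms(2)] by blast
  then have "J (app f x) = \<kappa>" using J_fun(2)[OF assms(1) s(1) is_fun_Univ[OF f] x(1)] x(2) by simp
  moreover have "Ord (app f x)" using is_fun_app(1)[OF f x(1)] Ord_in[OF assms(3)] by blast
  ultimately show False using \<kappa>_not_J by blast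
qed

lemma Card_\<kappa>: "Card \<kappa>"
  unfolding Card_def using \<kappa>(1) fixed_bij_range[OF _ _ \<kappa>(1)] \<kappa>_moved by blast

section \<open>The critical sequence\<close>

lemma L_ex: "\<exists>\<Phi>. tm UNIV (\<lambda>e. \<Phi> (e 0)) \<and> \<Phi> empty = \<kappa> \<and> (\<forall>m\<in>elts omega. \<Phi> (succ m) = J (\<Phi> m))"
proof -
  \<comment> \<open>\<open>bigU\<close> reads off the predecessor and \<open>appz\<close> is
    application made total, so that \<open>G\<close> is a term on all pairs of sets. At 0 the value
    is the critical point.\<close>
  define G where "G x f = (if x = empty then \<kappa> else J (appz f (bigU x)))" for x f
  have tG: "tm UNIV (\<lambda>e. G (e 0) (e (Suc 0)))" unfolding G_def
    by (intro tm_if dfn_eq tm_empty tm_UNIV_const \<kappa>_sets tm_J' tm_subst2[where f = appz, OF _ _ tm_appz0] tm_bigU tm_var)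
  obtain \<Phi> where \<Phi>: "tm UNIV (\<lambda>e. \<Phi> (e 0))" "\<And>x. x \<in> sets \<Longrightarrow> \<Phi> x = G x (lam (tc x) \<Phi>)"
    by (rule recursion[OF tG]) (rule that)
  have "\<Phi> empty = \<kappa>" using \<Phi>(2)[of empty] by (simp add: G_def)
  moreover have "\<Phi> (succ m) = J (\<Phi> m)" if m: "m \<in> elts omega" for m
  proof -
    have om: "Ord m" using Ord_omega_in[OF m] .
    have ms: "succ m \<in> sets" "m \<in> sets" using m by auto
    have U: "\<Phi> x \<in> elts Univ" if "x \<in> elts (succ m)" for x using tm_app1_sets[OF \<Phi>(1) elts_sets[OF that]] by simp
    note lf = lam_fun[OF \<Phi>(1) ms(1) U] lam_aux(1)[OF \<Phi>(1) ms(1)]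
    have "appz (lam (succ m) \<Phi>) m = \<Phi> m" using appz_eq[OF lf(3,1)] lf(2) ms by simp
    then show ?thesis using \<Phi>(2)[OF ms(1)] tc_Ord[OF Ord_succ[OF om]] bigU_succ[OF om] ms by (simp add: G_def)
  qed
  ultimately show ?thesis using \<Phi>(1) by blast
qed

text \<open>\<open>SOME\<close> only picks a name: the values on \<open>omega\<close> are
  determined, those elsewhere are irrelevant. Keeping a term besides the set \<open>l\<close> allows
  the sequence to occur in definable properties.\<close>

definition L :: "'a \<Rightarrow> 'a" where
  "L = (SOME \<Phi>. tm UNIV (\<lambda>e. \<Phi> (e 0)) \<and> \<Phi> empty = \<kappa> \<and> (\<forall>m\<in>elts omega. \<Phi> (succ m) = J (\<Phi> m)))"

lemma L: "tm UNIV (\<lambda>e. L (e 0))" "L empty = \<kappa>" "\<And>m. m \<in> elts omega \<Longrightarrow> L (succ m) = J (L m)"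
  using someI_ex[OF L_ex] unfolding L_def by blast+

lemmas tm_L = tm_subst1[where f = L, OF _ L(1)]

lemma L_sets [simp]: "m \<in> sets \<Longrightarrow> L m \<in> sets" using tm_app1_sets[OF L(1)] .

definition l :: 'a where "l = lam omega L"

lemma l: "l \<in> sets" "is_fun l omega Univ" "\<And>m. m \<in> elts omega \<Longrightarrow> app l m = L m"
  unfolding l_def using lam_aux(1)[OF L(1) omega_sets] lam_fun[OF L(1) omega_sets, of Univ] by auto

lemma critical_sequence_eq: "critical_sequence j = l"
  unfolding critical_sequence_def
proof (rule the_equality)
  show "l \<in> sets \<and> is_fun l omega Univ \<and> app l empty = crit j Univ \<and> (\<forall>m\<in>elts omega. app l (succ m) = app j (app l m))"
    using l L by (simp add: crit_j J_def[symmetric])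
  fix f assume f: "f \<in> sets \<and> is_fun f omega Univ \<and> app f empty = crit j Univ \<and> (\<forall>m\<in>elts omega. app f (succ m) = app j (app f m))"
  have mem: "opair m (L m) \<in> elts f \<longleftrightarrow> app f m = L m" if "m \<in> elts omega" for m
    using is_fun_iff[of f omega Univ m "L m"] f that by auto
  \<comment> \<open>Uniqueness is again an internal induction, stated through the graph of
    \<open>f\<close> so that the property is definable.\<close>
  have "opair m (L m) \<in> elts f" if "m \<in> elts omega" for m
  proof (rule omega_induct[of "\<lambda>m. opair m (L m) \<in> elts f", OF _ _ _ that])
    show "dfn UNIV (\<lambda>e. opair (e 0) (L (e 0)) \<in> elts f)"
      by (intro dfn_mem tm_opair L tm_var tm_UNIV_const conjunct1[OF f])
    show "opair empty (L empty) \<in> elts f" using mem[of empty] f L by (simp add: crit_j)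
    fix m assume m: "m \<in> elts omega" "opair m (L m) \<in> elts f"
    then show "opair (succ m) (L (succ m)) \<in> elts f" using mem[of m] mem[of "succ m"] f L by (simp add: J_def[symmetric])
  qed
  then show "f = l" using fun_ext[of f omega Univ l Univ] f l mem by simp
qed

definition mu :: 'a where "mu = lam omega (\<lambda>m. L (succ m))"

lemma tm_Lsucc: "tm UNIV (\<lambda>e. L (succ (e 0)))" by (intro tm_L dfn_intros)

lemma mu: "mu \<in> sets" "is_fun mu omega Univ" "\<And>m. m \<in> elts omega \<Longrightarrow> app mu m = L (succ m)"
  unfolding mu_def using lam_aux(1)[OF tm_Lsucc omega_sets] lam_fun[OF tm_Lsucc omega_sets, of Univ] by auto

lemma seq_shift_l: "seq_shift l = mu"
proof -
  have "(\<lambda>p. \<exists>m\<in>elts omega. p = opair m (app l (succ m))) = (\<lambda>p. \<exists>m\<in>elts omega. p = opair m (L (succ m)))"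
    using l(3) by (intro ext bex_cong) simp_all
  then show ?thesis unfolding seq_shift_def mu_def lam_def by simp
qed

text \<open>At \<open>m\<close>, which is fixed, \<open>J l\<close> takes the value
  \<open>J (L m)\<close>, the next member of the critical sequence.\<close>

lemma J_l: "J l = mu"
proof (rule fun_ext)
  show "is_fun (J l) omega Univ" using J_fun(1)[OF l(1) omega_sets l(2)] by simp
  show "is_fun mu omega Univ" by (rule mu)
  fix m assume m: "m \<in> elts omega"
  show "app (J l) m = app mu m" using J_fun(2)[OF l(1) omega_sets l(2) m] l(3)[OF m] mu(3)[OF m] L(3)[OF m] m by simp
qed

lemma L_Card: "m \<in> elts omega \<Longrightarrow> Card (L m)"
  by (rule omega_induct[of "\<lambda>m. Card (L m)"], intro dfn_Card L(1)) (simp_all add: L Card_\<kappa> J_Card)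

lemma L_Ord: "m \<in> elts omega \<Longrightarrow> Ord (L m)"
  using L_Card unfolding Card_def by blast

lemma L_succ: "m \<in> elts omega \<Longrightarrow> L m \<in> elts (L (succ m))"
  by (rule omega_induct[of "\<lambda>m. L m \<in> elts (L (succ m))"], intro dfn_mem tm_Lsucc L(1))
     (simp_all add: L \<kappa>_moved J_mem)

lemma L_mono: "m \<in> elts omega \<Longrightarrow> i \<in> elts m \<Longrightarrow> L i \<in> elts (L m)"
proof -
  assume m: "m \<in> elts omega" "i \<in> elts m"
  have "\<forall>i\<in>elts m. L i \<in> elts (L m)"
  proof (rule omega_induct[of "\<lambda>m. \<forall>i\<in>elts m. L i \<in> elts (L m)", OF _ _ _ m(1)])
    show "dfn UNIV (\<lambda>e. \<forall>i\<in>elts (e 0). L i \<in> elts (L (e 0)))" by (intro dfn_ball dfn_mem tm_L tm_var)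
    fix m assume m: "m \<in> elts omega" "\<forall>i\<in>elts m. L i \<in> elts (L m)"
    show "\<forall>i\<in>elts (succ m). L i \<in> elts (L (succ m))"
      using m L_succ[OF m(1)] Ord_trans[OF L_Ord[OF succ_omega[OF m(1)]], of _ "L m"] by auto
  qed simp
  then show ?thesis using m by blast
qed

definition lambda :: 'a where "lambda = seq_sup mu"

lemma lambda_aux: "lambda \<in> sets \<and> elts lambda = (\<Union>m\<in>elts omega. elts (L m)) \<and> Ord lambda"
proof -
  obtain b where b: "b \<in> sets" "elts b = L ` elts omega" using replacement_fun[OF L(1) omega_sets] by blast
  have E: "elts (bigU b) = (\<Union>m\<in>elts omega. elts (L m))" using b by simp
  have "(\<Union>m\<in>elts omega. elts (L m)) = {x \<in> sets. \<exists>m\<in>elts omega. x \<in> elts (app mu m)}"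
  proof (intro equalityI subsetI)
    fix x assume "x \<in> (\<Union>m\<in>elts omega. elts (L m))"
    then obtain m where m: "m \<in> elts omega" "x \<in> elts (L m)" by blast
    then have "x \<in> elts (L (succ m))" using Ord_trans[OF L_Ord[OF succ_omega[OF m(1)]] m(2) L_succ[OF m(1)]] by blast
    then have "x \<in> elts (app mu m)" using mu(3)[OF m(1)] by simp
    then show "x \<in> {x \<in> sets. \<exists>m\<in>elts omega. x \<in> elts (app mu m)}" using m(1) elts_sets by blast
  next
    fix x assume "x \<in> {x \<in> sets. \<exists>m\<in>elts omega. x \<in> elts (app mu m)}"
    then obtain m where "m \<in> elts omega" "x \<in> elts (app mu m)" by blast
    then show "x \<in> (\<Union>m\<in>elts omega. elts (L m))" using mu(3) succ_omega by auto
  qed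
  then have "seq_sup mu = bigU b" unfolding seq_sup_def using E by (intro Coll_eq) simp
  moreover have "Ord (bigU b)" by (rule Ord_bigU) (use b L_Ord in auto)
  ultimately show ?thesis using b E unfolding lambda_def by simp
qed

lemma lambda: "lambda \<in> sets" "elts lambda = (\<Union>m\<in>elts omega. elts (L m))" "Ord lambda"
  using lambda_aux by auto

text \<open>\<open>R\<close> says that the first argument is the supremum of the second. It carries
  \<open>lambda\<close>, the supremum of \<open>l\<close>, to \<open>J lambda\<close>, the supremum
  of \<open>mu\<close>; both sequences have the same supremum.\<close>

lemma J_lambda: "J lambda = lambda"
proof -
  define R where "R S f \<longleftrightarrow> (\<forall>x\<in>sets. x \<in> elts S \<longleftrightarrow> (\<exists>m\<in>elts omega. \<exists>y\<in>sets. opair m y \<in> elts f \<and> x \<in> elts y))" for S f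
  have dR: "dfn Fixed (\<lambda>e. R (e 0) (e (Suc 0)))" unfolding R_def by (intro dfn_intros)
  have ml: "opair m y \<in> elts l \<longleftrightarrow> y = L m" "opair m y \<in> elts mu \<longleftrightarrow> y = L (succ m)" if "m \<in> elts omega" "y \<in> sets" for m y
    using is_fun_iff[OF l(2), of m y] is_fun_iff[OF mu(2), of m y] l(3) mu(3) that by auto
  have "R lambda l" unfolding R_def lambda(2) using ml(1) by auto
  then have "R (J lambda) mu" using elementarity2[of R, OF dR lambda(1) l(1)] J_l by simp
  then have "x \<in> elts (J lambda) \<longleftrightarrow> (\<exists>m\<in>elts omega. x \<in> elts (L (succ m)))" if "x \<in> sets" for x
    unfolding R_def using ml(2) that by auto
  moreover have "x \<in> elts lambda \<longleftrightarrow> (\<exists>m\<in>elts omega. x \<in> elts (L (succ m)))" for x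
  proof
    assume "x \<in> elts lambda"
    then obtain m where m: "m \<in> elts omega" "x \<in> elts (L m)" using lambda(2) by blast
    then have "x \<in> elts (L (succ m))" using Ord_trans[OF L_Ord[OF succ_omega[OF m(1)]] m(2) L_succ[OF m(1)]] by blast
    then show "\<exists>m\<in>elts omega. x \<in> elts (L (succ m))" using m by blast
  next
    assume "\<exists>m\<in>elts omega. x \<in> elts (L (succ m))"
    then show "x \<in> elts lambda" using lambda(2) succ_omega by auto
  qed
  ultimately have "elts (J lambda) = elts lambda" using elts_sets by blast
  then show ?thesis by (rule extensionality)
qed

lemma lambda_Fixed: "lambda \<in> Fixed" using J_lambda lambda(1) by (simp add: Fixed_def)

lemma L_in_lambda: "m \<in> elts omega \<Longrightarrow> L m \<in> elts lambda"
  using L_succ[of m] succ_omega[of m] lambda(2) by auto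

lemma \<kappa>_in_lambda: "\<kappa> \<in> elts lambda"
  using L_in_lambda[OF empty_omega] L(2) by simp

text \<open>A fixed ordinal that is at least \<kappa> is, by repeated application of
  \<open>J\<close>, at least every \<open>L m\<close>, hence at least \<open>lambda\<close>.\<close>

lemma fixed_below_lambda:
  assumes "\<alpha> \<in> elts lambda" "J \<alpha> = \<alpha>"
  shows "\<alpha> \<in> elts \<kappa>"
proof (rule ccontr)
  assume n: "\<alpha> \<notin> elts \<kappa>"
  have oa: "Ord \<alpha>" "\<alpha> \<in> sets" using assms(1) Ord_in[OF lambda(3)] elts_sets by auto
  have "elts (L m) \<subseteq> elts \<alpha>" if "m \<in> elts omega" for m
  proof (rule omega_induct[of "\<lambda>m. elts (L m) \<subseteq> elts \<alpha>", OF _ _ _ that])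
    show "dfn UNIV (\<lambda>e. elts (L (e 0)) \<subseteq> elts \<alpha>)" by (intro dfn_subset L(1) tm_UNIV_const oa)
    show "elts (L empty) \<subseteq> elts \<alpha>" using n Ord_not_mem_iff[OF oa(1) \<kappa>(1)] L(2) by simp
    fix m assume m: "m \<in> elts omega" "elts (L m) \<subseteq> elts \<alpha>"
    then show "elts (L (succ m)) \<subseteq> elts \<alpha>" using J_subset[of "L m" \<alpha>] oa assms(2) L(3)[OF m(1)] by simp
  qed
  then have "elts lambda \<subseteq> elts \<alpha>" using lambda(2) by blast
  then show False using assms(1) mem_irrefl by blast
qed

text \<open>
  The least ordinal equinumerous with \<open>\<lambda>\<close> is definable from \<open>\<lambda>\<close>, hence fixed by \<open>j\<close>; if it were
  below \<open>\<lambda>\<close> it would be below the critical point.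
\<close>

lemma Card_lambda: "Card lambda"
proof (rule ccontr)
  assume "\<not> Card lambda"
  then obtain \<alpha> where \<alpha>: "\<alpha> \<in> elts lambda" "\<exists>f\<in>sets. is_bij f \<alpha> lambda" unfolding Card_def using lambda(3) by blast
  define P where "P \<alpha> \<longleftrightarrow> (\<exists>f\<in>sets. is_bij f \<alpha> lambda)" for \<alpha>
  have dP: "dfn Fixed (\<lambda>e. P (e 0))" unfolding P_def by (intro dfn_intros tm_Fixed_const lambda_Fixed)
  have oa: "Ord \<alpha>" using \<alpha>(1) Ord_in[OF lambda(3)] by blast
  note least = leastO[of P, OF dfn_mono[OF dP subset_UNIV] oa \<alpha>(2)[folded P_def]]
  have "leastO P \<in> Fixed"
  proof (rule tm_Fixed)
    show "tm Fixed (\<lambda>e. leastO P)" by (rule tm_leastO) (rule dP)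
  qed
  then have J: "J (leastO P) = leastO P" using Fixed_J by blast
  have "leastO P = \<alpha> \<or> leastO P \<in> elts \<alpha>" using least(4)[OF oa \<alpha>(2)[folded P_def]] Ord_subset_iff[OF least(1) oa] by blast
  then have "leastO P \<in> elts lambda" using \<alpha>(1) Ord_trans[OF lambda(3)] by auto
  then have k: "leastO P \<in> elts \<kappa>" using fixed_below_lambda J by blast
  obtain f where "f \<in> sets" "is_bij f (leastO P) lambda" using least(2) unfolding P_def by blast
  \<comment> \<open>Such a bijection would exclude \<kappa> from \<open>J lambda\<close>, which
    equals \<open>lambda\<close>.\<close>
  then show False using fixed_bij_range[OF _ k lambda(3)] J_lambda \<kappa>_in_lambda by simp
qed

lemma limit_Card_lambda: "limit_Card lambda"
  unfolding limit_Card_def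
proof (intro conjI ballI)
  show "Card lambda" by (rule Card_lambda)
  show "lambda \<noteq> empty" using \<kappa>_in_lambda by auto
  fix \<alpha> assume "\<alpha> \<in> elts lambda"
  then obtain m where m: "m \<in> elts omega" "\<alpha> \<in> elts (L m)" using lambda(2) by blast
  then show "\<exists>\<mu>\<in>elts lambda. Card \<mu> \<and> \<alpha> \<in> elts \<mu>" using L_in_lambda L_Card by blast
qed

section \<open>Reflecting the embedding\<close>

text \<open>Both classes are requested because one level will serve as \<eta> and as \<zeta>. That
  \<eta> is a limit leaves room above \<open>lambda\<close> for the restricted embedding as an
  element of \<open>V_\<eta>\<close>.\<close>

lemma fixed_level:
  obtains \<eta> where "\<eta> \<in> Fixed" "Limit \<eta>" "lambda \<in> elts \<eta>" "C_class n \<eta>" "C_class (n + 1) \<eta>"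
proof -
  define P where "P \<eta> \<longleftrightarrow> Limit \<eta> \<and> lambda \<in> elts \<eta> \<and> C_class n \<eta> \<and> C_class (n + 1) \<eta>" for \<eta>
  have dP: "dfn Fixed (\<lambda>e. P (e 0))" unfolding P_def by (intro dfn_intros tm_Fixed_const lambda_Fixed)
  obtain \<nu> where "Limit \<nu>" "lambda \<in> elts \<nu>" "\<And>i. i \<le> n + 1 \<Longrightarrow> C_class i \<nu>"
    by (rule C_class_unbounded[OF \<kappa>_regular lambda(3), where n = "n + 1"]) (rule that)
  then have "P \<nu>" "Ord \<nu>" unfolding P_def using Limit_Ord by simp_all
  then have "P (leastO P)" using leastO(2)[of P, OF dfn_mono[OF dP subset_UNIV]] by blast
  moreover have "leastO P \<in> Fixed"
  proof (rule tm_Fixed)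
    show "tm Fixed (\<lambda>e. leastO P)" by (rule tm_leastO) (rule dP)
  qed
  ultimately show ?thesis using that unfolding P_def by blast
qed

text \<open>
  The definition of ultraexact embeddings uses \<open>app\<close>, \<open>crit\<close> and \<open>comp\<close>, which are not definable where they
  take junk values; \<open>reflect\<close> is a relational substitute to which elementarity applies.
\<close>

definition comp_rel :: "'a \<Rightarrow> 'a \<Rightarrow> 'a \<Rightarrow> bool" where
  "comp_rel c k s \<longleftrightarrow> (\<forall>q\<in>sets. q \<in> elts c \<longleftrightarrow>
     (\<exists>a\<in>elts omega. \<exists>y\<in>sets. \<exists>z\<in>sets. opair a y \<in> elts s \<and> opair y z \<in> elts k \<and> q = opair a z))"

text \<open>On a genuine assignment the relational composite exists and is unique, so the quantifier
  over \<open>c\<close> in \<open>emb_rel\<close> says the same as a direct use of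
  \<open>comp\<close>.\<close>

lemma comp_facts:
  assumes k: "k \<in> sets" "is_fun k X M" and s: "assignment X s"
  shows "comp k s \<in> sets" "is_fun (comp k s) omega M" "\<And>a. a \<in> elts omega \<Longrightarrow> app (comp k s) a = app k (app s a)"
    "\<And>c. c \<in> sets \<Longrightarrow> comp_rel c k s \<longleftrightarrow> c = comp k s"
proof -
  have ss: "s \<in> sets" "is_fun s omega X" using s unfolding assignment_def by auto
  define Q where "Q a q \<longleftrightarrow> (\<exists>y\<in>sets. \<exists>z\<in>sets. opair a y \<in> elts s \<and> opair y z \<in> elts k \<and> q = opair a z)" for a q
  have Q: "Q a q \<longleftrightarrow> q = opair a (app k (app s a))" if a: "a \<in> elts omega" for a q
  proof -
    have sa: "app s a \<in> elts X" "app s a \<in> sets" using is_fun_app(1,3)[OF ss(2) a] by auto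
    have ka: "app k (app s a) \<in> sets" using is_fun_app(3)[OF k(2) sa(1)] .
    have "opair a y \<in> elts s \<longleftrightarrow> y = app s a" if "y \<in> sets" for y using is_fun_iff[OF ss(2) omega_in_sets[OF a] that] a by simp
    moreover have "opair (app s a) z \<in> elts k \<longleftrightarrow> z = app k (app s a)" if "z \<in> sets" for z
      using is_fun_iff[OF k(2) sa(2) that] sa(1) by simp
    ultimately show ?thesis unfolding Q_def using sa ka by auto
  qed
  have dQ: "dfn UNIV (\<lambda>e. Q (e 0) (e (Suc 0)))" unfolding Q_def by (intro dfn_intros tm_UNIV_const k ss)
  have "\<exists>b\<in>sets. elts b = {q \<in> sets. \<exists>a\<in>elts omega. Q a q}"
    by (rule replacement_rel[OF dQ omega_sets]) (simp add: Q)
  then obtain b where b: "b \<in> sets" "elts b = {q \<in> sets. \<exists>a\<in>elts omega. Q a q}" by blast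
  have "comp k s = b" unfolding comp_def
    by (rule Coll_eq) (unfold b(2), use Q in auto)
  then have c: "comp k s \<in> sets" "elts (comp k s) = {q \<in> sets. \<exists>a\<in>elts omega. Q a q}" using b by auto
  show "comp k s \<in> sets" by (rule c)
  have ka: "app k (app s a) \<in> elts M" if "a \<in> elts omega" for a
    using is_fun_app(1)[OF k(2) is_fun_app(1)[OF ss(2) that]] .
  have "opair a (app k (app s a)) \<in> sets" if "a \<in> elts omega" for a using elts_sets[OF ka[OF that]] that by simp
  then have im: "elts (comp k s) = (\<lambda>a. opair a (app k (app s a))) ` elts omega"
    unfolding c(2) using Q by auto
  show "is_fun (comp k s) omega M" "\<And>a. a \<in> elts omega \<Longrightarrow> app (comp k s) a = app k (app s a)"
    using is_funI[OF im ka] by blast+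
  fix c' assume "c' \<in> sets"
  have "comp_rel c' k s \<longleftrightarrow> (\<forall>q\<in>sets. q \<in> elts c' \<longleftrightarrow> q \<in> elts (comp k s))"
    unfolding comp_rel_def c(2) Q_def by simp
  also have "\<dots> \<longleftrightarrow> elts c' = elts (comp k s)" using elts_sets by blast
  finally show "comp_rel c' k s \<longleftrightarrow> c' = comp k s" using extensionality by blast
qed

definition emb_rel :: "'a \<Rightarrow> 'a \<Rightarrow> bool" where
  "emb_rel k W \<longleftrightarrow> is_fun k W W \<and> (\<forall>p\<in>elts Form. \<forall>s\<in>sets. assignment W s \<longrightarrow>
     (\<exists>c\<in>sets. comp_rel c k s \<and> (Sat W p s \<longleftrightarrow> Sat W p c)))"

lemma dfn_emb_rel0: "dfn K (\<lambda>e. emb_rel (e 0) (e (Suc 0)))"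
  unfolding emb_rel_def comp_rel_def by (intro dfn_intros)

lemma emb_rel_iff: "k \<in> sets \<Longrightarrow> emb_rel k W \<longleftrightarrow> elementary_embedding k W W"
proof -
  assume k: "k \<in> sets"
  have *: "(\<exists>c\<in>sets. comp_rel c k s \<and> (Sat W p s \<longleftrightarrow> Sat W p c)) \<longleftrightarrow> (Sat W p s \<longleftrightarrow> Sat W p (comp k s))"
    if "is_fun k W W" "assignment W s" for p s
    using comp_facts(1,4)[OF k that] by auto
  have all: "(\<forall>s. assignment W s \<longrightarrow> X s) \<longleftrightarrow> (\<forall>s\<in>sets. assignment W s \<longrightarrow> X s)" for X
    using assignment_sets by blast
  show ?thesis unfolding emb_rel_def elementary_embedding_def all
    by (intro conj_cong ball_cong imp_cong refl *)
qed

text \<open>\<open>W\<close> and \<open>lambda\<close> are fixed parameters; the other three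
  arguments are the ones to be pulled back along \<open>J\<close>. The last conjunct describes the
  critical point without \<open>crit\<close>: all below \<alpha> is fixed, and \<alpha> goes to
  \<kappa>', different from \<alpha>.\<close>

definition reflect :: "'a \<Rightarrow> 'a \<Rightarrow> 'a \<Rightarrow> 'a \<Rightarrow> bool" where
  "reflect W A \<kappa>' \<mu> \<longleftrightarrow> (\<exists>k\<in>sets. emb_rel k W \<and> opair lambda lambda \<in> elts k \<and>
     (\<exists>\<alpha>\<in>elts lambda. \<exists>\<beta>\<in>sets. opair \<alpha> \<beta> \<in> elts k \<and> \<beta> \<noteq> \<alpha>) \<and>
     restrict k (Vz lambda) \<in> elts W \<and>
     (\<exists>x\<in>elts W. opair x A \<in> elts k) \<and>
     (\<exists>y\<in>sets. opair empty y \<in> elts \<mu> \<and> opair \<kappa>' y \<in> elts k) \<and>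
     (\<forall>m\<in>elts omega. \<exists>y\<in>sets. \<exists>z\<in>sets. opair m y \<in> elts \<mu> \<and> opair (succ m) z \<in> elts \<mu> \<and> opair y z \<in> elts k) \<and>
     (\<exists>\<alpha>\<in>elts W. Ord \<alpha> \<and> opair \<alpha> \<kappa>' \<in> elts k \<and> \<alpha> \<noteq> \<kappa>' \<and> (\<forall>\<beta>\<in>elts \<alpha>. opair \<beta> \<beta> \<in> elts k)))"

lemma dfn_reflect:
  assumes "W \<in> Fixed"
  shows "dfn Fixed (\<lambda>e. reflect W (e 0) (e (Suc 0)) (e (Suc (Suc 0))))"
  unfolding reflect_def
  by (intro dfn_intros dfn_subst2[where P = emb_rel, OF _ _ dfn_emb_rel0] tm_Fixed_const lambda_Fixed assms)

lemma J_level: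
  assumes "\<eta> \<in> Fixed" "Ord \<eta>"
  shows "J (Vlev \<eta>) = Vlev \<eta>"
  using J_V[OF assms(2)] Fixed_J[OF assms(1)] by simp

text \<open>The witness is the restriction of \<open>J\<close> to \<open>W\<close>, a set by
  replacement although \<open>j\<close> is a proper class, and a map into \<open>W\<close> because
  \<open>J W = W\<close>.\<close>

lemma reflect_J:
  assumes \<eta>: "\<eta> \<in> Fixed" "Limit \<eta>" "lambda \<in> elts \<eta>" and A: "A \<in> elts (Vlev (succ lambda))"
  shows "reflect (Vlev \<eta>) (J A) (J \<kappa>) (J mu)"
proof -
  define W where "W = Vlev \<eta>"
  have o: "Ord \<eta>" using \<eta> Limit_Ord by blast
  have W: "W \<in> sets" "J W = W" "transitive W" using J_level[OF \<eta>(1) o] o V_transitive by (simp_all add: W_def)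
  have JW: "J x \<in> elts W" if "x \<in> elts W" for x using J_memI[OF W(1) that] W(2) by simp
  define k where "k = lam W J"
  have k: "k \<in> sets" "is_fun k W W" "\<And>x. x \<in> elts W \<Longrightarrow> app k x = J x" "elts k = (\<lambda>x. opair x (J x)) ` elts W"
    unfolding k_def using lam_aux[OF tm_J W(1)] lam_fun[OF tm_J W(1) JW] by auto
  have kI: "opair x (J x) \<in> elts k" if "x \<in> elts W" for x using k(4) that by blast
  have lamW: "lambda \<in> elts W" unfolding W_def using Ord_mem_V[OF o lambda(3)] \<eta>(3) by simp
  have lsub: "elts lambda \<subseteq> elts W" using lamW W(3) unfolding transitive_def by blast
  have LW: "L m \<in> elts W" if "m \<in> elts omega" for m using L_in_lambda[OF that] lsub by blast
  have emb: "emb_rel k W"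
    unfolding emb_rel_iff[OF k(1)] elementary_embedding_def
  proof (intro conjI ballI allI impI)
    show "is_fun k W W" by (rule k)
    fix p s assume p: "p \<in> elts Form" and s: "assignment W s"
    have ss: "s \<in> sets" "is_fun s omega W" using s unfolding assignment_def by auto
    note c = comp_facts[OF k(1,2) s]
    \<comment> \<open>Indices in omega are fixed, so \<open>J\<close> acts on an assignment by
      acting on its values.\<close>
    have "J s = comp k s"
    proof (rule fun_ext[OF _ c(2)])
      show "is_fun (J s) omega Univ" using J_fun(1)[OF ss(1) omega_sets is_fun_Univ[OF ss(2)]] by simp
      fix a assume a: "a \<in> elts omega"
      show "app (J s) a = app (comp k s) a"
        using J_fun(2)[OF ss(1) omega_sets is_fun_Univ[OF ss(2)] a] c(3)[OF a] k(3)[OF is_fun_app(1)[OF ss(2) a]] a by simp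
    qed
    \<comment> \<open>A single instance of the schema, with \<open>p\<close> and \<open>s\<close> as
      variables; the quantifier over coded formulas remains internal.\<close>
    moreover have "Sat W p s \<longleftrightarrow> Sat (J W) (J p) (J s)"
      by (rule elementarity3[OF dfn_Sat0 W(1) _ ss(1)]) (use p in simp)
    ultimately show "Sat W p s \<longleftrightarrow> Sat W p (comp k s)" using W(2) J_Form_in[OF p] by simp
  qed
  have VlF: "Vlev lambda \<in> sets" "J (Vlev lambda) = Vlev lambda" using lambda(3) J_level[OF lambda_Fixed lambda(3)] by simp_all
  \<comment> \<open>\<open>J\<close> maps \<open>V_lambda\<close> into itself, so the restriction is
    a relation on that level and appears below the limit \<eta>.\<close>
  have "restrict k (Vlev lambda) \<in> elts W" unfolding W_def
  proof (rule Limit_relation[OF \<eta>(2,3)])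
    show "restrict k (Vlev lambda) \<in> sets" using k VlF by simp
    fix q assume "q \<in> elts (restrict k (Vlev lambda))"
    then obtain x y where xy: "q = opair x y" "x \<in> elts (Vlev lambda)" "y \<in> sets" "opair x y \<in> elts k"
      unfolding elts_restrict[OF VlF(1)] by blast
    have "x \<in> sets" using xy elts_sets by blast
    then have "x \<in> elts W" "y = app k x" using is_fun_iff[OF k(2) _ xy(3)] xy(4) by auto
    then have "y = J x" using k(3) by simp
    then have "y \<in> elts (Vlev lambda)" using J_memI[OF VlF(1) xy(2)] VlF(2) by simp
    then show "\<exists>x\<in>elts (Vlev lambda). \<exists>y\<in>elts (Vlev lambda). q = opair x y" using xy by blast
  qed
  moreover have "opair lambda lambda \<in> elts k" using kI[OF lamW] J_lambda by simp
  moreover have "\<exists>\<alpha>\<in>elts lambda. \<exists>\<beta>\<in>sets. opair \<alpha> \<beta> \<in> elts k \<and> \<beta> \<noteq> \<alpha>"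
    using kI[of \<kappa>] \<kappa>_in_lambda lsub \<kappa>(2) J_sets[OF \<kappa>_sets] by blast
  moreover have "\<exists>x\<in>elts W. opair x (J A) \<in> elts k"
  proof -
    have "succ lambda \<in> elts \<eta>" using \<eta> unfolding Limit_def by blast
    then have "A \<in> elts W" using A V_mono_mem[OF o] unfolding W_def by blast
    then show ?thesis using kI by blast
  qed
  \<comment> \<open>\<open>mu\<close> starts at index 1 of the critical sequence and
    \<open>J\<close> shifts it once more, hence the two successors.\<close>
  moreover have Jmu: "opair m (L (succ (succ m))) \<in> elts (J mu)" if m: "m \<in> elts omega" for m
  proof -
    have "opair m (L (succ m)) \<in> elts mu" using is_fun_app(2)[OF mu(2) m] mu(3)[OF m] by simp
    then have "J (opair m (L (succ m))) \<in> elts (J mu)" using J_memI[OF mu(1)] by blast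
    then show ?thesis using J_opair[of m "L (succ m)"] m L(3)[of "succ m"] by simp
  qed
  moreover have "\<exists>y\<in>sets. opair empty y \<in> elts (J mu) \<and> opair (J \<kappa>) y \<in> elts k"
  proof -
    have "L (succ empty) = J \<kappa>" using L(2) L(3)[OF empty_omega] by simp
    then have "opair (J \<kappa>) (L (succ (succ empty))) \<in> elts k"
      using kI[OF LW[of "succ empty"]] L(3)[of "succ empty"] by simp
    then show ?thesis using Jmu[OF empty_omega] L_sets by (intro bexI[of _ "L (succ (succ empty))"]) auto
  qed
  moreover have "\<forall>m\<in>elts omega. \<exists>y\<in>sets. \<exists>z\<in>sets. opair m y \<in> elts (J mu) \<and> opair (succ m) z \<in> elts (J mu) \<and> opair y z \<in> elts k"
  proof
    fix m assume m: "m \<in> elts omega"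
    have "opair (L (succ (succ m))) (L (succ (succ (succ m)))) \<in> elts k"
      using kI[OF LW[of "succ (succ m)"]] L(3)[of "succ (succ m)"] m by simp
    then show "\<exists>y\<in>sets. \<exists>z\<in>sets. opair m y \<in> elts (J mu) \<and> opair (succ m) z \<in> elts (J mu) \<and> opair y z \<in> elts k"
      using Jmu[OF m] Jmu[OF succ_omega[OF m]] m
      by (intro bexI[of _ "L (succ (succ m))"] bexI[of _ "L (succ (succ (succ m)))"]) auto
  qed
  \<comment> \<open>On this side the witness is \<kappa>, with value \<open>J \<kappa>\<close>;
    after pulling back, some other ordinal with value \<kappa> takes its place.\<close>
  moreover have "\<exists>\<alpha>\<in>elts W. Ord \<alpha> \<and> opair \<alpha> (J \<kappa>) \<in> elts k \<and> \<alpha> \<noteq> J \<kappa> \<and> (\<forall>\<beta>\<in>elts \<alpha>. opair \<beta> \<beta> \<in> elts k)"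
  proof (intro bexI[of _ \<kappa>] conjI ballI)
    show kW: "\<kappa> \<in> elts W" using \<kappa>_in_lambda lsub by blast
    show "Ord \<kappa>" "opair \<kappa> (J \<kappa>) \<in> elts k" "\<kappa> \<noteq> J \<kappa>" using \<kappa>(1) kI[OF kW] \<kappa>(2) by auto
    fix \<beta> assume b: "\<beta> \<in> elts \<kappa>"
    then have "\<beta> \<in> elts W" using kW W(3) unfolding transitive_def by blast
    then show "opair \<beta> \<beta> \<in> elts k" using kI[of \<beta>] \<kappa>(3)[OF b] by simp
  qed
  ultimately show ?thesis unfolding reflect_def W_def[symmetric] using emb k(1) lambda(3) by (intro bexI[of _ k]) simp_all
qed

lemma elts_ident: "A \<in> sets \<Longrightarrow> elts (ident A) = (\<lambda>x. opair x x) ` elts A"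
proof -
  assume A: "A \<in> sets"
  have "dfn UNIV (\<lambda>e. \<exists>x\<in>elts A. e 0 = opair x x)" by (intro dfn_intros tm_UNIV_const A)
  then have "elts (ident A) = {p \<in> sets. \<exists>x\<in>elts A. p = opair x x}" unfolding ident_def by (rule elts_Coll)
  then show ?thesis using elts_sets by auto
qed

text \<open>The embedding is a witness of \<open>reflect\<close> and depends on \<open>A\<close>.
  For the restriction of \<open>j\<close> itself the requirement that \<open>A\<close> lie in its
  range could fail, and its critical point is not sent to \<kappa>.\<close>

theorem parametrically_ultraexact_critical_sequence:
  assumes n: "n > 0"
  shows "parametrically_ultraexact n (app (critical_sequence j) empty) (seq_shift (critical_sequence j))"
  unfolding critical_sequence_eq seq_shift_l l(3)[OF empty_omega] L(2) parametrically_ultraexact_def lambda_def[symmetric]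
proof (intro conjI ballI)
  show "mu \<in> sets" "is_fun mu omega Univ" by (fact mu)+
  show "Card (app mu m)" if "m \<in> elts omega" for m using mu(3)[OF that] L_Card[OF succ_omega[OF that]] by simp
  show "Card \<kappa>" by (rule Card_\<kappa>)
  show "\<kappa> \<in> elts (app mu empty)" using mu(3)[OF empty_omega] L_succ[OF empty_omega] L(2) by simp
next
  fix m i assume m: "m \<in> elts omega" and i: "i \<in> elts m"
  have iw: "i \<in> elts omega" using omega_transitive[OF m] i by blast
  have "L (succ i) \<in> elts (L (succ m))" using J_memI[OF L_sets L_mono[OF m i]] L(3)[OF m] L(3)[OF iw] m by simp
  then show "app mu i \<in> elts (app mu m)" using mu(3)[OF m] mu(3)[OF iw] by simp
next
  fix A assume A: "A \<in> elts (Vlev (succ lambda))"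
  obtain \<eta> where \<eta>: "\<eta> \<in> Fixed" "Limit \<eta>" "lambda \<in> elts \<eta>" "C_class n \<eta>" "C_class (n + 1) \<eta>"
    by (rule fixed_level[of n]) (rule that)
  define W where "W = Vlev \<eta>"
  have o: "Ord \<eta>" using \<eta> Limit_Ord by blast
  have W: "W \<in> sets" "W \<in> Fixed" using J_level[OF \<eta>(1) o] o by (simp_all add: W_def Fixed_def)
  have lamW: "lambda \<in> elts W" unfolding W_def using Ord_mem_V[OF o lambda(3)] \<eta>(3) by simp
  have As: "A \<in> sets" using A elts_sets by blast
  have "reflect W (J A) (J \<kappa>) (J mu)" unfolding W_def by (rule reflect_J[OF \<eta>(1-3) A])
  \<comment> \<open>Elementarity is used from right to left: the statement about the images yields
    the statement about \<open>A\<close>, \<kappa> and \<open>mu\<close>, with an unrelated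
    witness.\<close>
  then have "reflect W A \<kappa> mu"
    using elementarity3[of "reflect W", OF dfn_reflect[OF W(2)] As \<kappa>_sets mu(1)] by blast
  then obtain k where k: "k \<in> sets" "emb_rel k W" "opair lambda lambda \<in> elts k"
    "\<exists>\<alpha>\<in>elts lambda. \<exists>\<beta>\<in>sets. opair \<alpha> \<beta> \<in> elts k \<and> \<beta> \<noteq> \<alpha>"
    "restrict k (Vz lambda) \<in> elts W"
    "\<exists>x\<in>elts W. opair x A \<in> elts k"
    "\<exists>y\<in>sets. opair empty y \<in> elts mu \<and> opair \<kappa> y \<in> elts k"
    "\<forall>m\<in>elts omega. \<exists>y\<in>sets. \<exists>z\<in>sets. opair m y \<in> elts mu \<and> opair (succ m) z \<in> elts mu \<and> opair y z \<in> elts k"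
    "\<exists>\<alpha>\<in>elts W. Ord \<alpha> \<and> opair \<alpha> \<kappa> \<in> elts k \<and> \<alpha> \<noteq> \<kappa> \<and> (\<forall>\<beta>\<in>elts \<alpha>. opair \<beta> \<beta> \<in> elts k)"
    unfolding reflect_def by blast
  have kf: "is_fun k W W" using k(2) unfolding emb_rel_def by blast
  have kapp: "app k x = y" if "opair x y \<in> elts k" "x \<in> sets" "y \<in> sets" for x y
    using is_fun_iff[OF kf that(2,3)] that(1) by simp
  have muI: "y = L (succ m)" if "opair m y \<in> elts mu" "m \<in> elts omega" "y \<in> sets" for m y
    using is_fun_iff[OF mu(2), of m y] that mu(3) by simp
  have "restrict k lambda \<noteq> ident lambda"
  proof
    assume eq: "restrict k lambda = ident lambda"
    obtain \<alpha> \<beta> where ab: "\<alpha> \<in> elts lambda" "\<beta> \<in> sets" "opair \<alpha> \<beta> \<in> elts k" "\<beta> \<noteq> \<alpha>" using k(4) by blast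
    have "opair \<alpha> \<beta> \<in> elts (restrict k lambda)" unfolding elts_restrict[OF lambda(1)] using ab by blast
    then obtain x where "x \<in> elts lambda" "opair \<alpha> \<beta> = opair x x" unfolding eq elts_ident[OF lambda(1)] by blast
    then have "\<alpha> = x \<and> \<beta> = x" using opair_eq_iff ab(1,2) elts_sets by metis
    then show False using ab(4) by simp
  qed
  moreover have "elementary_submodel W W" unfolding elementary_submodel_def by simp
  moreover have "elts (Vlev lambda) \<union> {lambda} \<subseteq> elts W" using lamW V_mono_mem[OF o \<eta>(3)] unfolding W_def by simp
  moreover have "app k lambda = lambda" using kapp[OF k(3) lambda(1) lambda(1)] .
  moreover have "elementary_embedding k W W" using k(2) emb_rel_iff[OF k(1)] by blast
  moreover have "restrict k (Vlev lambda) \<in> elts W" using k(5) lambda(3) by simp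
  \<comment> \<open>The submodel \<open>X\<close> is all of \<open>V_\<eta>\<close>, and \<eta> also
    takes the role of \<zeta>.\<close>
  ultimately have "ultraexact_embedding n lambda \<eta> W \<eta> k"
    unfolding ultraexact_embedding_def W_def[symmetric] using n limit_Card_lambda \<eta> by simp
  moreover have "\<exists>x\<in>elts W. app k x = A" using k(6) kapp As elts_sets by blast
  moreover have "app k \<kappa> = app mu empty"
  proof -
    obtain y where y: "y \<in> sets" "opair empty y \<in> elts mu" "opair \<kappa> y \<in> elts k" using k(7) by blast
    then show ?thesis using kapp[OF y(3) \<kappa>_sets y(1)] muI[OF y(2) empty_omega y(1)] mu(3)[OF empty_omega] by simp
  qed
  moreover have "app k (app mu m) = app mu (succ m)" if m: "m \<in> elts omega" for m
  proof -
    obtain y z where y: "y \<in> sets" "z \<in> sets" "opair m y \<in> elts mu" "opair (succ m) z \<in> elts mu" "opair y z \<in> elts k"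
      using k(8) m by blast
    then show ?thesis using kapp[OF y(5,1,2)] muI[OF y(3) m y(1)] muI[OF y(4) succ_omega[OF m] y(2)]
        mu(3)[OF m] mu(3)[OF succ_omega[OF m]] by simp
  qed
  moreover have "app k (crit k W) = \<kappa>"
  proof -
    obtain \<alpha> where \<alpha>: "\<alpha> \<in> elts W" "Ord \<alpha>" "opair \<alpha> \<kappa> \<in> elts k" "\<alpha> \<noteq> \<kappa>" "\<forall>\<beta>\<in>elts \<alpha>. opair \<beta> \<beta> \<in> elts k" using k(9) by blast
    have ka: "app k \<alpha> = \<kappa>" using kapp[OF \<alpha>(3) Ord_sets[OF \<alpha>(2)] \<kappa>_sets] .
    have low: "app k \<beta> = \<beta>" if "\<beta> \<in> elts \<alpha>" for \<beta> using kapp[of \<beta> \<beta>] \<alpha>(5) that elts_sets[OF that] by blast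
    have below: "\<beta> \<in> elts W" if "\<beta> \<in> elts \<alpha>" for \<beta>
      using V_transitive[OF o] \<alpha>(1) that unfolding W_def transitive_def by blast
    \<comment> \<open>A competing candidate below \<alpha> would be fixed, and one above \<alpha>
      would require \<alpha> to be fixed.\<close>
    have "crit k W = \<alpha>" unfolding crit_def
    proof (rule the_equality)
      show "\<alpha> \<in> elts W \<and> Ord \<alpha> \<and> app k \<alpha> \<noteq> \<alpha> \<and> (\<forall>\<beta>\<in>elts \<alpha>. \<beta> \<in> elts W \<longrightarrow> app k \<beta> = \<beta>)"
        using \<alpha> ka low by auto
      fix \<gamma> assume g: "\<gamma> \<in> elts W \<and> Ord \<gamma> \<and> app k \<gamma> \<noteq> \<gamma> \<and> (\<forall>\<beta>\<in>elts \<gamma>. \<beta> \<in> elts W \<longrightarrow> app k \<beta> = \<beta>)"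
      then show "\<gamma> = \<alpha>" using Ord_linear[of \<gamma> \<alpha>] \<alpha>(1,2,4) ka low by auto
    qed
    then show ?thesis using ka by simp
  qed
  ultimately show "\<exists>\<eta>\<in>sets. \<exists>X\<in>sets. \<exists>\<zeta>\<in>sets. \<exists>k\<in>sets. ultraexact_embedding n lambda \<eta> X \<zeta> k \<and>
      (\<exists>x\<in>elts X. app k x = A) \<and> app k \<kappa> = app mu empty \<and>
      (\<forall>m\<in>elts omega. app k (app mu m) = app mu (succ m)) \<and> app k (crit k X) = \<kappa>"
    using Ord_sets[OF o] W(1) k(1) by blast
qed

end

theorem theorem5p2:
  fixes mem :: "'c \<Rightarrow> 'c \<Rightarrow> bool" and j l :: 'c and n :: nat
  assumes "nbg mem"
    and "class_structure.elementary_V mem j"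
    and "class_structure.nontrivial_V mem j"
    and "l = class_structure.critical_sequence mem j"
    and "n > 0"
  shows "class_structure.parametrically_ultraexact mem n
           (class_structure.app mem l (class_structure.empty mem))
           (class_structure.seq_shift mem l)"
proof -
  interpret nbg_embedding mem j
    using assms(1-3) by (simp add: nbg_embedding_def nbg_embedding_axioms_def)
  show ?thesis using parametrically_ultraexact_critical_sequence[OF assms(5)] by (simp add: assms(4))
qed

end
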